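(* Let $f:\mathbb{R}^2\to[0,\infty)$ be defined by $f(z)=e^{-\gamma|z|^2}$ with $\gamma>2\pi$. Let $\Lambda\subseteq\mathbb{R}^2$ be a lattice satisfying $D(\Lambda)>4$. Suppose that $$Z_{\lambda,\ell},\quad(\lambda,\ell)\in\Lambda\times\{1,2,3\},$$ is a sequence of independent $\mathbb{R}^2$-valued random variables, where each $Z_{\lambda,\ell}$ is uniformly distributed on the disk $B_{f(\lambda)}(\lambda)$. Then $\mathcal{U}=\{Z_{\lambda,\ell}:(\lambda,\ell)\in\Lambda\times\{1,2,3\}\}$ is a uniqueness set for the Gabor phase retrieval problem in $L^2(\mathbb{R})$ almost surely.
   Context: $\mathbb{R}^2$ is identified with $\mathbb{C}$. A lattice with periods $\omega_1,\omega_2\in\mathbb{C}\setminus\{0\}$, $\operatorname{Im}\frac{\omega_2}{\omega_1}>0$, is $\Lambda=\{m\omega_1+n\omega_2:m,n\in\mathbb{Z}\}$; its density is $D(\Lambda)=1/s(\Lambda)$ with $s(\Lambda)=\operatorname{Im}(\overline{\omega_1}\omega_2)$ the area of a period parallelogram. $B_r(z)$ is the closed ball of radius $r$ around $z$. $L^2(\mathbb{R})$ denotes the complex-valued square-integrable functions on $\mathbb{R}$. The Gabor transform of $g\in L^2(\mathbb{R})$ is $\mathcal{G}g(x,\omega)=\int_{\mathbb{R}}g(t)e^{-\pi(t-x)^2}e^{-2\pi i\omega t}\,dt$, $(x,\omega)\in\mathbb{R}^2$. A set $\mathcal{U}\subseteq\mathbb{R}^2$ is a uniqueness set for the Gabor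 phase retrieval problem in $X\subseteq L^2(\mathbb{R})$ if for all $g,h\in X$: whenever $|\mathcal{G}g(u)|=|\mathcal{G}h(u)|$ for all $u\in\mathcal{U}$, there is $\tau\in\mathbb{C}$ with $|\tau|=1$ and $g=\tau h$. *)

theory Defs
  imports "HOL-Probability.Probability"
begin

text \<open>The plane is the type \<^typ>\<open>complex\<close>: a time-frequency point \<open>(x, \<omega>)\<close> is the complex
  number with real part \<open>x\<close> and imaginary part \<open>\<omega>\<close>, and \<open>lborel :: complex measure\<close> is
  planar Lebesgue measure.\<close>

definition lattice_periods :: "complex \<Rightarrow> complex \<Rightarrow> bool" where
  "lattice_periods \<omega>\<^sub>1 \<omega>\<^sub>2 \<longleftrightarrow> \<omega>\<^sub>1 \<noteq> 0 \<and> \<omega>\<^sub>2 \<noteq> 0 \<and> Im (\<omega>\<^sub>2 / \<omega>\<^sub>1) > 0"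

definition lattice :: "complex \<Rightarrow> complex \<Rightarrow> complex set" where
  "lattice \<omega>\<^sub>1 \<omega>\<^sub>2 = {of_int m * \<omega>\<^sub>1 + of_int n * \<omega>\<^sub>2 | m n :: int. True}"

text \<open>The density depends only on the lattice, but is computed from a choice of periods.\<close>

definition lattice_area :: "complex \<Rightarrow> complex \<Rightarrow> real" where
  "lattice_area \<omega>\<^sub>1 \<omega>\<^sub>2 = Im (cnj \<omega>\<^sub>1 * \<omega>\<^sub>2)"

definition lattice_density :: "complex \<Rightarrow> complex \<Rightarrow> real" where
  "lattice_density \<omega>\<^sub>1 \<omega>\<^sub>2 = 1 / lattice_area \<omega>\<^sub>1 \<omega>\<^sub>2"

text \<open>Elements of \<open>L2\<close> are representatives; equality in \<open>L\<^sup>2(\<real>)\<close> is equality almost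
  everywhere, which is how \<open>g = \<tau> h\<close> is rendered in \<open>gabor_uniqueness_set\<close>.\<close>

definition L2 :: "(real \<Rightarrow> complex) set" where
  "L2 = {g. g \<in> borel_measurable lebesgue \<and> integrable lebesgue (\<lambda>t. (cmod (g t))\<^sup>2)}"

definition gabor_transform :: "(real \<Rightarrow> complex) \<Rightarrow> complex \<Rightarrow> complex" where
  "gabor_transform g z =
     (LINT t|lebesgue. g t * of_real (exp (- pi * (t - Re z)\<^sup>2))
                           * exp (- 2 * of_real pi * \<i> * of_real (Im z) * of_real t))"

definition gabor_uniqueness_set :: "complex set \<Rightarrow> (real \<Rightarrow> complex) set \<Rightarrow> bool" where
  "gabor_uniqueness_set U X \<longleftrightarrow>
     (\<forall>g\<in>X. \<forall>h\<in>X. (\<forall>u\<in>U. cmod (gabor_transform g u) = cmod (gabor_transform h u)) \<longrightarrow>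
        (\<exists>\<tau>::complex. cmod \<tau> = 1 \<and> (AE t in lebesgue. g t = \<tau> * h t)))"

end

theory Submission
  imports Defs "HOL-Complex_Analysis.Complex_Analysis"
begin

text \<open>
  Up to a factor of modulus \<open>exp (- \<pi>/2 \<bar>z\<bar>\<^sup>2)\<close> and a complex conjugation, the Gabor transform of \<open>g\<close> at the
  time-frequency point \<open>z\<close> is the value at \<open>z\<close> of an entire function \<open>F\<close> with \<open>\<bar>F z\<bar> \<le> C exp (\<pi>/2 \<bar>z\<bar>\<^sup>2)\<close>
  (\<open>cmod_gabor_eq_fock\<close>, \<open>fock_transform_growth\<close>). So one has to show that two such functions
  \<open>F\<close>, \<open>H\<close> with \<open>\<bar>F\<bar> = \<bar>H\<bar>\<close> on the random set agree up to a unimodular constant.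

  The function \<open>\<bar>F\<bar>\<^sup>2 - \<bar>H\<bar>\<^sup>2\<close> is not holomorphic, and its values on a lattice alone carry too little
  information. But three points in a tiny disc that are not too close to a common line also give its gradient,
  up to an error governed by the radius of the disc. Smallness of
  \<open>\<bar>F\<bar>\<^sup>2 - \<bar>H\<bar>\<^sup>2\<close> and of its gradient forces the Wronskian \<open>W = F' H - H' F\<close>, which is entire, to be small.
  The Wronskian grows at most like \<open>exp ((\<pi> + \<epsilon>) \<bar>z\<bar>\<^sup>2)\<close>; the radius \<open>exp (- \<gamma> \<bar>\<lambda>\<bar>\<^sup>2)\<close> enters the
  estimate for \<open>\<bar>W\<bar>\<^sup>2\<close> near \<open>\<lambda>\<close> against a factor \<open>exp (4 \<sqdot> \<pi>/2 \<sqdot> \<bar>\<lambda>\<bar>\<^sup>2)\<close> of four functions of growth \<open>\<pi>/2\<close>,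
  which is where \<open>\<gamma> > 2 \<pi>\<close> comes from. Hence \<open>W\<close> decays along the lattice.

  A dense lattice is a Liouville set: an entire function of subcritical Gaussian growth that is bounded on the
  lattice is constant (\<open>lattice_Liouville_bounded\<close>). This is proved by interpolation with the
  Weierstrass sigma function, taken here as a theta function given by an infinite product. The interpolation
  bounds the function on a period cell by its supremum on the lattice, with a constant
  that does not depend on the function, so that translating by lattice vectors gives a global bound.
  Consequently \<open>W = 0\<close>, \<open>F\<close> is a constant multiple of \<open>H\<close>, and the constant is
  unimodular unless \<open>H\<close> vanishes on the whole sample set, when the Liouville property gives
  \<open>H = 0\<close> (\<open>phase_retrieval_from_triples\<close>). Injectivity of the Fourier transform carries the
  result back from \<open>F\<close> to \<open>g\<close>.

  Finally, three independent uniform points in a disc lie within relative distance \<open>\<epsilon>\<close> of a common line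
  with probability at most \<open>8 \<epsilon>\<close>. With \<open>\<epsilon> = exp (- \<eta> \<bar>\<lambda>\<bar>\<^sup>2) / n\<close> these probabilities are summable over the lattice
  with a sum of order \<open>1 / n\<close>, so almost surely some \<open>n\<close> works for all \<open>\<lambda>\<close> at once. Choosing \<open>\<eta> < \<gamma> - 2 \<pi>\<close>
  makes the loss harmless in the deterministic argument.
\<close>

section \<open>A theta function with zeros on a lattice\<close>

text \<open>
  The function is the \<open>q\<close>-Pochhammer symbol \<open>(u; p)\<^sub>\<infinity> = \<Prod>n. (1 - p\<^sup>n u)\<close>. Its functional equation is all that is
  needed to build a theta function whose zeros are known by construction.
\<close>

lemma q_product_exists:
  fixes p :: complex
  assumes p: "norm p < 1"
  obtains P where "P holomorphic_on UNIV" "\<And>u. P u = (1 - u) * P (p * u)"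
    "\<And>u. P u = 0 \<longleftrightarrow> (\<exists>n. p ^ n * u = 1)"
proof
  define P where "P = (\<lambda>u. \<Prod>n. 1 - p ^ n * u)"
  have summ: "summable (\<lambda>n. norm (p ^ n * u))" for u
    using p by (simp add: norm_mult norm_power summable_geometric summable_mult2)
  have conv: "convergent_prod (\<lambda>n. 1 - p ^ n * u)" for u
    by (rule abs_convergent_prod_imp_convergent_prod, rule summable_imp_abs_convergent_prod)
       (use summ[of u] in \<open>simp add: norm_minus_commute\<close>)
  have lim: "(\<lambda>N. \<Prod>n<N. 1 - p ^ n * u) \<longlonglongrightarrow> P u" for u
    using convergent_prod_LIMSEQ[OF conv[of u]] unfolding P_def
    by (subst LIMSEQ_lessThan_iff_atMost)
  have ulim: "uniform_limit (cball x 1) (\<lambda>N u. \<Prod>n<N. 1 - p ^ n * u) P sequentially" for x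
  proof -
    have "uniformly_convergent_on (cball x 1) (\<lambda>N u. \<Sum>n<N. norm (1 - p ^ n * u - 1))"
    proof (rule Weierstrass_m_test'[where M = "\<lambda>n. norm p ^ n * (norm x + 1)"])
      fix n u assume "u \<in> cball x 1"
      hence "norm u \<le> norm x + 1"
        by (metis add.commute dist_commute mem_cball norm_triangle_le_diff dist_norm diff_add_cancel add_le_cancel_right norm_triangle_sub order_trans)
      thus "norm (norm (1 - p ^ n * u - 1)) \<le> norm p ^ n * (norm x + 1)"
        by (simp add: norm_mult norm_power mult_left_mono)
    qed (use p in \<open>simp add: summable_geometric summable_mult2\<close>)
    hence "uniformly_convergent_on (cball x 1) (\<lambda>N u. \<Prod>n<N. 1 - p ^ n * u)"
      by (intro uniformly_convergent_on_prod') (auto intro!: continuous_intros)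
    then obtain l where l: "uniform_limit (cball x 1) (\<lambda>N u. \<Prod>n<N. 1 - p ^ n * u) l sequentially"
      by (auto simp: uniformly_convergent_on_def)
    have "l u = P u" if "u \<in> cball x 1" for u
      using tendsto_uniform_limitI[OF l that] lim[of u] LIMSEQ_unique by blast
    thus ?thesis using l uniform_limit_cong'[of "cball x 1"] by (metis (no_types, lifting))
  qed
  show "P holomorphic_on UNIV"
    by (rule holomorphic_uniform_sequence[where f = "\<lambda>N u. \<Prod>n<N. 1 - p ^ n * u"])
       (use ulim in \<open>auto intro!: holomorphic_intros exI[of _ 1]\<close>)
  have step: "P u = (1 - u) * P (p * u)" for u
  proof -
    have "(\<lambda>N. (1 - u) * (\<Prod>n<N. 1 - p ^ n * (p * u))) \<longlonglongrightarrow> (1 - u) * P (p * u)"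
      by (intro tendsto_intros lim)
    moreover have "(1 - u) * (\<Prod>n<N. 1 - p ^ n * (p * u)) = (\<Prod>n<Suc N. 1 - p ^ n * u)" for N
      by (subst prod.lessThan_Suc_shift) (simp add: mult.assoc mult.left_commute)
    ultimately have "(\<lambda>N. (\<Prod>n<Suc N. 1 - p ^ n * u)) \<longlonglongrightarrow> (1 - u) * P (p * u)" by simp
    thus ?thesis using LIMSEQ_Suc[OF lim[of u]] LIMSEQ_unique by blast
  qed
  show "P u = (1 - u) * P (p * u)" for u by (rule step)
  show "P u = 0 \<longleftrightarrow> (\<exists>n. p ^ n * u = 1)" for u
  proof
    assume "P u = 0"
    thus "\<exists>n. p ^ n * u = 1"
      using prodinf_nonzero[OF conv[of u]] by (auto simp: P_def)
  next
    have *: "P u = (\<Prod>k<n. 1 - p ^ k * u) * P (p ^ n * u)" for n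
    proof (induction n)
      case (Suc n)
      show ?case unfolding Suc by (subst step[of "p ^ n * u"]) (simp add: mult_ac)
    qed simp
    assume "\<exists>n. p ^ n * u = 1"
    then obtain n where n: "p ^ n * u = 1" by blast
    have "P 1 = 0" using step[of 1] by simp
    thus "P u = 0" using *[of n] n by simp
  qed
qed


lemma exp_two_pi_i_eq_1_iff:
  "exp (2 * of_real pi * \<i> * w) = 1 \<longleftrightarrow> (\<exists>m::int. w = of_int m)"
proof -
  have "exp (2 * of_real pi * \<i> * w) = 1 \<longleftrightarrow> Im w = 0 \<and> (\<exists>m::int. Re w = of_int m)"
    by (auto simp: exp_eq_1 mult.commute)
  also have "\<dots> \<longleftrightarrow> (\<exists>m::int. w = of_int m)"
    by (auto simp: complex_eq_iff)
  finally show ?thesis .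
qed

lemma int_multiple_period:
  fixes f :: "'b::ring_1 \<Rightarrow> 'c"
  assumes "\<And>z. f (z + w) = f z"
  shows "f (z + of_int m * w) = f z"
proof (induction m rule: int_induct[where k = 0])
  case (step1 i)
  thus ?case using assms[of "z + of_int i * w"] by (simp add: algebra_simps)
next
  case (step2 i)
  thus ?case using assms[of "z + of_int (i - 1) * w"] by (simp add: algebra_simps)
qed simp

text \<open>
  With \<open>u = exp (2 \<pi> \<i> z)\<close> and \<open>p = exp (2 \<pi> \<i> \<tau>)\<close>, the theta function \<open>(u; p)\<^sub>\<infinity> (p / u; p)\<^sub>\<infinity>\<close> has
  period \<open>1\<close> and picks up the factor \<open>- 1 / u\<close> under \<open>z \<mapsto> z + \<tau>\<close>. Multiplying it by the exponential of a suitable quadratic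
  polynomial turns this into periodicity of \<open>\<bar>S z\<bar> exp (- \<kappa> \<bar>z\<bar>\<^sup>2)\<close> under the whole lattice: \<open>S\<close> is the
  Weierstrass sigma function up to a factor \<open>exp (c z\<^sup>2)\<close>. The number \<open>\<kappa>\<close> is the critical rate of
  Gaussian growth for the lattice. The quotient \<open>G z = S z / z\<close> vanishes at all
  nonzero lattice points and is normalised at \<open>0\<close>, so it serves as interpolation kernel.
\<close>

lemma lattice_sigma_function:
  fixes \<tau> :: complex
  assumes \<tau>: "Im \<tau> > 0" and \<kappa>: "\<kappa> = pi / (2 * Im \<tau>)"
  obtains S G where "S holomorphic_on UNIV" "G holomorphic_on UNIV" "\<And>z. S z = z * G z" "G 0 = 1"
    "\<And>z. S z = 0 \<longleftrightarrow> z \<in> lattice 1 \<tau>"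
    "\<And>z l. l \<in> lattice 1 \<tau> \<Longrightarrow>
       norm (S (z + l)) = norm (S z) * exp (\<kappa> * ((norm (z + l))\<^sup>2 - (norm z)\<^sup>2))"
proof -
  define u where "u = (\<lambda>z. exp (2 * of_real pi * \<i> * z))"
  define p where "p = u \<tau>"
  have u_add: "u (z + w) = u z * u w" for z w by (simp add: u_def exp_add ring_distribs)
  have u_mult: "u (of_nat n * w) = u w ^ n" for n w
    by (induction n) (auto simp: u_add ring_distribs, simp add: u_def)
  have u_minus: "u (- w) = inverse (u w)" for w by (simp add: u_def exp_minus)
  have u_nz [simp]: "u z \<noteq> 0" for z by (simp add: u_def)
  have u1: "u w = 1 \<longleftrightarrow> (\<exists>m::int. w = of_int m)" for w
    unfolding u_def by (rule exp_two_pi_i_eq_1_iff)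
  have u_hol: "u holomorphic_on A" for A unfolding u_def by (intro holomorphic_intros)
  have norm_u: "norm (u z) = exp (- 2 * pi * Im z)" for z by (simp add: u_def)
  have "norm p < 1" using \<tau> by (simp add: p_def norm_u)
  then obtain P where P_hol: "P holomorphic_on UNIV" and P_step: "\<And>u. P u = (1 - u) * P (p * u)"
    and P_zero: "\<And>u. P u = 0 \<longleftrightarrow> (\<exists>n. p ^ n * u = 1)"
    using q_product_exists by blast
  have P_hol': "(\<lambda>z. P (f z)) holomorphic_on UNIV" if "f holomorphic_on UNIV" for f
    using holomorphic_on_compose_gen[OF that P_hol] by (simp add: o_def)
  define \<theta> where "\<theta> = (\<lambda>z. P (u z) * P (p / u z))"
  have \<theta>_zero: "\<theta> z = 0 \<longleftrightarrow> z \<in> lattice 1 \<tau>" for z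
  proof -
    have 1: "p ^ n * u z = u (of_nat n * \<tau> + z)" for n by (simp add: p_def u_add u_mult)
    have 2: "p ^ n * (p / u z) = u (of_nat (Suc n) * \<tau> - z)" for n
      unfolding diff_conv_add_uminus u_add u_mult u_minus p_def by (simp add: divide_inverse)
    have "\<theta> z = 0 \<longleftrightarrow> (\<exists>n m::int. z = of_int m + of_int n * \<tau>)"
    proof
      assume "\<theta> z = 0"
      then consider (a) n m where "of_nat n * \<tau> + z = of_int m" 
        | (b) n m where "of_nat (Suc n) * \<tau> - z = of_int m"
        unfolding \<theta>_def mult_eq_0_iff P_zero 1 2 u1 by blast
      thus "\<exists>n m::int. z = of_int m + of_int n * \<tau>"
      proof cases
        case (a n m)
        hence "z = of_int m + of_int (- int n) * \<tau>" by (simp add: algebra_simps)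
        thus ?thesis by blast
      next
        case (b n m)
        hence "z = of_int (- m) + of_int (int (Suc n)) * \<tau>" by (simp add: algebra_simps)
        thus ?thesis by blast
      qed
    next
      assume "\<exists>n m::int. z = of_int m + of_int n * \<tau>"
      then obtain n m :: int where z: "z = of_int m + of_int n * \<tau>" by blast
      show "\<theta> z = 0"
      proof (cases "n \<le> 0")
        case True
        hence "of_nat (nat (- n)) * \<tau> + z = of_int m" by (simp add: z of_nat_nat)
        thus ?thesis unfolding \<theta>_def mult_eq_0_iff P_zero 1 2 u1 by blast
      next
        case False
        hence "of_nat (Suc (nat (n - 1))) * \<tau> - z = of_int (- m)" 
          by (simp add: z of_nat_nat algebra_simps)
        thus ?thesis unfolding \<theta>_def mult_eq_0_iff P_zero 1 2 u1 by blast
      qed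
    qed
    thus ?thesis by (auto simp: lattice_def)
  qed
  have \<theta>_1: "\<theta> (z + 1) = \<theta> z" for z
  proof -
    have "u 1 = 1" unfolding u1 by (intro exI[of _ 1]) simp
    thus ?thesis by (simp add: \<theta>_def u_add)
  qed
  have \<theta>_\<tau>: "\<theta> (z + \<tau>) = - \<theta> z / u z" for z
  proof -
    have "\<theta> (z + \<tau>) = P (p * u z) * P (1 / u z)"
      unfolding \<theta>_def u_add p_def[symmetric] by (simp add: mult.commute) (simp add: p_def)
    thus ?thesis
      unfolding \<theta>_def P_step[of "u z"] P_step[of "1 / u z"] by (simp add: field_simps)
  qed
  \<comment> \<open>\<open>\<Phi>\<close> depends only on \<open>\<bar>\<theta>\<bar>\<close> and the imaginary part, since \<open>Re (z\<^sup>2) - \<bar>z\<bar>\<^sup>2 = - 2 (Im z)\<^sup>2\<close>.\<close>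
  define S0 where "S0 = (\<lambda>z. \<theta> z * exp (of_real \<kappa> * z\<^sup>2 - \<i> * of_real pi * z))"
  define \<Phi> where "\<Phi> = (\<lambda>z. norm (S0 z) * exp (- \<kappa> * (norm z)\<^sup>2))"
  have \<Phi>_eq: "\<Phi> z = norm (\<theta> z) * exp (- 2 * \<kappa> * (Im z)\<^sup>2 + pi * Im z)" for z
    unfolding \<Phi>_def S0_def cmod_power2
    by (simp add: norm_mult mult.assoc exp_add [symmetric] power2_eq_square algebra_simps)
  have \<Phi>_1: "\<Phi> (z + 1) = \<Phi> z" for z by (simp add: \<Phi>_eq \<theta>_1)
  have \<Phi>_\<tau>: "\<Phi> (z + \<tau>) = \<Phi> z" for z
  proof -
    have \<kappa>_pi: "2 * \<kappa> * Im \<tau> = pi" using \<tau> by (simp add: \<kappa>)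
    have *: "- 2 * \<kappa> * (Im z + Im \<tau>)\<^sup>2 + pi * (Im z + Im \<tau>) 
            = - 2 * pi * Im z + (- 2 * \<kappa> * (Im z)\<^sup>2 + pi * Im z)"
      unfolding \<kappa>_pi[symmetric] by (simp add: power2_eq_square algebra_simps)
    show ?thesis unfolding \<Phi>_eq \<theta>_\<tau> norm_divide norm_minus_cancel norm_u plus_complex.sel *
      by (subst exp_add) simp
  qed
  have \<Phi>_lattice: "\<Phi> (z + l) = \<Phi> z" if l_in: "l \<in> lattice 1 \<tau>" for z l
  proof -
    obtain m n :: int where l: "l = of_int m * 1 + of_int n * \<tau>" using l_in unfolding lattice_def by blast
    have "\<Phi> (z + of_int m * 1 + of_int n * \<tau>) = \<Phi> (z + of_int m * 1)"
      by (rule int_multiple_period) (rule \<Phi>_\<tau>)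
    also have "\<dots> = \<Phi> z" by (rule int_multiple_period) (rule \<Phi>_1)
    finally show ?thesis by (simp add: l add.assoc)
  qed
  define R where "R = (\<lambda>z. P (p * u z) * P (p / u z) * exp (of_real \<kappa> * z\<^sup>2 - \<i> * of_real pi * z))"
  have S0_R: "S0 z = (1 - u z) * R z" for z
    using P_step[of "u z"] by (simp add: S0_def \<theta>_def R_def)
  have R_hol: "R holomorphic_on UNIV"
    unfolding R_def by (intro holomorphic_intros P_hol' u_hol) auto
  have S0_hol: "S0 holomorphic_on UNIV"
    unfolding S0_R by (intro holomorphic_intros R_hol u_hol)
  have R0: "R 0 \<noteq> 0"
  proof -
    have "p ^ n * p \<noteq> 1" for n
    proof
      assume "p ^ n * p = 1"
      hence "norm p ^ Suc n = 1" by (metis norm_one norm_power power_Suc2)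
      thus False using \<open>norm p < 1\<close> using power_Suc_less_one[of "norm p" n] by (cases "p = 0") auto
    qed
    hence "P p \<noteq> 0" by (simp add: P_zero)
    moreover have "u 0 = 1" by (simp add: u_def)
    ultimately show ?thesis by (simp add: R_def)
  qed
  have D: "(S0 has_field_derivative - (2 * of_real pi * \<i>) * R 0) (at 0)"
  proof -
    have "(R has_field_derivative deriv R 0) (at 0)"
      using R_hol by (simp add: holomorphic_derivI)
    moreover have "((\<lambda>z. 1 - u z) has_field_derivative - (2 * of_real pi * \<i>)) (at 0)"
      unfolding u_def by (auto intro!: derivative_eq_intros)
    ultimately have "((\<lambda>z. (1 - u z) * R z) has_field_derivative 
        - (2 * of_real pi * \<i>) * R 0 + deriv R 0 * (1 - u 0)) (at 0)"
      by (rule DERIV_mult[rotated])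
    moreover have "u 0 = 1" by (simp add: u_def)
    ultimately show ?thesis by (simp add: S0_R [abs_def])
  qed
  define d where "d = - (2 * of_real pi * \<i>) * R 0"
  have d: "d \<noteq> 0" using R0 by (simp add: d_def)
  define S where "S = (\<lambda>z. S0 z / d)"
  define G where "G = (\<lambda>z. if z = 0 then 1 else S z / z)"
  have S_hol: "S holomorphic_on UNIV" unfolding S_def by (intro holomorphic_intros S0_hol d)
  have S00: "S 0 = 0" by (simp add: S_def S0_R u_def)
  have SD: "deriv S 0 = 1"
  proof (rule DERIV_imp_deriv)
    show "(S has_field_derivative 1) (at 0)"
      unfolding S_def using DERIV_cdivide[OF D, of d] d by (simp add: d_def)
  qed
  have G_hol: "G holomorphic_on UNIV"
    by (rule pole_theorem_open_0[OF S_hol, where a = 0]) (auto simp: G_def SD S00)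
  show ?thesis
  proof (rule that[OF S_hol G_hol])
    show "S z = z * G z" for z by (simp add: G_def S00)
    show "G 0 = 1" by (simp add: G_def)
    show "S z = 0 \<longleftrightarrow> z \<in> lattice 1 \<tau>" for z using d by (simp add: S_def S0_def \<theta>_zero)
    show "norm (S (z + l)) = norm (S z) * exp (\<kappa> * ((norm (z + l))\<^sup>2 - (norm z)\<^sup>2))"
      if "l \<in> lattice 1 \<tau>" for z l
      using \<Phi>_lattice[OF that, of z] d
      by (simp add: \<Phi>_def S_def norm_divide exp_minus exp_diff right_diff_distrib field_simps)
  qed
qed

section \<open>Gaussian sums over lattices\<close>

text \<open>
  The coordinates of \<open>z\<close> with respect to the periods are \<open>Im (cnj \<omega>\<^sub>1 z)\<close> and \<open>Im (cnj z \<omega>\<^sub>2)\<close> divided by the area,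
  so the Euclidean norm dominates them.
\<close>

lemma lattice_coordinates:
  fixes \<omega>\<^sub>1 \<omega>\<^sub>2 :: complex
  assumes D: "lattice_area \<omega>\<^sub>1 \<omega>\<^sub>2 > 0"
  obtains L where "L > 0" "\<And>a b :: real. a\<^sup>2 + b\<^sup>2 \<le> L * (cmod (of_real a * \<omega>\<^sub>1 + of_real b * \<omega>\<^sub>2))\<^sup>2"
proof -
  define D where "D = lattice_area \<omega>\<^sub>1 \<omega>\<^sub>2"
  define L where "L = ((cmod \<omega>\<^sub>1)\<^sup>2 + (cmod \<omega>\<^sub>2)\<^sup>2) / D\<^sup>2"
  have D0: "D > 0" using D by (simp add: D_def)
  have "\<omega>\<^sub>1 \<noteq> 0" using D by (auto simp: lattice_area_def)
  hence "L > 0" using D0 by (auto simp: L_def intro!: divide_pos_pos add_pos_nonneg)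
  moreover have "a\<^sup>2 + b\<^sup>2 \<le> L * (cmod (of_real a * \<omega>\<^sub>1 + of_real b * \<omega>\<^sub>2))\<^sup>2" for a b
  proof -
    define z where "z = of_real a * \<omega>\<^sub>1 + of_real b * \<omega>\<^sub>2"
    have "b * D = Im (cnj \<omega>\<^sub>1 * z)" 
      by (simp add: z_def D_def lattice_area_def algebra_simps)
    hence "\<bar>b * D\<bar> \<le> cmod \<omega>\<^sub>1 * cmod z" using abs_Im_le_cmod[of "cnj \<omega>\<^sub>1 * z"] by (simp add: norm_mult)
    hence "(b * D)\<^sup>2 \<le> (cmod \<omega>\<^sub>1 * cmod z)\<^sup>2" by (rule power2_le_iff_abs_le[THEN iffD2, rotated]) auto
    moreover have "a * D = Im (cnj z * \<omega>\<^sub>2)" 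
      by (simp add: z_def D_def lattice_area_def algebra_simps)
    hence "\<bar>a * D\<bar> \<le> cmod z * cmod \<omega>\<^sub>2" using abs_Im_le_cmod[of "cnj z * \<omega>\<^sub>2"] by (simp add: norm_mult)
    hence "(a * D)\<^sup>2 \<le> (cmod z * cmod \<omega>\<^sub>2)\<^sup>2" by (rule power2_le_iff_abs_le[THEN iffD2, rotated]) auto
    ultimately have "(a\<^sup>2 + b\<^sup>2) * D\<^sup>2 \<le> ((cmod \<omega>\<^sub>1)\<^sup>2 + (cmod \<omega>\<^sub>2)\<^sup>2) * (cmod z)\<^sup>2"
      by (simp add: power_mult_distrib algebra_simps)
    thus ?thesis unfolding z_def[symmetric] L_def using D0 by (simp add: field_simps)
  qed
  ultimately show ?thesis by (rule that)
qed

lemma summable_gaussian_int: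
  fixes c :: real
  assumes "c > 0"
  shows "(\<lambda>m::int. exp (- c * (of_int m)\<^sup>2)) summable_on UNIV"
proof -
  let ?f = "\<lambda>m::int. exp (- c * (of_int m)\<^sup>2)"
  have nat: "(\<lambda>n::nat. exp (- c * (of_nat n)\<^sup>2)) summable_on UNIV"
  proof (rule norm_summable_imp_summable_on, rule summable_comparison_test')
    show "summable (\<lambda>n. exp (- c) ^ n)" using assms by (intro summable_geometric) simp
    show "norm (norm (exp (- c * (of_nat n)\<^sup>2))) \<le> exp (- c) ^ n" if "n \<ge> 0" for n :: nat
    proof -
      have "real n \<le> (real n)\<^sup>2"
        by (cases n) (auto simp: power2_eq_square)
      thus ?thesis using assms by (simp add: exp_of_nat_mult[symmetric] mult.commute[of "real n"])
    qed
  qed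
  have "?f summable_on (range int)"
    by (subst summable_on_reindex) (use nat in \<open>auto simp: o_def\<close>)
  moreover have "?f summable_on (range (\<lambda>n. - int n))"
    by (subst summable_on_reindex) (use nat in \<open>auto simp: o_def inj_def\<close>)
  ultimately have "?f summable_on (range int \<union> range (\<lambda>n. - int n))" by (rule summable_on_union)
  moreover have "range int \<union> range (\<lambda>n. - int n) = UNIV"
  proof -
    have "x \<in> range int \<union> range (\<lambda>n. - int n)" for x :: int
      by (cases x rule: int_cases2) auto
    thus ?thesis by blast
  qed
  ultimately show ?thesis by simp
qed

lemma lattice_periods_area_pos:
  assumes "lattice_periods \<omega>\<^sub>1 \<omega>\<^sub>2"
  shows "lattice_area \<omega>\<^sub>1 \<omega>\<^sub>2 > 0"
proof -
  have "\<omega>\<^sub>1 \<noteq> 0" "Im (\<omega>\<^sub>2 / \<omega>\<^sub>1) > 0" using assms by (auto simp: lattice_periods_def)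
  moreover have "Im (\<omega>\<^sub>2 / \<omega>\<^sub>1) = lattice_area \<omega>\<^sub>1 \<omega>\<^sub>2 / (cmod \<omega>\<^sub>1)\<^sup>2"
    by (subst complex_div_cnj) (simp add: lattice_area_def mult.commute)
  ultimately show ?thesis by (simp add: zero_less_divide_iff)
qed

lemma countable_lattice: "countable (lattice \<omega>\<^sub>1 \<omega>\<^sub>2)"
proof -
  have "lattice \<omega>\<^sub>1 \<omega>\<^sub>2 = (\<lambda>(m::int, n::int). of_int m * \<omega>\<^sub>1 + of_int n * \<omega>\<^sub>2) ` UNIV"
    by (auto simp: lattice_def)
  thus ?thesis by simp
qed

lemma summable_gaussian_lattice:
  fixes \<omega>\<^sub>1 \<omega>\<^sub>2 :: complex and \<eta> :: real
  assumes D: "lattice_area \<omega>\<^sub>1 \<omega>\<^sub>2 > 0" and \<eta>: "\<eta> > 0"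
  shows "(\<lambda>z. exp (- \<eta> * (cmod z)\<^sup>2)) summable_on lattice \<omega>\<^sub>1 \<omega>\<^sub>2"
proof -
  obtain L where L: "L > 0" "\<And>a b :: real. a\<^sup>2 + b\<^sup>2 \<le> L * (cmod (of_real a * \<omega>\<^sub>1 + of_real b * \<omega>\<^sub>2))\<^sup>2"
    using lattice_coordinates[OF D] by blast
  define h where "h = (\<lambda>(m::int, n::int). of_int m * \<omega>\<^sub>1 + of_int n * \<omega>\<^sub>2)"
  define c where "c = \<eta> / L"
  have c: "c > 0" using L \<eta> by (simp add: c_def)
  have bound: "(of_int m)\<^sup>2 + (of_int n)\<^sup>2 \<le> L * (cmod (h (m, n)))\<^sup>2" for m n
    using L(2)[of "of_int m" "of_int n"] by (simp add: h_def)
  have inj: "inj h"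
  proof (rule injI, clarify)
    fix m n m' n' assume "h (m, n) = h (m', n')"
    hence "h (m - m', n - n') = 0" by (simp add: h_def algebra_simps)
    hence "(of_int (m - m'))\<^sup>2 + (of_int (n - n'))\<^sup>2 \<le> (0::real)"
      using bound[of "m - m'" "n - n'"] by simp
    thus "m = m' \<and> n = n'" by (simp add: sum_power2_le_zero_iff)
  qed
  let ?e = "\<lambda>m::int. exp (- c * (of_int m)\<^sup>2)"
  have "(\<lambda>(m, n). ?e m * ?e n) summable_on UNIV \<times> UNIV"
    by (rule summable_on_SigmaI[where g = "\<lambda>m. ?e m * infsum ?e UNIV"])
       (use summable_gaussian_int[OF c] in \<open>auto intro!: has_sum_cmult_right summable_on_cmult_left\<close>)
  hence "(\<lambda>z. exp (- \<eta> * (cmod (h z))\<^sup>2)) summable_on UNIV"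
    unfolding UNIV_Times_UNIV
  proof (rule summable_on_comparison_test, goal_cases)
    case (1 z)
    obtain m n where z: "z = (m, n)" by (cases z)
    have "c * ((of_int m)\<^sup>2 + (of_int n)\<^sup>2) \<le> c * (L * (cmod (h z))\<^sup>2)"
      using bound[of m n] c by (intro mult_left_mono) (auto simp: z)
    also have "\<dots> = \<eta> * (cmod (h z))\<^sup>2" using L by (simp add: c_def)
    finally show ?case by (simp add: z exp_add[symmetric] algebra_simps)
  qed auto
  hence "(\<lambda>z. exp (- \<eta> * (cmod z)\<^sup>2)) summable_on (h ` UNIV)"
    by (subst summable_on_reindex[OF inj]) (simp add: o_def)
  moreover have "lattice \<omega>\<^sub>1 \<omega>\<^sub>2 = h ` UNIV" by (auto simp: lattice_def h_def)
  ultimately show ?thesis by simp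
qed

section \<open>The Liouville property of lattices\<close>

text \<open>
  The difference of the two sides is the square of \<open>(\<beta> - \<alpha>) s - \<alpha> t\<close> divided by \<open>\<beta> - \<alpha>\<close>. Gaussian growth is therefore
  stable under bounded translations at the price of an arbitrarily small increase of the rate.
\<close>

lemma quadratic_shift_bound:
  fixes s t :: real
  assumes "0 \<le> \<alpha>" "\<alpha> < \<beta>"
  shows "\<alpha> * (s + t)\<^sup>2 \<le> \<beta> * s\<^sup>2 + \<alpha> * \<beta> / (\<beta> - \<alpha>) * t\<^sup>2"
proof -
  have "0 \<le> ((\<beta> - \<alpha>) * s - \<alpha> * t)\<^sup>2 / (\<beta> - \<alpha>)" using assms by simp
  also have "\<dots> = \<beta> * s\<^sup>2 + \<alpha> * \<beta> / (\<beta> - \<alpha>) * t\<^sup>2 - \<alpha> * (s + t)\<^sup>2"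
    using assms by (simp add: divide_simps) (simp add: power2_eq_square algebra_simps)
  finally show ?thesis by simp
qed

lemma gaussian_growth_shift:
  assumes "0 \<le> \<alpha>" "\<alpha> < \<beta>" "cmod w \<le> r"
  shows "exp (\<alpha> * (cmod (z + w))\<^sup>2) \<le> exp (\<alpha> * \<beta> / (\<beta> - \<alpha>) * r\<^sup>2) * exp (\<beta> * (cmod z)\<^sup>2)"
proof -
  have "cmod (z + w) \<le> cmod z + r" using norm_triangle_ineq[of z w] assms by linarith
  hence "\<alpha> * (cmod (z + w))\<^sup>2 \<le> \<alpha> * (cmod z + r)\<^sup>2"
    using assms by (intro mult_left_mono power_mono) auto
  also note quadratic_shift_bound[OF assms(1,2)]
  finally show ?thesis by (simp add: exp_add[symmetric] add.commute)
qed

lemma lattice_add: "\<lbrakk>x \<in> lattice a b; y \<in> lattice a b\<rbrakk> \<Longrightarrow> x + y \<in> lattice a b"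
proof -
  assume "x \<in> lattice a b" "y \<in> lattice a b"
  then obtain m n m' n' :: int where "x = of_int m * a + of_int n * b" "y = of_int m' * a + of_int n' * b"
    unfolding lattice_def by blast
  hence "x + y = of_int (m + m') * a + of_int (n + n') * b" by (simp add: algebra_simps)
  thus ?thesis unfolding lattice_def by blast
qed

lemma lattice_uminus: "x \<in> lattice a b \<Longrightarrow> - x \<in> lattice a b"
proof -
  assume "x \<in> lattice a b"
  then obtain m n :: int where "x = of_int m * a + of_int n * b"
    unfolding lattice_def by blast
  hence "- x = of_int (- m) * a + of_int (- n) * b" by (simp add: algebra_simps)
  thus ?thesis unfolding lattice_def by blast
qed

lemma lattice_diff: "\<lbrakk>x \<in> lattice a b; y \<in> lattice a b\<rbrakk> \<Longrightarrow> x - y \<in> lattice a b"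
  using lattice_add[OF _ lattice_uminus, of x a b y] by simp

lemma zero_in_lattice: "0 \<in> lattice a b"
proof -
  have "0 = of_int 0 * a + of_int 0 * b" by simp
  thus ?thesis unfolding lattice_def by blast
qed

text \<open>
  By periodicity of \<open>\<bar>S z\<bar> exp (- \<kappa> \<bar>z\<bar>\<^sup>2)\<close>, compactness of a period cell gives global bounds. The lower bound holds
  where a coordinate with respect to the periods is a half-integer; these lines contain the boundaries of the large
  period parallelograms centred at \<open>0\<close> to which the maximum principle is applied.
  Zeros of \<open>S\<close> are simple because \<open>\<bar>S (l + h)\<bar> / \<bar>h\<bar>\<close> has the positive limit \<open>exp (\<kappa> \<bar>l\<bar>\<^sup>2)\<close>.
\<close>

lemma lattice_sigma_estimates:
  fixes \<tau> :: complex
  assumes \<tau>: "Im \<tau> > 0" and \<kappa>: "\<kappa> = pi / (2 * Im \<tau>)"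
  obtains S G C0 C1 c where "S holomorphic_on UNIV" "G holomorphic_on UNIV" "\<And>z. S z = z * G z" "G 0 = 1"
    "\<And>z. S z = 0 \<longleftrightarrow> z \<in> lattice 1 \<tau>"
    "\<And>l. l \<in> lattice 1 \<tau> \<Longrightarrow> deriv S l \<noteq> 0"
    "C0 \<ge> 0" "\<And>z. cmod (S z) \<le> C0 * exp (\<kappa> * (cmod z)\<^sup>2)"
    "C1 \<ge> 0" "\<And>z. cmod (G z) \<le> C1 * exp (\<kappa> * (cmod z)\<^sup>2)"
    "c > 0" "\<And>x y. x + 1/2 \<in> \<int> \<or> y + 1/2 \<in> \<int> \<Longrightarrow>
       c * exp (\<kappa> * (cmod (of_real x + of_real y * \<tau>))\<^sup>2) \<le> cmod (S (of_real x + of_real y * \<tau>))"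
proof -
  obtain S G where S_hol: "S holomorphic_on UNIV" and G_hol: "G holomorphic_on UNIV" 
    and SG: "\<And>z. S z = z * G z" and G0: "G 0 = 1"
    and S_zero: "\<And>z. S z = 0 \<longleftrightarrow> z \<in> lattice 1 \<tau>"
    and S_per: "\<And>z l. l \<in> lattice 1 \<tau> \<Longrightarrow>
       norm (S (z + l)) = norm (S z) * exp (\<kappa> * ((norm (z + l))\<^sup>2 - (norm z)\<^sup>2))"
    using lattice_sigma_function[OF \<tau> \<kappa>] by blast
  have \<kappa>0: "\<kappa> > 0" using \<tau> by (simp add: \<kappa>)
  define b where "b = (\<lambda>z. Im z / Im \<tau>)"
  define a where "a = (\<lambda>z. Re z - b z * Re \<tau>)"
  have ab: "z = of_real (a z) + of_real (b z) * \<tau>" for z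
    using \<tau> by (simp add: complex_eq_iff a_def b_def)
  have ab_eq: "a (of_real x + of_real y * \<tau>) = x" "b (of_real x + of_real y * \<tau>) = y" for x y
    using \<tau> by (auto simp: a_def b_def)
  have ab_diff: "a (z - w) = a z - a w" "b (z - w) = b z - b w" for z w
    by (auto simp: a_def b_def diff_divide_distrib algebra_simps)
  have cont_ab: "continuous_on X a" "continuous_on X b" for X
    unfolding a_def b_def using \<tau> by (auto intro!: continuous_intros)
  have lat: "l \<in> lattice 1 \<tau> \<longleftrightarrow> (\<exists>m n::int. l = of_int m + of_int n * \<tau>)" for l
    by (auto simp: lattice_def)
  have ab_lat: "a (of_int m + of_int n * \<tau>) = of_int m" "b (of_int m + of_int n * \<tau>) = of_int n" for m n
    using ab_eq[of "of_int m" "of_int n"] by simp_all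
  define cell where "cell = {z. \<bar>a z\<bar> \<le> 1/2 \<and> \<bar>b z\<bar> \<le> 1/2}"
  define r where "r = 1 + cmod \<tau>"
  have ab_norm: "cmod z \<le> \<bar>a z\<bar> + \<bar>b z\<bar> * cmod \<tau>" for z
    using norm_triangle_ineq[of "of_real (a z)" "of_real (b z) * \<tau>"] ab[of z]
    by (simp add: norm_mult)
  have cell_norm: "cmod z \<le> r" if "z \<in> cell" for z
  proof -
    have "\<bar>b z\<bar> * cmod \<tau> \<le> 1 * cmod \<tau>" using that by (intro mult_right_mono) (auto simp: cell_def)
    thus ?thesis using ab_norm[of z] that by (auto simp: cell_def r_def)
  qed
  have closed_cell: "closed cell"
    unfolding cell_def by (intro closed_Collect_conj closed_Collect_le continuous_intros cont_ab)
  have compact_cell: "compact cell"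
    unfolding compact_eq_bounded_closed using closed_cell cell_norm by (auto simp: bounded_iff)
  define red where "red = (\<lambda>z. of_int \<lfloor>a z + 1/2\<rfloor> + of_int \<lfloor>b z + 1/2\<rfloor> * \<tau>)"
  have red_lat: "red z \<in> lattice 1 \<tau>" for z unfolding lat red_def by blast
  have ab_red: "a (z - red z) = a z - of_int \<lfloor>a z + 1/2\<rfloor>" "b (z - red z) = b z - of_int \<lfloor>b z + 1/2\<rfloor>" for z
    by (simp_all add: ab_diff red_def ab_lat)
  have round: "\<bar>x - of_int \<lfloor>x + 1/2\<rfloor>\<bar> \<le> 1/2" for x :: real by linarith
  have red_cell: "z - red z \<in> cell" for z
    unfolding cell_def mem_Collect_eq ab_red by (intro conjI round)
  have cont_S: "continuous_on X S" for X
    using S_hol holomorphic_on_imp_continuous_on continuous_on_subset by blast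
  have cont_G: "continuous_on X G" for X
    using G_hol holomorphic_on_imp_continuous_on continuous_on_subset by blast
  define \<Phi> where "\<Phi> = (\<lambda>z. cmod (S z) * exp (- \<kappa> * (cmod z)\<^sup>2))"
  have S_\<Phi>: "cmod (S z) = \<Phi> z * exp (\<kappa> * (cmod z)\<^sup>2)" for z by (simp add: \<Phi>_def exp_minus)
  have \<Phi>_red: "\<Phi> z = \<Phi> (z - red z)" for z
    using S_per[OF red_lat[of z], of "z - red z"]
    by (simp add: \<Phi>_def right_diff_distrib exp_diff exp_minus field_simps)
  have cont_\<Phi>: "continuous_on X \<Phi>" for X unfolding \<Phi>_def by (intro continuous_intros cont_S)
  obtain C0 where C0: "C0 \<ge> 0" "\<And>z. \<Phi> z \<le> C0"
  proof -
    have "bounded (\<Phi> ` cell)" by (intro compact_imp_bounded compact_continuous_image cont_\<Phi> compact_cell)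
    then obtain B where "\<And>z. z \<in> cell \<Longrightarrow> \<bar>\<Phi> z\<bar> \<le> B" by (auto simp: bounded_iff)
    hence "\<Phi> z \<le> max B 0" for z using red_cell[of z] \<Phi>_red[of z] by (metis abs_le_D1 max.coboundedI1)
    thus ?thesis using that[of "max B 0"] by auto
  qed
  obtain C1 where C1: "C1 \<ge> 0" "\<And>z. cmod (G z) \<le> C1 * exp (\<kappa> * (cmod z)\<^sup>2)"
  proof -
    have "bounded (G ` cball 0 1)" by (intro compact_imp_bounded compact_continuous_image cont_G) auto
    then obtain B where B: "\<And>z. cmod z \<le> 1 \<Longrightarrow> cmod (G z) \<le> B"
      unfolding bounded_iff by (metis imageI mem_cball_0)
    have "cmod (G z) \<le> max B C0 * exp (\<kappa> * (cmod z)\<^sup>2)" for z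
    proof (cases "cmod z \<le> 1")
      case True
      have "cmod (G z) \<le> max B C0 * 1" using B[OF True] by simp
      also have "\<dots> \<le> max B C0 * exp (\<kappa> * (cmod z)\<^sup>2)" 
        using \<kappa>0 C0 by (intro mult_left_mono) auto
      finally show ?thesis .
    next
      case False
      hence "cmod (G z) \<le> cmod z * cmod (G z)" by (intro mult_le_cancel_right1[THEN iffD2]) auto
      also have "\<dots> = \<Phi> z * exp (\<kappa> * (cmod z)\<^sup>2)" by (simp add: S_\<Phi>[symmetric] SG norm_mult)
      also have "\<dots> \<le> max B C0 * exp (\<kappa> * (cmod z)\<^sup>2)" using C0(2)[of z] by (intro mult_right_mono) auto
      finally show ?thesis .
    qed
    thus ?thesis using that[of "max B C0"] C0 by auto
  qed
  define edge where "edge = {z \<in> cell. \<bar>a z\<bar> = 1/2 \<or> \<bar>b z\<bar> = 1/2}"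
  obtain c where c: "c > 0" "\<And>z. z \<in> edge \<Longrightarrow> c \<le> \<Phi> z"
  proof -
    have "compact edge"
    proof -
      have "edge = cell \<inter> ({z. \<bar>a z\<bar> = 1/2} \<union> {z. \<bar>b z\<bar> = 1/2})" by (auto simp: edge_def)
      moreover have "closed ({z. \<bar>a z\<bar> = 1/2} \<union> {z. \<bar>b z\<bar> = 1/2})"
        by (intro closed_Un closed_Collect_eq continuous_intros cont_ab)
      ultimately show ?thesis using compact_cell compact_Int_closed by metis
    qed
    moreover have "of_real (1/2) \<in> edge"
      using ab_eq[of "1/2" 0] by (simp add: edge_def cell_def)
    hence "edge \<noteq> {}" by blast
    ultimately obtain z0 where z0: "z0 \<in> edge" "\<And>z. z \<in> edge \<Longrightarrow> \<Phi> z0 \<le> \<Phi> z"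
      using continuous_attains_inf[OF _ _ cont_\<Phi>] by metis
    have "z0 \<notin> lattice 1 \<tau>"
    proof
      assume "z0 \<in> lattice 1 \<tau>"
      then obtain m n :: int where mn: "z0 = of_int m + of_int n * \<tau>" unfolding lat by blast
      have no_half: "\<bar>real_of_int k\<bar> \<noteq> 1/2" for k
      proof
        assume "\<bar>real_of_int k\<bar> = 1/2"
        hence "real_of_int (2 * \<bar>k\<bar>) = real_of_int 1"
          unfolding of_int_mult of_int_abs of_int_numeral of_int_1 by linarith
        hence "2 * \<bar>k\<bar> = 1" by (simp only: of_int_eq_iff)
        thus False by presburger
      qed
      thus False using z0(1) by (simp add: edge_def mn ab_lat)
    qed
    hence "\<Phi> z0 > 0" by (simp add: \<Phi>_def S_zero)
    thus ?thesis using that[of "\<Phi> z0"] z0(2) by blast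
  qed
  have S_deriv_nz: "deriv S l \<noteq> 0" if l: "l \<in> lattice 1 \<tau>" for l
  proof -
    have "((\<lambda>h. (S (l + h) - S l) / h) \<longlongrightarrow> deriv S l) (at 0)"
      unfolding DERIV_def[symmetric] by (rule holomorphic_derivI[OF S_hol open_UNIV UNIV_I])
    hence lim1: "((\<lambda>h. cmod ((S (l + h) - S l) / h)) \<longlongrightarrow> cmod (deriv S l)) (at 0)" by (rule tendsto_norm)
    have lim2: "((\<lambda>h. cmod (G h) * exp (\<kappa> * ((cmod (h + l))\<^sup>2 - (cmod h)\<^sup>2))) \<longlongrightarrow> 
        cmod (G 0) * exp (\<kappa> * ((cmod (0 + l))\<^sup>2 - (cmod 0)\<^sup>2))) (at 0)"
    proof -
      have "isCont G 0" using cont_G[of UNIV] by (simp add: continuous_on_eq_continuous_at)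
      hence "(G \<longlongrightarrow> G 0) (at 0)" by (simp add: isCont_def)
      thus ?thesis by (intro tendsto_intros)
    qed
    have ev: "eventually (\<lambda>h. cmod ((S (l + h) - S l) / h) = 
        cmod (G h) * exp (\<kappa> * ((cmod (h + l))\<^sup>2 - (cmod h)\<^sup>2))) (at 0)"
    proof (intro eventually_at_filter[THEN iffD2] eventuallyI impI)
      fix h :: complex assume "h \<noteq> 0"
      have "cmod ((S (l + h) - S l) / h) = cmod (S (h + l)) / cmod h"
        using S_zero[of l] l by (simp add: norm_divide add.commute)
      also have "\<dots> = cmod (G h) * exp (\<kappa> * ((cmod (h + l))\<^sup>2 - (cmod h)\<^sup>2))"
        unfolding S_per[OF l] SG[of h] norm_mult using \<open>h \<noteq> 0\<close> by simp
      finally show "cmod ((S (l + h) - S l) / h) = cmod (G h) * exp (\<kappa> * ((cmod (h + l))\<^sup>2 - (cmod h)\<^sup>2))" .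
    qed
    have "cmod (deriv S l) = cmod (G 0) * exp (\<kappa> * ((cmod (0 + l))\<^sup>2 - (cmod 0)\<^sup>2))"
      by (rule tendsto_unique[OF at_neq_bot tendsto_cong[OF ev, THEN iffD1, OF lim1] lim2])
    thus ?thesis using G0 by auto
  qed
  have edge_bound: "c * exp (\<kappa> * (cmod (of_real x + of_real y * \<tau>))\<^sup>2) \<le> cmod (S (of_real x + of_real y * \<tau>))"
    if "x + 1/2 \<in> \<int> \<or> y + 1/2 \<in> \<int>" for x y
  proof -
    define z where "z = of_real x + of_real y * \<tau>"
    have half: "\<bar>x - of_int \<lfloor>x + 1/2\<rfloor>\<bar> = 1/2" if x: "x + 1/2 \<in> \<int>" for x :: real
    proof -
      obtain k where "x + 1/2 = of_int k" using x by (elim Ints_cases)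
      moreover from this have "\<lfloor>x + 1/2\<rfloor> = k" by (simp only: floor_of_int)
      ultimately show ?thesis by simp
    qed
    have "z - red z \<in> edge"
      using red_cell[of z] that half[of x] half[of y] by (auto simp: edge_def ab_red) (auto simp: z_def ab_eq)
    thus ?thesis using c(2) \<Phi>_red[of z] unfolding S_\<Phi> z_def[symmetric] by (intro mult_right_mono) auto
  qed
  have S_bound: "cmod (S z) \<le> C0 * exp (\<kappa> * (cmod z)\<^sup>2)" for z
    unfolding S_\<Phi> using C0(2)[of z] by (intro mult_right_mono) auto
  show ?thesis
    by (rule that[OF S_hol G_hol SG G0 S_zero S_deriv_nz C0(1) S_bound C1 c(1) edge_bound])
qed

text \<open>
  The kernels \<open>G (z - l) exp (2 \<kappa> (cnj l) (z - l))\<close> are bounded by \<open>C exp (\<kappa> \<bar>z\<bar>\<^sup>2 - \<kappa> \<bar>l\<bar>\<^sup>2)\<close>. Hence the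
  interpolation sum \<open>T\<close> of \<open>W\<close> over the lattice points of a large period parallelogram is controlled by \<open>M\<close>, uniformly in the size of the
  parallelogram. Since \<open>W - T\<close> vanishes at these points, \<open>(W - T) / S\<close> is holomorphic on the parallelogram. On its boundary
  the contribution of \<open>W / S\<close> tends to \<open>0\<close> because \<open>W\<close> grows subcritically, and the maximum modulus
  principle transports the bound to the central cell, which the last two hypotheses describe in
  coordinates with respect to the periods \<open>1\<close> and \<open>\<tau>\<close>. The constant \<open>K\<close> depends on the lattice only, which is what makes
  the estimate invariant under translations of \<open>W\<close>.
\<close>

lemma interpolation_on_cell:
  fixes \<tau> :: complex
  assumes \<tau>: "Im \<tau> > 0" and \<kappa>: "\<kappa> = pi / (2 * Im \<tau>)"
  obtains K where "K \<ge> 0" "\<And>W C A M z. \<lbrakk>W holomorphic_on UNIV; 0 \<le> A; A < \<kappa>; \<And>z. cmod (W z) \<le> C * exp (A * (cmod z)\<^sup>2);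
     \<And>l. l \<in> lattice 1 \<tau> \<Longrightarrow> cmod (W l) \<le> M; \<bar>Im z / Im \<tau>\<bar> \<le> 1/2; \<bar>Re z - Im z / Im \<tau> * Re \<tau>\<bar> \<le> 1/2\<rbrakk> 
       \<Longrightarrow> cmod (W z) \<le> K * M"
proof -
  obtain S G C0 C1 c where S_hol: "S holomorphic_on UNIV" and G_hol: "G holomorphic_on UNIV" 
    and SG: "\<And>z. S z = z * G z" and G0: "G 0 = 1"
    and S_zero: "\<And>z. S z = 0 \<longleftrightarrow> z \<in> lattice 1 \<tau>"
    and S_deriv_nz: "\<And>l. l \<in> lattice 1 \<tau> \<Longrightarrow> deriv S l \<noteq> 0"
    and C0: "C0 \<ge> 0" "\<And>z. cmod (S z) \<le> C0 * exp (\<kappa> * (cmod z)\<^sup>2)"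
    and C1: "C1 \<ge> 0" "\<And>z. cmod (G z) \<le> C1 * exp (\<kappa> * (cmod z)\<^sup>2)"
    and c: "c > 0" "\<And>x y. x + 1/2 \<in> \<int> \<or> y + 1/2 \<in> \<int> \<Longrightarrow>
       c * exp (\<kappa> * (cmod (of_real x + of_real y * \<tau>))\<^sup>2) \<le> cmod (S (of_real x + of_real y * \<tau>))"
    by (rule lattice_sigma_estimates[OF \<tau> \<kappa>]) (rule that; assumption)
  have \<kappa>0: "\<kappa> > 0" using \<tau> by (simp add: \<kappa>)
  define b where "b = (\<lambda>z. Im z / Im \<tau>)"
  define a where "a = (\<lambda>z. Re z - b z * Re \<tau>)"
  have ab: "z = of_real (a z) + of_real (b z) * \<tau>" for z
    using \<tau> by (simp add: complex_eq_iff a_def b_def)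
  have ab_eq: "a (of_real x + of_real y * \<tau>) = x" "b (of_real x + of_real y * \<tau>) = y" for x y
    using \<tau> by (auto simp: a_def b_def)
  have cont_ab: "continuous_on X a" "continuous_on X b" for X
    unfolding a_def b_def using \<tau> by (auto intro!: continuous_intros)
  have lat: "l \<in> lattice 1 \<tau> \<longleftrightarrow> (\<exists>m n::int. l = of_int m + of_int n * \<tau>)" for l
    by (auto simp: lattice_def)
  have ab_lat: "a (of_int m + of_int n * \<tau>) = of_int m" "b (of_int m + of_int n * \<tau>) = of_int n" for m n
    using ab_eq[of "of_int m" "of_int n"] by simp_all
  obtain L where L: "L > 0" "\<And>x y :: real. x\<^sup>2 + y\<^sup>2 \<le> L * (cmod (of_real x * 1 + of_real y * \<tau>))\<^sup>2"
    using lattice_coordinates[of 1 \<tau>] \<tau> by (auto simp: lattice_area_def)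
  have L': "(a z)\<^sup>2 + (b z)\<^sup>2 \<le> L * (cmod z)\<^sup>2" for z
    using L(2)[of "a z" "b z"] ab[of z] by simp
  define cell where "cell = {z. \<bar>a z\<bar> \<le> 1/2 \<and> \<bar>b z\<bar> \<le> 1/2}"
  define r where "r = 1 + cmod \<tau>"
  have ab_norm: "cmod z \<le> \<bar>a z\<bar> + \<bar>b z\<bar> * cmod \<tau>" for z
    using norm_triangle_ineq[of "of_real (a z)" "of_real (b z) * \<tau>"] ab[of z]
    by (simp add: norm_mult)
  have cell_norm: "cmod z \<le> r" if "z \<in> cell" for z
  proof -
    have "\<bar>b z\<bar> * cmod \<tau> \<le> 1 * cmod \<tau>" using that by (intro mult_right_mono) (auto simp: cell_def)
    thus ?thesis using ab_norm[of z] that by (auto simp: cell_def r_def)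
  qed
  define \<Sigma> where "\<Sigma> = infsum (\<lambda>l. exp (- \<kappa> * (cmod l)\<^sup>2)) (lattice 1 \<tau>)"
  have summ: "(\<lambda>l. exp (- \<kappa> * (cmod l)\<^sup>2)) summable_on lattice 1 \<tau>"
    using summable_gaussian_lattice[of 1 \<tau> \<kappa>] \<tau> \<kappa>0 by (simp add: lattice_area_def)
  have \<Sigma>0: "\<Sigma> \<ge> 0" unfolding \<Sigma>_def by (rule infsum_nonneg) simp
  have \<Sigma>_ge: "(\<Sum>l\<in>F. exp (- \<kappa> * (cmod l)\<^sup>2)) \<le> \<Sigma>" if "finite F" "F \<subseteq> lattice 1 \<tau>" for F
    unfolding \<Sigma>_def by (rule finite_sum_le_infsum) (use that summ in auto)
  define E where "E = exp (\<kappa> * r\<^sup>2)"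
  define K where "K = C1 * \<Sigma> * E + C0 * E * (C1 * \<Sigma> / c)"
  have "K \<ge> 0"
    unfolding K_def E_def using C1(1) C0(1) c(1) \<Sigma>0
    by (intro add_nonneg_nonneg mult_nonneg_nonneg divide_nonneg_pos exp_ge_zero) auto
  moreover have "cmod (W z0) \<le> K * M" 
    if W_hol: "W holomorphic_on UNIV" and A: "0 \<le> A" "A < \<kappa>" 
      and W_growth: "\<And>z. cmod (W z) \<le> C * exp (A * (cmod z)\<^sup>2)"
      and W_lat: "\<And>l. l \<in> lattice 1 \<tau> \<Longrightarrow> cmod (W l) \<le> M" and z0: "z0 \<in> cell" for W C A M z0
  proof (rule field_le_epsilon)
    fix e :: real assume e: "e > 0"
    have M0: "M \<ge> 0" using order_trans[OF norm_ge_zero W_lat[OF zero_in_lattice]] .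
    have C: "C \<ge> 0" using order_trans[OF norm_ge_zero W_growth[of 0]] by simp
    define \<delta> where "\<delta> = e * c / (C0 * E + 1)"
    have \<delta>: "\<delta> > 0" using e c C0 by (auto simp: \<delta>_def E_def intro!: divide_pos_pos add_nonneg_pos)
    obtain N :: nat where N0: "N > 0" and N: "C * exp (- (\<kappa> - A) * ((real N)\<^sup>2 / L)) \<le> \<delta>"
    proof -
      have "((\<lambda>N. C * exp (- (\<kappa> - A) * ((real N)\<^sup>2 / L))) \<longlongrightarrow> C * 0) sequentially"
      proof (intro tendsto_intros)
        have "filterlim (\<lambda>N. (\<kappa> - A) / L * (real N)\<^sup>2) at_top sequentially"
          using A L by (intro filterlim_tendsto_pos_mult_at_top[OF tendsto_const] 
              filterlim_pow_at_top filterlim_real_sequentially) auto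
        hence "((\<lambda>N. exp (- ((\<kappa> - A) / L * (real N)\<^sup>2))) \<longlongrightarrow> 0) sequentially"
          by (intro filterlim_compose[OF exp_at_bot] filterlim_uminus_at_bot_at_top[THEN filterlim_compose])
        thus "((\<lambda>N. exp (- (\<kappa> - A) * ((real N)\<^sup>2 / L))) \<longlongrightarrow> 0) sequentially"
          by (simp only: mult_minus_left times_divide_eq_left times_divide_eq_right minus_divide_left)
      qed
      hence "eventually (\<lambda>N. C * exp (- (\<kappa> - A) * ((real N)\<^sup>2 / L)) < \<delta>) sequentially"
        using \<delta> by (auto dest: order_tendstoD)
      from eventually_happens'[OF sequentially_bot eventually_conj[OF eventually_gt_at_top[of 0] this]] show ?thesis
        using that less_imp_le by blast
    qed
    define \<Lambda> where "\<Lambda> = (\<lambda>(m::int, n::int). of_int m + of_int n * \<tau>) ` ({- int N..int N} \<times> {- int N..int N})"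
    have fin: "finite \<Lambda>" by (simp add: \<Lambda>_def)
    have in_lat: "of_int m + of_int n * \<tau> \<in> lattice 1 \<tau>" for m n unfolding lat by blast
    have \<Lambda>_sub: "\<Lambda> \<subseteq> lattice 1 \<tau>" using in_lat by (auto simp: \<Lambda>_def)
    define T where "T = (\<lambda>z. \<Sum>l\<in>\<Lambda>. W l * G (z - l) * exp (2 * of_real \<kappa> * cnj l * (z - l)))"
    have G_hol': "(\<lambda>z. G (z - l)) holomorphic_on UNIV" for l
      using holomorphic_on_compose_gen[OF holomorphic_on_diff[OF holomorphic_on_ident holomorphic_on_const] G_hol, of l UNIV]
      by (simp add: o_def)
    have T_hol: "T holomorphic_on UNIV" unfolding T_def by (intro holomorphic_intros G_hol')
    have T_lat: "T l = W l" if l: "l \<in> \<Lambda>" for l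
    proof -
      have "G (l - l') = 0" if l': "l' \<in> \<Lambda> - {l}" for l'
        using S_zero[of "l - l'"] lattice_diff[of l 1 \<tau> l'] l' l \<Lambda>_sub by (auto simp: SG)
      hence "T l = (\<Sum>l'\<in>\<Lambda>. if l' = l then W l else 0)"
        unfolding T_def by (intro sum.cong refl) (auto simp: G0)
      thus ?thesis using fin l by simp
    qed
    have T_bound: "cmod (T z) \<le> M * C1 * \<Sigma> * exp (\<kappa> * (cmod z)\<^sup>2)" for z
    proof -
      have "cmod (T z) \<le> (\<Sum>l\<in>\<Lambda>. M * C1 * exp (\<kappa> * (cmod z)\<^sup>2) * exp (- \<kappa> * (cmod l)\<^sup>2))"
        unfolding T_def
      proof (rule sum_norm_le)
        fix l assume "l \<in> \<Lambda>"
        have Re: "\<kappa> * (cmod (z - l))\<^sup>2 + Re (2 * of_real \<kappa> * cnj l * (z - l)) = \<kappa> * (cmod z)\<^sup>2 - \<kappa> * (cmod l)\<^sup>2"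
          unfolding cmod_power2 by (simp add: power2_eq_square algebra_simps)
        have "cmod (W l * G (z - l) * exp (2 * of_real \<kappa> * cnj l * (z - l))) \<le> 
           M * (C1 * exp (\<kappa> * (cmod (z - l))\<^sup>2)) * exp (Re (2 * of_real \<kappa> * cnj l * (z - l)))"
          unfolding norm_mult norm_exp_eq_Re using \<open>l \<in> \<Lambda>\<close> \<Lambda>_sub M0 C1
          by (intro mult_mono W_lat) auto
        also have "\<dots> = M * C1 * exp (\<kappa> * (cmod z)\<^sup>2) * exp (- \<kappa> * (cmod l)\<^sup>2)"
          using Re by (simp add: mult.assoc exp_add[symmetric] del: times_complex.sel)
        finally show "cmod (W l * G (z - l) * exp (2 * of_real \<kappa> * cnj l * (z - l))) \<le>
          M * C1 * exp (\<kappa> * (cmod z)\<^sup>2) * exp (- \<kappa> * (cmod l)\<^sup>2)" .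
      qed
      also have "\<dots> = M * C1 * exp (\<kappa> * (cmod z)\<^sup>2) * (\<Sum>l\<in>\<Lambda>. exp (- \<kappa> * (cmod l)\<^sup>2))"
        by (simp add: sum_distrib_left)
      also have "\<dots> \<le> M * C1 * exp (\<kappa> * (cmod z)\<^sup>2) * \<Sigma>"
        using M0 C1 \<Sigma>_ge[OF fin \<Lambda>_sub] by (intro mult_left_mono) auto
      finally show ?thesis by (simp add: mult_ac)
    qed
    define V where "V = (\<lambda>z. W z - T z)"
    have V_hol: "V holomorphic_on UNIV" unfolding V_def by (intro holomorphic_intros W_hol T_hol)
    have V_lat: "V l = 0" if "l \<in> \<Lambda>" for l using T_lat[OF that] by (simp add: V_def)
    \<comment> \<open>The value at a lattice point is the limit of the quotient there, so that singularities are removed.\<close>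
    define Q where "Q = (\<lambda>z. if z \<in> \<Lambda> then deriv V z / deriv S z else V z / S z)"
    \<comment> \<open>An open neighbourhood of the closed parallelogram that contains no further lattice points.\<close>
    define R' where "R' = {z. \<bar>a z\<bar> < real N + 3/4 \<and> \<bar>b z\<bar> < real N + 3/4}"
    have R'_open: "open R'" unfolding R'_def by (intro open_Collect_conj open_Collect_less continuous_intros cont_ab)
    have R'_zero: "S z \<noteq> 0" if "z \<in> R' - \<Lambda>" for z
    proof
      assume "S z = 0"
      then obtain m n :: int where z: "z = of_int m + of_int n * \<tau>" unfolding S_zero lat by blast
      have "\<bar>real_of_int m\<bar> < real N + 3/4" "\<bar>real_of_int n\<bar> < real N + 3/4" 
        using that by (auto simp: R'_def z ab_lat)
      hence "m \<in> {- int N..int N}" "n \<in> {- int N..int N}" by auto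
      hence "z \<in> \<Lambda>" unfolding \<Lambda>_def z by auto
      thus False using that by blast
    qed
    have Q_hol1: "Q holomorphic_on (R' - \<Lambda>)"
    proof -
      have "(\<lambda>z. V z / S z) holomorphic_on (R' - \<Lambda>)"
        by (intro holomorphic_intros holomorphic_on_subset[OF V_hol] holomorphic_on_subset[OF S_hol])
           (use R'_zero in auto)
      thus ?thesis by (rule holomorphic_transform) (auto simp: Q_def)
    qed
    have Q_cont: "continuous_on R' Q"
    proof (rule continuous_at_imp_continuous_on, rule ballI)
      fix z assume z: "z \<in> R'"
      show "isCont Q z"
      proof (cases "z \<in> \<Lambda>")
        case False
        have "open (R' - \<Lambda>)" using R'_open fin by (simp add: finite_imp_closed open_Diff)
        thus ?thesis using Q_hol1 False z holomorphic_on_imp_continuous_on continuous_on_eq_continuous_at by blast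
      next
        case True
        have "((\<lambda>w. V w / S w) \<longlongrightarrow> deriv V z / deriv S z) (at z)"
          by (rule lhopital_complex_simple[OF holomorphic_derivI[OF V_hol] holomorphic_derivI[OF S_hol]])
             (use True V_lat \<Lambda>_sub S_zero S_deriv_nz in auto)
        moreover have "eventually (\<lambda>w. V w / S w = Q w) (at z)"
        proof -
          have "open (- (\<Lambda> - {z}))" using fin by (intro open_Compl finite_imp_closed finite_Diff)
          hence "eventually (\<lambda>w. w \<in> - (\<Lambda> - {z})) (nhds z)" by (intro eventually_nhds_in_open) auto
          thus ?thesis unfolding eventually_at_filter by eventually_elim (auto simp: Q_def)
        qed
        ultimately have "(Q \<longlongrightarrow> deriv V z / deriv S z) (at z)" by (rule Lim_transform_eventually)
        thus ?thesis using True by (simp add: isCont_def Q_def)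
      qed
    qed
    have Q_hol: "Q holomorphic_on R'"
      by (rule no_isolated_singularity[OF Q_cont Q_hol1 R'_open fin])
    define R where "R = {z. \<bar>a z\<bar> < real N + 1/2 \<and> \<bar>b z\<bar> < real N + 1/2}"
    have R_open: "open R" unfolding R_def by (intro open_Collect_conj open_Collect_less continuous_intros cont_ab)
    have closed: "closed {z. \<bar>a z\<bar> \<le> real N + 1/2 \<and> \<bar>b z\<bar> \<le> real N + 1/2}"
      by (intro closed_Collect_conj closed_Collect_le continuous_intros cont_ab)
    have R_closure: "closure R \<subseteq> {z. \<bar>a z\<bar> \<le> real N + 1/2 \<and> \<bar>b z\<bar> \<le> real N + 1/2}"
      by (rule closure_minimal[OF _ closed]) (auto simp: R_def)
    have R_R': "closure R \<subseteq> R'" using R_closure by (force simp: R'_def)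
    have R_bounded: "bounded R"
    proof -
      have "cmod z \<le> (real N + 1/2) + (real N + 1/2) * cmod \<tau>" if "z \<in> R" for z
        using ab_norm[of z] that mult_right_mono[of "\<bar>b z\<bar>" "real N + 1/2" "cmod \<tau>"]
        by (auto simp: R_def)
      thus ?thesis by (auto simp: bounded_iff)
    qed
    have Q_bound: "cmod (Q z) \<le> (\<delta> + M * C1 * \<Sigma>) / c" if "z \<in> frontier R" for z
    proof -
      have z: "\<bar>a z\<bar> \<le> real N + 1/2" "\<bar>b z\<bar> \<le> real N + 1/2" "\<bar>a z\<bar> = real N + 1/2 \<or> \<bar>b z\<bar> = real N + 1/2"
        using that R_closure unfolding frontier_def interior_open[OF R_open]
        by (auto simp: R_def not_less dest!: subsetD)
      have half: "x + 1/2 \<in> \<int>" if "\<bar>x\<bar> = real N + 1/2" for x :: real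
      proof (cases "x \<ge> 0")
        case True
        hence "x + 1/2 = of_int (int N + 1)" using that by simp
        thus ?thesis by (metis Ints_of_int)
      next
        case False
        hence "x + 1/2 = of_int (- int N)" using that by simp
        thus ?thesis by (metis Ints_of_int)
      qed
      have c_le: "c * exp (\<kappa> * (cmod z)\<^sup>2) \<le> cmod (S z)"
        using c(2)[of "a z" "b z"] z(3) half[of "a z"] half[of "b z"] ab[of z] by auto
      have "0 < c * exp (\<kappa> * (cmod z)\<^sup>2)" using c by simp
      hence "S z \<noteq> 0" using c_le by auto
      hence "z \<notin> \<Lambda>" using \<Lambda>_sub S_zero[of z] by blast
      hence "Q z = V z / S z" by (simp add: Q_def)
      have sq: "(real N)\<^sup>2 \<le> x\<^sup>2" if "real N \<le> \<bar>x\<bar>" for x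
        using power_mono[OF that, of 2] by simp
      have "(real N)\<^sup>2 \<le> (a z)\<^sup>2 + (b z)\<^sup>2"
        using z(3) sq[of "a z"] sq[of "b z"] zero_le_power2[of "a z"] zero_le_power2[of "b z"] 
        by linarith
      also note L'
      finally have "(real N)\<^sup>2 / L \<le> (cmod z)\<^sup>2" using L(1) by (simp add: pos_divide_le_eq mult.commute)
      hence "(\<kappa> - A) * ((real N)\<^sup>2 / L) \<le> (\<kappa> - A) * (cmod z)\<^sup>2" using A by (intro mult_left_mono) auto
      hence "C * exp (- (\<kappa> - A) * (cmod z)\<^sup>2) \<le> C * exp (- (\<kappa> - A) * ((real N)\<^sup>2 / L))"
        unfolding mult_minus_left by (intro mult_left_mono[OF _ C]) (simp only: exp_le_cancel_iff neg_le_iff_le)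
      hence 1: "C * exp (- (\<kappa> - A) * (cmod z)\<^sup>2) \<le> \<delta>" using N by linarith
      have "cmod (W z) \<le> (C * exp (- (\<kappa> - A) * (cmod z)\<^sup>2)) * exp (\<kappa> * (cmod z)\<^sup>2)"
        using W_growth[of z] by (simp add: mult.assoc exp_add[symmetric] algebra_simps)
      also have "\<dots> \<le> \<delta> * exp (\<kappa> * (cmod z)\<^sup>2)" using 1 by (intro mult_right_mono) auto
      finally have "cmod (V z) \<le> (\<delta> + M * C1 * \<Sigma>) * exp (\<kappa> * (cmod z)\<^sup>2)"
        using T_bound[of z] norm_triangle_ineq4[of "W z" "T z"] by (simp add: V_def algebra_simps)
      moreover have "0 < c * exp (\<kappa> * (cmod z)\<^sup>2)" using c by simp
      moreover have "0 \<le> \<delta> + M * C1 * \<Sigma>" using \<delta> M0 C1 \<Sigma>0 by (intro add_nonneg_nonneg mult_nonneg_nonneg) auto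
      ultimately have "cmod (V z) / cmod (S z) \<le> ((\<delta> + M * C1 * \<Sigma>) * exp (\<kappa> * (cmod z)\<^sup>2)) / (c * exp (\<kappa> * (cmod z)\<^sup>2))"
        using c_le by (intro frac_le mult_nonneg_nonneg) auto
      thus ?thesis by (simp add: \<open>Q z = V z / S z\<close> norm_divide)
    qed
    have Q_z0: "cmod (Q z0) \<le> (\<delta> + M * C1 * \<Sigma>) / c"
    proof (rule maximum_modulus_frontier[OF _ _ R_bounded Q_bound])
      show "Q holomorphic_on interior R" 
        using Q_hol R_R' closure_subset interior_subset holomorphic_on_subset by (metis subset_trans)
      show "continuous_on (closure R) Q" using Q_cont R_R' continuous_on_subset by blast
      show "z0 \<in> R"
        using z0 N0 by (auto simp: cell_def R_def)
    qed
    have "W z0 = T z0 + S z0 * Q z0"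
    proof (cases "z0 \<in> \<Lambda>")
      case True
      thus ?thesis using T_lat \<Lambda>_sub S_zero by auto
    next
      case False
      hence "S z0 \<noteq> 0" using z0 by (intro R'_zero) (auto simp: cell_def R'_def)
      thus ?thesis using False by (simp add: Q_def V_def)
    qed
    hence "cmod (W z0) \<le> cmod (T z0) + cmod (S z0) * cmod (Q z0)"
      by (metis norm_mult norm_triangle_ineq)
    also have "\<dots> \<le> M * C1 * \<Sigma> * E + C0 * E * ((\<delta> + M * C1 * \<Sigma>) / c)"
    proof (intro add_mono mult_mono Q_z0)
      have le_E: "exp (\<kappa> * (cmod z0)\<^sup>2) \<le> E"
        unfolding E_def using cell_norm[OF z0] \<kappa>0 by (auto intro!: power_mono)
      show "cmod (S z0) \<le> C0 * E" using order_trans[OF C0(2) mult_left_mono[OF le_E C0(1)]] .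
      have "M * C1 * \<Sigma> * exp (\<kappa> * (cmod z0)\<^sup>2) \<le> M * C1 * \<Sigma> * E"
        using M0 C1 \<Sigma>0 le_E by (intro mult_left_mono mult_nonneg_nonneg) auto
      thus "cmod (T z0) \<le> M * C1 * \<Sigma> * E" using T_bound[of z0] by linarith
    qed (use C0 in \<open>auto simp: E_def\<close>)
    also have "\<dots> = K * M + C0 * E * \<delta> / c"
      by (simp add: K_def add_divide_distrib algebra_simps)
    also have "C0 * E * \<delta> / c = e * (C0 * E / (C0 * E + 1))" using c by (simp add: \<delta>_def)
    also have "\<dots> \<le> e * 1" using e C0 by (intro mult_left_mono) (auto simp: E_def divide_simps add_nonneg_pos)
    finally show "cmod (W z0) \<le> K * M + e" by simp
  qed
  ultimately show ?thesis by (rule that) (auto simp: cell_def a_def b_def)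
qed

definition gaussian_growth :: "real \<Rightarrow> (complex \<Rightarrow> complex) \<Rightarrow> bool" where
  "gaussian_growth \<alpha> f \<longleftrightarrow> f holomorphic_on UNIV \<and> (\<exists>C. \<forall>z. cmod (f z) \<le> C * exp (\<alpha> * (cmod z)\<^sup>2))"

lemma gaussian_growthE:
  assumes "gaussian_growth \<alpha> f"
  obtains C where "C \<ge> 0" "\<And>z. cmod (f z) \<le> C * exp (\<alpha> * (cmod z)\<^sup>2)"
proof -
  obtain C where C: "\<And>z. cmod (f z) \<le> C * exp (\<alpha> * (cmod z)\<^sup>2)"
    using assms unfolding gaussian_growth_def by blast
  have "0 \<le> C * exp (\<alpha> * (cmod 0)\<^sup>2)" using order_trans[OF norm_ge_zero C] .
  thus ?thesis using that[OF _ C] by simp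
qed

lemma gaussian_growth_holomorphic: "gaussian_growth \<alpha> f \<Longrightarrow> f holomorphic_on UNIV"
  by (simp add: gaussian_growth_def)

lemma gaussian_growth_local:
  assumes "gaussian_growth \<alpha> f" "0 \<le> \<alpha>" "\<alpha> < \<beta>"
  obtains C where "C \<ge> 0" "\<And>l z. cmod (z - l) \<le> r \<Longrightarrow> cmod (f z) \<le> C * exp (\<beta> * (cmod l)\<^sup>2)"
proof -
  obtain C where C: "C \<ge> 0" "\<And>z. cmod (f z) \<le> C * exp (\<alpha> * (cmod z)\<^sup>2)"
    using assms(1) by (rule gaussian_growthE) (rule that; assumption)
  define C' where "C' = C * exp (\<alpha> * \<beta> / (\<beta> - \<alpha>) * r\<^sup>2)"
  have "cmod (f z) \<le> C' * exp (\<beta> * (cmod l)\<^sup>2)" if "cmod (z - l) \<le> r" for l z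
  proof -
    have "cmod (f z) \<le> C * exp (\<alpha> * (cmod (l + (z - l)))\<^sup>2)" using C(2)[of z] by simp
    also have "\<dots> \<le> C * (exp (\<alpha> * \<beta> / (\<beta> - \<alpha>) * r\<^sup>2) * exp (\<beta> * (cmod l)\<^sup>2))"
      by (intro mult_left_mono gaussian_growth_shift assms that C)
    finally show ?thesis by (simp add: C'_def mult.assoc)
  qed
  moreover have "C' \<ge> 0" using C by (simp add: C'_def)
  ultimately show ?thesis using that by blast
qed

text \<open>
  Cauchy's inequality on unit circles, combined with the stability of Gaussian growth under bounded translations.
\<close>

lemma gaussian_growth_deriv:
  assumes f: "gaussian_growth \<alpha> f" and "0 \<le> \<alpha>" "\<alpha> < \<beta>"
  shows "gaussian_growth \<beta> (deriv f)"
proof -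
  have hol: "f holomorphic_on UNIV" using f by (rule gaussian_growth_holomorphic)
  obtain C where C: "\<And>l z. cmod (z - l) \<le> 1 \<Longrightarrow> cmod (f z) \<le> C * exp (\<beta> * (cmod l)\<^sup>2)"
    using gaussian_growth_local[OF assms, of 1] by blast
  have "cmod ((deriv ^^ 1) f z) \<le> fact 1 * (C * exp (\<beta> * (cmod z)\<^sup>2)) / 1 ^ 1" for z
  proof (rule Cauchy_inequality)
    show "f holomorphic_on ball z 1" using hol holomorphic_on_subset by blast
    show "continuous_on (cball z 1) f"
      using hol holomorphic_on_imp_continuous_on continuous_on_subset by blast
    show "cmod (f x) \<le> C * exp (\<beta> * (cmod z)\<^sup>2)" if "cmod (z - x) = 1" for x
      by (rule C) (use that in \<open>simp add: norm_minus_commute\<close>)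
  qed simp
  hence "\<And>z. cmod (deriv f z) \<le> C * exp (\<beta> * (cmod z)\<^sup>2)" by simp
  moreover have "deriv f holomorphic_on UNIV" using hol by (intro holomorphic_deriv) auto
  ultimately show ?thesis unfolding gaussian_growth_def by blast
qed

lemma gaussian_growth_mult:
  assumes "gaussian_growth \<alpha> f" "gaussian_growth \<beta> g"
  shows "gaussian_growth (\<alpha> + \<beta>) (\<lambda>z. f z * g z)"
proof -
  obtain C where C: "C \<ge> 0" "\<And>z. cmod (f z) \<le> C * exp (\<alpha> * (cmod z)\<^sup>2)"
    using assms(1) by (rule gaussian_growthE) (rule that; assumption)
  obtain C' where C': "C' \<ge> 0" "\<And>z. cmod (g z) \<le> C' * exp (\<beta> * (cmod z)\<^sup>2)"
    using assms(2) by (rule gaussian_growthE) (rule that; assumption)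
  have "cmod (f z * g z) \<le> (C * C') * exp ((\<alpha> + \<beta>) * (cmod z)\<^sup>2)" for z
  proof -
    have "cmod (f z) * cmod (g z) \<le> (C * exp (\<alpha> * (cmod z)\<^sup>2)) * (C' * exp (\<beta> * (cmod z)\<^sup>2))"
      using C C' by (intro mult_mono) auto
    thus ?thesis by (simp add: norm_mult ring_distribs exp_add mult_ac)
  qed
  thus ?thesis using assms unfolding gaussian_growth_def by (blast intro: holomorphic_on_mult)
qed

lemma gaussian_growth_diff:
  assumes "gaussian_growth \<alpha> f" "gaussian_growth \<alpha> g"
  shows "gaussian_growth \<alpha> (\<lambda>z. f z - g z)"
proof -
  obtain C where C: "C \<ge> 0" "\<And>z. cmod (f z) \<le> C * exp (\<alpha> * (cmod z)\<^sup>2)"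
    using assms(1) by (rule gaussian_growthE) (rule that; assumption)
  obtain C' where C': "C' \<ge> 0" "\<And>z. cmod (g z) \<le> C' * exp (\<alpha> * (cmod z)\<^sup>2)"
    using assms(2) by (rule gaussian_growthE) (rule that; assumption)
  have "cmod (f z - g z) \<le> (C + C') * exp (\<alpha> * (cmod z)\<^sup>2)" for z
    using norm_triangle_ineq4[of "f z" "g z"] C(2)[of z] C'(2)[of z] by (simp add: ring_distribs)
  thus ?thesis using assms unfolding gaussian_growth_def by (blast intro: holomorphic_on_diff)
qed

lemma lattice_scale:
  assumes "\<omega>\<^sub>1 \<noteq> 0"
  shows "lattice \<omega>\<^sub>1 \<omega>\<^sub>2 = (*) \<omega>\<^sub>1 ` lattice 1 (\<omega>\<^sub>2 / \<omega>\<^sub>1)"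
proof -
  have eq: "of_int m * \<omega>\<^sub>1 + of_int n * \<omega>\<^sub>2 = \<omega>\<^sub>1 * (of_int m * 1 + of_int n * (\<omega>\<^sub>2 / \<omega>\<^sub>1))" for m n
    using assms by (simp add: algebra_simps)
  show ?thesis unfolding lattice_def eq by blast
qed

text \<open>
  The bound on the period cell applies to all translates of \<open>W\<close> by lattice vectors, as these have the same supremum on the
  lattice and still grow subcritically. Therefore \<open>W\<close> is bounded, and Liouville's theorem applies. The critical rate
  \<open>\<pi> / (2 area)\<close> is that of the sigma function, which vanishes on the lattice.
\<close>

theorem lattice_Liouville_bounded:
  assumes per: "lattice_periods \<omega>\<^sub>1 \<omega>\<^sub>2" and W: "gaussian_growth A W" 
    and A: "0 \<le> A" "A < pi / (2 * lattice_area \<omega>\<^sub>1 \<omega>\<^sub>2)"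
    and bounded: "\<And>l. l \<in> lattice \<omega>\<^sub>1 \<omega>\<^sub>2 \<Longrightarrow> cmod (W l) \<le> M"
  shows "W constant_on UNIV"
proof -
  define \<tau> where "\<tau> = \<omega>\<^sub>2 / \<omega>\<^sub>1"
  define \<kappa> where "\<kappa> = pi / (2 * Im \<tau>)"
  have \<omega>: "\<omega>\<^sub>1 \<noteq> 0" and \<tau>: "Im \<tau> > 0" using per by (auto simp: lattice_periods_def \<tau>_def)
  have Im_\<tau>: "Im \<tau> = lattice_area \<omega>\<^sub>1 \<omega>\<^sub>2 / (cmod \<omega>\<^sub>1)\<^sup>2"
    unfolding \<tau>_def by (subst complex_div_cnj) (simp add: lattice_area_def mult.commute)
  obtain K where K: "K \<ge> 0" "\<And>W C A M z. \<lbrakk>W holomorphic_on UNIV; 0 \<le> A; A < \<kappa>; \<And>z. cmod (W z) \<le> C * exp (A * (cmod z)\<^sup>2);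
     \<And>l. l \<in> lattice 1 \<tau> \<Longrightarrow> cmod (W l) \<le> M; \<bar>Im z / Im \<tau>\<bar> \<le> 1/2; \<bar>Re z - Im z / Im \<tau> * Re \<tau>\<bar> \<le> 1/2\<rbrakk> 
       \<Longrightarrow> cmod (W z) \<le> K * M"
    using interpolation_on_cell[OF \<tau> \<kappa>_def] by blast
  define A1 where "A1 = A * (cmod \<omega>\<^sub>1)\<^sup>2"
  have A1: "0 \<le> A1" "A1 < \<kappa>"
  proof -
    show "0 \<le> A1" using A by (simp add: A1_def)
    have "A1 < pi / (2 * lattice_area \<omega>\<^sub>1 \<omega>\<^sub>2) * (cmod \<omega>\<^sub>1)\<^sup>2"
      unfolding A1_def using A \<omega> by (intro mult_strict_right_mono) auto
    thus "A1 < \<kappa>" by (simp add: \<kappa>_def Im_\<tau>)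
  qed
  define A2 where "A2 = (A1 + \<kappa>) / 2"
  have A2: "A1 < A2" "A2 < \<kappa>" using A1 by (auto simp: A2_def)
  define W1 where "W1 = (\<lambda>z. W (\<omega>\<^sub>1 * z))"
  obtain C where C: "C \<ge> 0" "\<And>z. cmod (W z) \<le> C * exp (A * (cmod z)\<^sup>2)"
    using W by (rule gaussian_growthE) (rule that; assumption)
  have W_hol: "W holomorphic_on UNIV" using W by (rule gaussian_growth_holomorphic)
  have hol: "(\<lambda>z. W1 (z + \<mu>)) holomorphic_on UNIV" for \<mu>
  proof -
    have "(W \<circ> (\<lambda>z. \<omega>\<^sub>1 * (z + \<mu>))) holomorphic_on UNIV"
      by (rule holomorphic_on_compose_gen[OF _ W_hol]) (auto intro!: holomorphic_intros)
    thus ?thesis by (simp add: W1_def o_def)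
  qed
  have W1: "cmod (W1 z) \<le> C * exp (A1 * (cmod z)\<^sup>2)" for z
    using C(2)[of "\<omega>\<^sub>1 * z"] by (simp add: W1_def A1_def norm_mult power_mult_distrib mult_ac)
  have lat1: "cmod (W1 l) \<le> M" if "l \<in> lattice 1 \<tau>" for l
    unfolding W1_def by (rule bounded, unfold lattice_scale[OF \<omega>] \<tau>_def[symmetric]) (rule imageI[OF that])
  have bound: "cmod (W1 z) \<le> K * M" for z
  proof -
    define b where "b = Im z / Im \<tau>"
    define a where "a = Re z - b * Re \<tau>"
    define \<mu> where "\<mu> = of_int \<lfloor>a + 1/2\<rfloor> * 1 + of_int \<lfloor>b + 1/2\<rfloor> * \<tau>"
    have \<mu>: "\<mu> \<in> lattice 1 \<tau>" unfolding \<mu>_def lattice_def by blast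
    have round: "\<bar>x - of_int \<lfloor>x + 1/2\<rfloor>\<bar> \<le> 1/2" for x :: real by linarith
    have b': "Im (z - \<mu>) / Im \<tau> = b - of_int \<lfloor>b + 1/2\<rfloor>"
      using \<tau> by (simp add: \<mu>_def b_def field_simps)
    have a': "Re (z - \<mu>) - Im (z - \<mu>) / Im \<tau> * Re \<tau> = a - of_int \<lfloor>a + 1/2\<rfloor>"
      unfolding b' by (simp add: \<mu>_def a_def algebra_simps)
    have "cmod (W1 ((z - \<mu>) + \<mu>)) \<le> K * M"
    proof (rule K(2)[OF hol, of A2])
      show "0 \<le> A2" "A2 < \<kappa>" using A1 A2 by auto
      show "cmod (W1 (z + \<mu>)) \<le> (C * exp (A1 * A2 / (A2 - A1) * (cmod \<mu>)\<^sup>2)) * exp (A2 * (cmod z)\<^sup>2)" for z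
      proof -
        have "cmod (W1 (z + \<mu>)) \<le> C * exp (A1 * (cmod (z + \<mu>))\<^sup>2)" by (rule W1)
        also have "\<dots> \<le> C * (exp (A1 * A2 / (A2 - A1) * (cmod \<mu>)\<^sup>2) * exp (A2 * (cmod z)\<^sup>2))"
          by (intro mult_left_mono gaussian_growth_shift A1 A2 C order_refl)
        finally show ?thesis by (simp add: mult.assoc)
      qed
      show "cmod (W1 (l + \<mu>)) \<le> M" if "l \<in> lattice 1 \<tau>" for l
        by (rule lat1[OF lattice_add[OF that \<mu>]])
      show "\<bar>Im (z - \<mu>) / Im \<tau>\<bar> \<le> 1/2" unfolding b' by (rule round)
      show "\<bar>Re (z - \<mu>) - Im (z - \<mu>) / Im \<tau> * Re \<tau>\<bar> \<le> 1/2" unfolding a' by (rule round)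
    qed
    thus ?thesis by simp
  qed
  have "cmod (W z) \<le> K * M" for z using bound[of "z / \<omega>\<^sub>1"] \<omega> by (simp add: W1_def)
  hence "bounded (range W)" by (auto simp: bounded_iff)
  thus ?thesis by (rule Liouville_theorem[OF W_hol])
qed

corollary lattice_Liouville_decay:
  assumes per: "lattice_periods \<omega>\<^sub>1 \<omega>\<^sub>2" and W: "gaussian_growth A W" 
    and A: "0 \<le> A" "A < pi / (2 * lattice_area \<omega>\<^sub>1 \<omega>\<^sub>2)" and \<delta>: "\<delta> > 0"
    and decay: "\<And>l. l \<in> lattice \<omega>\<^sub>1 \<omega>\<^sub>2 \<Longrightarrow> cmod (W l) \<le> M * exp (- \<delta> * (cmod l)\<^sup>2)"
  shows "W z = 0"
proof -
  have \<omega>: "\<omega>\<^sub>1 \<noteq> 0" using per by (simp add: lattice_periods_def)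
  have M: "M \<ge> 0" using order_trans[OF norm_ge_zero decay[OF zero_in_lattice]] by simp
  have "cmod (W l) \<le> M" if "l \<in> lattice \<omega>\<^sub>1 \<omega>\<^sub>2" for l
  proof -
    have "M * exp (- \<delta> * (cmod l)\<^sup>2) \<le> M * 1" using M \<delta> by (intro mult_left_mono) auto
    thus ?thesis using decay[OF that] by simp
  qed
  hence "W constant_on UNIV" by (rule lattice_Liouville_bounded[OF per W A])
  then obtain c where c: "\<And>z. W z = c" unfolding constant_on_def by blast
  have "cmod c \<le> M * exp (- \<delta> * (real n * cmod \<omega>\<^sub>1)\<^sup>2)" for n
  proof -
    have "of_int (int n) * \<omega>\<^sub>1 + of_int 0 * \<omega>\<^sub>2 \<in> lattice \<omega>\<^sub>1 \<omega>\<^sub>2" unfolding lattice_def by blast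
    from decay[OF this] show ?thesis by (simp add: c norm_mult)
  qed
  moreover have "(\<lambda>n. M * exp (- \<delta> * (real n * cmod \<omega>\<^sub>1)\<^sup>2)) \<longlonglongrightarrow> M * 0"
  proof (intro tendsto_intros)
    have "filterlim (\<lambda>n. \<delta> * (cmod \<omega>\<^sub>1)\<^sup>2 * (real n)\<^sup>2) at_top sequentially"
      using \<delta> \<omega> by (intro filterlim_tendsto_pos_mult_at_top[OF tendsto_const] 
          filterlim_pow_at_top filterlim_real_sequentially) auto
    hence "((\<lambda>n. exp (- (\<delta> * (cmod \<omega>\<^sub>1)\<^sup>2 * (real n)\<^sup>2))) \<longlongrightarrow> 0) sequentially"
      by (intro filterlim_compose[OF exp_at_bot] filterlim_uminus_at_bot_at_top[THEN filterlim_compose])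
    thus "(\<lambda>n. exp (- \<delta> * (real n * cmod \<omega>\<^sub>1)\<^sup>2)) \<longlonglongrightarrow> 0"
      by (simp add: power_mult_distrib mult_ac)
  qed
  ultimately have "cmod c \<le> M * 0" by (intro LIMSEQ_le_const) auto
  thus ?thesis using c by simp
qed

section \<open>Phase retrieval from noncollinear triples\<close>

text \<open>
  If \<open>x\<close>, \<open>p\<close> are the value and derivative of a holomorphic function at one point and \<open>y\<close> is its value at another point,
  at displacement \<open>v\<close>, this is the first-order Taylor estimate for the squared modulus.
\<close>

lemma modulus_square_expansion:
  fixes x y p v :: complex
  assumes R: "cmod (y - x - p * v) \<le> E * (cmod v)\<^sup>2" and x: "cmod x \<le> E" and p: "cmod p \<le> E" and v: "cmod v \<le> 2"
  shows "\<bar>(cmod y)\<^sup>2 - (cmod x)\<^sup>2 - 2 * Re (p * cnj x * v)\<bar> \<le> 11 * E\<^sup>2 * (cmod v)\<^sup>2"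
proof -
  define R where "R = y - x - p * v"
  have E: "E \<ge> 0" using x norm_ge_zero order_trans by blast
  have y: "y = x + (p * v + R)" by (simp add: R_def)
  have sq: "(cmod (a + b))\<^sup>2 = (cmod a)\<^sup>2 + (cmod b)\<^sup>2 + 2 * Re (cnj a * b)" for a b
    unfolding cmod_power2 by (simp add: power2_eq_square algebra_simps)
  have "(cmod y)\<^sup>2 - (cmod x)\<^sup>2 - 2 * Re (p * cnj x * v) = (cmod (p * v + R))\<^sup>2 + 2 * Re (cnj x * R)"
    unfolding y sq[of x] by (simp add: algebra_simps)
  moreover have "cmod (p * v + R) \<le> 3 * E * cmod v"
  proof -
    have "cmod (p * v) \<le> E * cmod v" using p by (simp add: norm_mult mult_right_mono)
    moreover have "E * (cmod v)\<^sup>2 \<le> E * (2 * cmod v)"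
      unfolding power2_eq_square using v E by (intro mult_left_mono mult_right_mono) auto
    ultimately show ?thesis using norm_triangle_ineq[of "p * v" R] R unfolding R_def[symmetric] by linarith
  qed
  hence "(cmod (p * v + R))\<^sup>2 \<le> (3 * E * cmod v)\<^sup>2" by (intro power_mono) auto
  hence "(cmod (p * v + R))\<^sup>2 \<le> 9 * (E\<^sup>2 * (cmod v)\<^sup>2)" by (simp add: power_mult_distrib)
  moreover have "\<bar>Re (cnj x * R)\<bar> \<le> E\<^sup>2 * (cmod v)\<^sup>2"
  proof -
    have "cmod (cnj x * R) \<le> E * (E * (cmod v)\<^sup>2)"
      unfolding norm_mult using x R E by (intro mult_mono) (auto simp: R_def)
    thus ?thesis using abs_Re_le_cmod[of "cnj x * R"] unfolding power2_eq_square[of E] mult.assoc by linarith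
  qed
  moreover have "0 \<le> (cmod (p * v + R))\<^sup>2" by simp
  ultimately show ?thesis unfolding mult.assoc by linarith
qed

text \<open>
  This is Cramer's rule for the real-linear functional \<open>v \<mapsto> Re (d v)\<close>: its values in two directions determine \<open>d\<close>, with a loss that is
  the inverse sine of the angle between the directions.
\<close>

lemma two_directional_bounds:
  fixes d v w :: complex
  assumes "\<bar>Re (d * v)\<bar> \<le> M * (cmod v)\<^sup>2" "\<bar>Re (d * w)\<bar> \<le> M * (cmod w)\<^sup>2"
  shows "cmod d * \<bar>Im (cnj v * w)\<bar> \<le> M * cmod v * cmod w * (cmod v + cmod w)"
proof -
  have "d * (2 * \<i> * of_real (Im (cnj v * w))) = 2 * (of_real (Re (d * w)) * cnj v - of_real (Re (d * v)) * cnj w)"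
    by (simp add: complex_eq_iff algebra_simps)
  hence "cmod d * (2 * \<bar>Im (cnj v * w)\<bar>) = 2 * cmod (of_real (Re (d * w)) * cnj v - of_real (Re (d * v)) * cnj w)"
    by (metis (no_types, opaque_lifting) norm_mult norm_of_real norm_ii norm_numeral mult_1_right)
  also have "\<dots> \<le> 2 * (\<bar>Re (d * w)\<bar> * cmod v + \<bar>Re (d * v)\<bar> * cmod w)"
    using norm_triangle_ineq4[of "of_real (Re (d * w)) * cnj v" "of_real (Re (d * v)) * cnj w"]
    by (simp add: norm_mult del: times_complex.sel)
  also have "\<dots> \<le> 2 * (M * (cmod w)\<^sup>2 * cmod v + M * (cmod v)\<^sup>2 * cmod w)"
    using assms by (intro mult_left_mono add_mono mult_right_mono) auto
  finally show ?thesis by (simp add: power2_eq_square algebra_simps)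
qed

lemma zero_wronskian_imp_proportional:
  assumes F: "F holomorphic_on UNIV" and H: "H holomorphic_on UNIV"
    and W: "\<And>z. deriv F z * H z = deriv H z * F z"
  shows "(\<forall>z. H z = 0) \<or> (\<exists>c. \<forall>z. F z = c * H z)"
proof (cases "\<forall>z. H z = 0")
  case False
  then obtain z0 where z0: "H z0 \<noteq> 0" by blast
  have "isCont H z0" using H holomorphic_on_imp_continuous_on continuous_on_eq_continuous_at by blast
  then obtain e where e: "e > 0" "\<And>z. dist z0 z < e \<Longrightarrow> H z \<noteq> 0"
    using continuous_at_avoid[of z0 H 0] z0 by blast
  have "((\<lambda>z. F z / H z) has_field_derivative 0) (at z within ball z0 e)" if "z \<in> ball z0 e" for z
  proof (rule has_field_derivative_at_within)
    have "(F has_field_derivative deriv F z) (at z)" "(H has_field_derivative deriv H z) (at z)"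
      using F H by (auto intro!: holomorphic_derivI[where S = UNIV])
    moreover have "deriv F z * H z - F z * deriv H z = 0" using W[of z] by (simp add: mult.commute)
    ultimately show "((\<lambda>z. F z / H z) has_field_derivative 0) (at z)"
      using DERIV_divide[of F "deriv F z" z UNIV H "deriv H z"] e(2)[of z] that by simp
  qed
  then obtain c where c: "\<And>z. z \<in> ball z0 e \<Longrightarrow> F z / H z = c"
    using has_field_derivative_zero_constant[of "ball z0 e" "\<lambda>z. F z / H z"] by auto
  have "F z = c * H z" for z
  proof (rule analytic_continuation_open[of "ball z0 e" UNIV F "\<lambda>z. c * H z" z])
    show "F z = c * H z" if "z \<in> ball z0 e" for z
      using c[OF that] e(2)[of z] that by (auto simp: divide_simps split: if_splits)
  qed (use e F H in \<open>auto intro!: holomorphic_intros\<close>)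
  thus ?thesis by blast
qed simp

text \<open>
  At \<open>x l\<close> let \<open>d = F' cnj F - H' cnj H\<close>, the complex gradient of \<open>\<bar>F\<bar>\<^sup>2 - \<bar>H\<bar>\<^sup>2\<close>. The three equalities of moduli and noncollinearity make
  \<open>d\<close> small. As \<open>\<bar>F\<bar> = \<bar>H\<bar>\<close> at \<open>x l\<close>, one has \<open>cnj F W = d H\<close> for the Wronskian \<open>W\<close> and
  \<open>\<bar>W\<bar> \<le> 2 E \<bar>F\<bar>\<close>, where \<open>E\<close> bounds \<open>F\<close>, \<open>H\<close> and their first two derivatives near \<open>l\<close>. Together these give
  \<open>\<bar>W\<bar>\<^sup>2 \<le> 2 E\<^sup>2 \<bar>d\<bar>\<close> without any lower bound on \<open>\<bar>F\<bar>\<close>. So \<open>W\<close> decays on the lattice and vanishes.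
\<close>

lemma phase_retrieval_from_triples:
  fixes F H :: "complex \<Rightarrow> complex" and x y z :: "complex \<Rightarrow> complex"
  assumes F: "gaussian_growth (pi / 2) F" and H: "gaussian_growth (pi / 2) H"
    and per: "lattice_periods \<omega>\<^sub>1 \<omega>\<^sub>2" and dens: "lattice_area \<omega>\<^sub>1 \<omega>\<^sub>2 < 1/2"
    and \<eta>: "\<eta> > 0" "2 * pi + \<eta> < \<gamma>" and c: "c > 0"
    and close: "\<And>l. l \<in> lattice \<omega>\<^sub>1 \<omega>\<^sub>2 \<Longrightarrow> cmod (x l - l) \<le> exp (- \<gamma> * (cmod l)\<^sup>2)"
       "\<And>l. l \<in> lattice \<omega>\<^sub>1 \<omega>\<^sub>2 \<Longrightarrow> cmod (y l - l) \<le> exp (- \<gamma> * (cmod l)\<^sup>2)"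
       "\<And>l. l \<in> lattice \<omega>\<^sub>1 \<omega>\<^sub>2 \<Longrightarrow> cmod (z l - l) \<le> exp (- \<gamma> * (cmod l)\<^sup>2)"
    and noncollinear: "\<And>l. l \<in> lattice \<omega>\<^sub>1 \<omega>\<^sub>2 \<Longrightarrow>
       c * exp (- \<eta> * (cmod l)\<^sup>2) * exp (- \<gamma> * (cmod l)\<^sup>2) * cmod (y l - x l) < \<bar>Im (cnj (y l - x l) * (z l - x l))\<bar>"
    and eq: "\<And>l. l \<in> lattice \<omega>\<^sub>1 \<omega>\<^sub>2 \<Longrightarrow> cmod (F (x l)) = cmod (H (x l))"
       "\<And>l. l \<in> lattice \<omega>\<^sub>1 \<omega>\<^sub>2 \<Longrightarrow> cmod (F (y l)) = cmod (H (y l))"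
       "\<And>l. l \<in> lattice \<omega>\<^sub>1 \<omega>\<^sub>2 \<Longrightarrow> cmod (F (z l)) = cmod (H (z l))"
  shows "\<exists>\<tau>. cmod \<tau> = 1 \<and> (\<forall>u. F u = \<tau> * H u)"
proof -
  let ?\<Lambda> = "lattice \<omega>\<^sub>1 \<omega>\<^sub>2"
  \<comment> \<open>\<open>\<beta>\<close> lies strictly between \<open>\<pi>/2\<close> and \<open>(\<gamma> - \<eta>)/4\<close>; \<open>\<alpha>'\<close> and \<open>\<alpha>\<close> interpolate, as each derivative costs an increase of the rate.\<close>
  define \<beta> where "\<beta> = (pi / 2 + (\<gamma> - \<eta>) / 4) / 2"
  define \<alpha> where "\<alpha> = (pi / 2 + \<beta>) / 2"
  define \<alpha>' where "\<alpha>' = (pi / 2 + \<alpha>) / 2"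
  have \<beta>: "\<beta> > pi / 2" "4 * \<beta> + \<eta> < \<gamma>" using \<eta> by (auto simp: \<beta>_def field_simps)
  have mid: "a < (a + b) / 2" "(a + b) / 2 < b" if "a < b" for a b :: real using that by auto
  have \<alpha>: "pi / 2 < \<alpha>" "\<alpha> < \<beta>" unfolding \<alpha>_def by (rule mid[OF \<beta>(1)])+
  have \<alpha>': "pi / 2 < \<alpha>'" "\<alpha>' < \<alpha>" unfolding \<alpha>'_def by (rule mid[OF \<alpha>(1)])+
  note \<alpha> = \<alpha> \<alpha>'
  have pos: "0 \<le> pi / 2" "0 < \<beta>" "0 < \<alpha>" "0 < \<alpha>'"
    using less_trans[OF pi_half_gt_zero] \<beta>(1) \<alpha>(1,3) by simp_all
  have F_hol: "F holomorphic_on UNIV" and H_hol: "H holomorphic_on UNIV"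
    using F H by (auto intro: gaussian_growth_holomorphic)
  have area: "lattice_area \<omega>\<^sub>1 \<omega>\<^sub>2 > 0" using per by (rule lattice_periods_area_pos)
  have crit: "pi < pi / (2 * lattice_area \<omega>\<^sub>1 \<omega>\<^sub>2)" using dens area by (simp add: field_simps)
  define F' where "F' = deriv F"
  define F'' where "F'' = deriv F'"
  define H' where "H' = deriv H"
  define H'' where "H'' = deriv H'"
  have hol': "F' holomorphic_on UNIV" "H' holomorphic_on UNIV"
    unfolding F'_def H'_def by (intro holomorphic_deriv F_hol H_hol open_UNIV)+
  have D: "(F has_field_derivative F' u) (at u)" "(H has_field_derivative H' u) (at u)"
     "(F' has_field_derivative F'' u) (at u)" "(H' has_field_derivative H'' u) (at u)" for u
    using F_hol H_hol hol' unfolding F''_def H''_def by (auto simp: F'_def H'_def intro!: holomorphic_derivI[where S = UNIV])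
  have gF': "gaussian_growth \<alpha>' F'" and gH': "gaussian_growth \<alpha>' H'"
    unfolding F'_def H'_def using F H \<alpha> pos by (auto intro!: gaussian_growth_deriv)
  have gF'': "gaussian_growth \<alpha> F''" and gH'': "gaussian_growth \<alpha> H''"
    unfolding F''_def H''_def using gF' gH' \<alpha> pos by (auto intro!: gaussian_growth_deriv)
  have loc: "\<exists>C\<ge>0. \<forall>l u. cmod (u - l) \<le> 1 \<longrightarrow> cmod (f u) \<le> C * exp (\<beta> * (cmod l)\<^sup>2)"
    if "gaussian_growth a f" "0 \<le> a" "a < \<beta>" for a f
    using gaussian_growth_local[OF that, of 1] by metis
  obtain CF where CF: "CF \<ge> 0" "\<And>l u. cmod (u - l) \<le> 1 \<Longrightarrow> cmod (F u) \<le> CF * exp (\<beta> * (cmod l)\<^sup>2)"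
    using loc[OF F] pos \<beta> by auto
  obtain CH where CH: "CH \<ge> 0" "\<And>l u. cmod (u - l) \<le> 1 \<Longrightarrow> cmod (H u) \<le> CH * exp (\<beta> * (cmod l)\<^sup>2)"
    using loc[OF H] pos \<beta> by auto
  obtain CF' where CF': "CF' \<ge> 0" "\<And>l u. cmod (u - l) \<le> 1 \<Longrightarrow> cmod (F' u) \<le> CF' * exp (\<beta> * (cmod l)\<^sup>2)"
    using loc[OF gF'] pos \<alpha> by auto
  obtain CH' where CH': "CH' \<ge> 0" "\<And>l u. cmod (u - l) \<le> 1 \<Longrightarrow> cmod (H' u) \<le> CH' * exp (\<beta> * (cmod l)\<^sup>2)"
    using loc[OF gH'] pos \<alpha> by auto
  obtain CF'' where CF'': "CF'' \<ge> 0" "\<And>l u. cmod (u - l) \<le> 1 \<Longrightarrow> cmod (F'' u) \<le> CF'' * exp (\<beta> * (cmod l)\<^sup>2)"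
    using loc[OF gF''] pos \<alpha> by auto
  obtain CH'' where CH'': "CH'' \<ge> 0" "\<And>l u. cmod (u - l) \<le> 1 \<Longrightarrow> cmod (H'' u) \<le> CH'' * exp (\<beta> * (cmod l)\<^sup>2)"
    using loc[OF gH''] pos \<alpha> by auto
  define C where "C = CF + CH + CF' + CH' + CF'' + CH''"
  have C0: "C \<ge> 0" using CF(1) CH(1) CF'(1) CH'(1) CF''(1) CH''(1) by (simp add: C_def)
  define E where "E = (\<lambda>l. C * exp (\<beta> * (cmod l)\<^sup>2))"
  have E0: "E l \<ge> 0" for l using C0 by (simp add: E_def)
  have up: "a * exp (\<beta> * (cmod l)\<^sup>2) \<le> E l" if "a \<le> C" for a l
    unfolding E_def using that by (intro mult_right_mono) auto
  have bounds: "cmod (F u) \<le> E l" "cmod (H u) \<le> E l" "cmod (F' u) \<le> E l" "cmod (H' u) \<le> E l"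
     "cmod (F'' u) \<le> E l" "cmod (H'' u) \<le> E l" if "cmod (u - l) \<le> 1" for u l
    using CF(1) CH(1) CF'(1) CH'(1) CF''(1) CH''(1)
    by (auto intro!: order_trans[OF CF(2)[OF that] up] order_trans[OF CH(2)[OF that] up] 
        order_trans[OF CF'(2)[OF that] up] order_trans[OF CH'(2)[OF that] up] 
        order_trans[OF CF''(2)[OF that] up] order_trans[OF CH''(2)[OF that] up] simp: C_def)
  have taylor: "cmod (f v - f u - f' u * (v - u)) \<le> E l * (cmod (v - u))\<^sup>2"
    if "\<And>u. (f has_field_derivative f' u) (at u)" "\<And>u. (f' has_field_derivative f'' u) (at u)"
       "\<And>u. cmod (u - l) \<le> 1 \<Longrightarrow> cmod (f'' u) \<le> E l" "cmod (u - l) \<le> 1" "cmod (v - l) \<le> 1" for f f' f'' u v l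
  proof -
    define g where "g = (\<lambda>i::nat. if i = 0 then f else if i = 1 then f' else f'')"
    have "cmod (g 0 v - (\<Sum>i\<le>1. g i u * (v - u) ^ i / fact i)) \<le> E l * cmod (v - u) ^ (Suc 1) / fact 1"
    proof (rule complex_Taylor)
      show "convex (cball l 1)" by simp
      show "(g i has_field_derivative g (Suc i) w) (at w within cball l 1)" if "w \<in> cball l 1" "i \<le> 1" for i w
        using that \<open>\<And>u. (f has_field_derivative f' u) (at u)\<close> \<open>\<And>u. (f' has_field_derivative f'' u) (at u)\<close>
        by (cases i) (auto simp: g_def intro: has_field_derivative_at_within)
      show "cmod (g (Suc 1) w) \<le> E l" if "w \<in> cball l 1" for w
        using that \<open>\<And>u. cmod (u - l) \<le> 1 \<Longrightarrow> cmod (f'' u) \<le> E l\<close> by (simp add: g_def dist_norm norm_minus_commute)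
    qed (use that in \<open>auto simp: dist_norm norm_minus_commute\<close>)
    thus ?thesis by (simp add: g_def power2_eq_square diff_diff_eq)
  qed
  define f where "f = (\<lambda>l. exp (- \<gamma> * (cmod l)\<^sup>2))"
  have f1: "0 < f l" "f l \<le> 1" for l
  proof -
    have "\<gamma> > 0" using \<eta> pi_gt_zero by linarith
    thus "0 < f l" "f l \<le> 1" by (auto simp: f_def)
  qed
  have near: "cmod (x l - l) \<le> 1" "cmod (y l - l) \<le> 1" "cmod (z l - l) \<le> 1" if "l \<in> ?\<Lambda>" for l
    using close[OF that] f1(2)[of l] unfolding f_def by linarith+
  define W where "W = (\<lambda>u. F' u * H u - H' u * F u)"
  define \<delta> where "\<delta> = (\<gamma> - \<eta> - 4 * \<beta>) / 2"
  have \<delta>: "\<delta> > 0" using \<beta> by (simp add: \<delta>_def)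
  define K where "K = sqrt (176 * C ^ 4 / c)"
  have W_x: "cmod (W (x l)) \<le> K * exp (- \<delta> * (cmod l)\<^sup>2)" if l: "l \<in> ?\<Lambda>" for l
  proof -
    define d where "d = F' (x l) * cnj (F (x l)) - H' (x l) * cnj (H (x l))"
    have directional: "\<bar>Re (d * (w - x l))\<bar> \<le> 11 * (E l)\<^sup>2 * (cmod (w - x l))\<^sup>2" 
      if w: "cmod (w - l) \<le> 1" "cmod (F w) = cmod (H w)" for w
    proof -
      have wx: "cmod (w - x l) \<le> 2" using norm_triangle_ineq4[of "w - l" "x l - l"] w near[OF l] by simp
      have "\<bar>(cmod (F w))\<^sup>2 - (cmod (F (x l)))\<^sup>2 - 2 * Re (F' (x l) * cnj (F (x l)) * (w - x l))\<bar> \<le> 11 * (E l)\<^sup>2 * (cmod (w - x l))\<^sup>2"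
        by (intro modulus_square_expansion taylor[where f'' = F''] D bounds near l w wx)
      moreover have "\<bar>(cmod (H w))\<^sup>2 - (cmod (H (x l)))\<^sup>2 - 2 * Re (H' (x l) * cnj (H (x l)) * (w - x l))\<bar> \<le> 11 * (E l)\<^sup>2 * (cmod (w - x l))\<^sup>2"
        by (intro modulus_square_expansion taylor[where f'' = H''] D bounds near l w wx)
      moreover have "Re (d * (w - x l)) = Re (F' (x l) * cnj (F (x l)) * (w - x l)) - Re (H' (x l) * cnj (H (x l)) * (w - x l))"
        unfolding d_def by (simp only: left_diff_distrib minus_complex.sel)
      moreover have "(cmod (F w))\<^sup>2 = (cmod (H w))\<^sup>2" "(cmod (F (x l)))\<^sup>2 = (cmod (H (x l)))\<^sup>2"
        using w(2) eq(1)[OF l] by simp_all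
      ultimately show ?thesis by linarith
    qed
    define v where "v = cmod (y l - x l)"
    define w where "w = cmod (z l - x l)"
    have vw: "0 \<le> v" "v \<le> 2 * f l" "0 \<le> w" "w \<le> 2 * f l"
      using norm_triangle_ineq4[of "y l - l" "x l - l"] norm_triangle_ineq4[of "z l - l" "x l - l"] close[OF l]
      by (auto simp: v_def w_def f_def)
    have "cmod d * \<bar>Im (cnj (y l - x l) * (z l - x l))\<bar> \<le> 11 * (E l)\<^sup>2 * v * w * (v + w)"
      unfolding v_def w_def by (intro two_directional_bounds directional near l eq)
    also have "\<dots> \<le> 11 * (E l)\<^sup>2 * v * (2 * f l) * (4 * f l)"
      using vw E0 f1(1)[of l] by (intro mult_mono mult_nonneg_nonneg) auto
    finally have 1: "cmod d * \<bar>Im (cnj (y l - x l) * (z l - x l))\<bar> \<le> 88 * (E l)\<^sup>2 * v * (f l)\<^sup>2"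
      by (simp add: power2_eq_square)
    have v0: "v > 0" using noncollinear[OF l] vw(1) by (cases "y l = x l") (auto simp: v_def)
    define e where "e = c * exp (- \<eta> * (cmod l)\<^sup>2)"
    have e: "e > 0" using c by (simp add: e_def)
    have "cmod d * (e * f l * v) \<le> cmod d * \<bar>Im (cnj (y l - x l) * (z l - x l))\<bar>"
      using noncollinear[OF l] by (intro mult_left_mono) (auto simp: e_def f_def v_def)
    hence "(cmod d * e) * (f l * v) \<le> (88 * (E l)\<^sup>2 * f l) * (f l * v)"
      using 1 by (simp add: power2_eq_square mult_ac)
    hence "cmod d * e \<le> 88 * (E l)\<^sup>2 * f l" using v0 f1(1)[of l] by simp
    hence d: "cmod d \<le> 88 * (E l)\<^sup>2 * f l / e" using e by (simp add: field_simps)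
    have nF: "cnj (F (x l)) * F (x l) = cnj (H (x l)) * H (x l)"
      using eq(1)[OF l] complex_norm_square by (metis mult.commute)
    have "cnj (F (x l)) * W (x l) = d * H (x l)"
    proof -
      have "cnj (F (x l)) * W (x l) = F' (x l) * cnj (F (x l)) * H (x l) - H' (x l) * (cnj (F (x l)) * F (x l))"
        by (simp add: W_def algebra_simps)
      also have "\<dots> = d * H (x l)" unfolding nF by (simp add: d_def algebra_simps)
      finally show ?thesis .
    qed
    hence FW: "cmod (F (x l)) * cmod (W (x l)) \<le> cmod d * E l"
      using bounds(2)[OF near(1)[OF l]] by (metis complex_mod_cnj mult_left_mono norm_ge_zero norm_mult)
    have "cmod (W (x l)) \<le> E l * cmod (H (x l)) + E l * cmod (F (x l))"
      unfolding W_def using bounds(3,4)[OF near(1)[OF l]] 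
      by (intro order_trans[OF norm_triangle_ineq4] add_mono) (auto simp: norm_mult intro: mult_right_mono)
    hence "cmod (W (x l)) \<le> 2 * E l * cmod (F (x l))" using eq(1)[OF l] by simp
    hence "cmod (W (x l)) * cmod (W (x l)) \<le> 2 * E l * cmod (F (x l)) * cmod (W (x l))"
      by (intro mult_right_mono) auto
    also have "\<dots> = 2 * E l * (cmod (F (x l)) * cmod (W (x l)))" by simp
    also have "\<dots> \<le> 2 * E l * (88 * (E l)\<^sup>2 * f l / e * E l)"
      using E0 FW d by (intro mult_left_mono order_trans[OF FW] mult_right_mono) auto
    also have "\<dots> = 176 * C ^ 4 / c * (exp (4 * \<beta> * (cmod l)\<^sup>2) * f l / exp (- \<eta> * (cmod l)\<^sup>2))"
    proof -
      have "(E l) ^ 4 = C ^ 4 * exp (4 * \<beta> * (cmod l)\<^sup>2)"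
        unfolding E_def power_mult_distrib by (simp add: exp_of_nat_mult[symmetric] mult_ac)
      moreover have "2 * E l * (88 * (E l)\<^sup>2 * f l / e * E l) = 176 * (E l) ^ 4 * f l / e"
        by (simp add: power2_eq_square power4_eq_xxxx)
      ultimately show ?thesis by (simp add: e_def mult_ac)
    qed
    also have "exp (4 * \<beta> * (cmod l)\<^sup>2) * f l / exp (- \<eta> * (cmod l)\<^sup>2) = (exp (- \<delta> * (cmod l)\<^sup>2))\<^sup>2"
      unfolding f_def exp_add[symmetric] exp_diff[symmetric] exp_double[symmetric] \<delta>_def
      by (rule arg_cong[where f = exp]) (simp add: algebra_simps add_divide_distrib diff_divide_distrib)
    finally have "(cmod (W (x l)))\<^sup>2 \<le> (K * exp (- \<delta> * (cmod l)\<^sup>2))\<^sup>2"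
      unfolding K_def power_mult_distrib using C0 c by (simp add: power2_eq_square)
    thus ?thesis by (rule power2_le_imp_le) (use C0 c in \<open>simp add: K_def\<close>)
  qed
  have W_lat: "cmod (W l) \<le> (K + 2 * C\<^sup>2) * exp (- \<delta> * (cmod l)\<^sup>2)" if l: "l \<in> ?\<Lambda>" for l
  proof -
    have "cmod (W l - W (x l)) \<le> 2 * (E l)\<^sup>2 * cmod (l - x l)"
    proof (rule field_differentiable_bound)
      show "convex (cball l 1)" by simp
      fix u assume "u \<in> cball l 1"
      hence u: "cmod (u - l) \<le> 1" by (simp add: dist_norm norm_minus_commute)
      have "(W has_field_derivative F'' u * H u - H'' u * F u) (at u)"
        unfolding W_def using D[of u] by (auto intro!: derivative_eq_intros)
      thus "(W has_field_derivative F'' u * H u - H'' u * F u) (at u within cball l 1)"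
        by (rule has_field_derivative_at_within)
      have "cmod (F'' u * H u - H'' u * F u) \<le> E l * E l + E l * E l"
        using bounds[OF u] E0 by (intro order_trans[OF norm_triangle_ineq4] add_mono) (auto simp: norm_mult intro: mult_mono)
      thus "cmod (F'' u * H u - H'' u * F u) \<le> 2 * (E l)\<^sup>2" by (simp add: power2_eq_square)
    qed (use near[OF l] in \<open>auto simp: dist_norm norm_minus_commute\<close>)
    also have "\<dots> \<le> 2 * (E l)\<^sup>2 * f l"
      using close(1)[OF l] by (intro mult_left_mono) (auto simp: f_def norm_minus_commute)
    also have "\<dots> = 2 * C\<^sup>2 * exp ((2 * \<beta> - \<gamma>) * (cmod l)\<^sup>2)"
      unfolding E_def f_def power_mult_distrib exp_double[symmetric] mult.assoc exp_add[symmetric] by (simp add: algebra_simps)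
    also have "\<dots> \<le> 2 * C\<^sup>2 * exp (- \<delta> * (cmod l)\<^sup>2)"
    proof -
      have "\<gamma> > 0" using \<eta> pi_gt_zero by linarith
      hence "2 * \<beta> - \<gamma> \<le> - \<delta>" using \<eta> by (simp add: \<delta>_def field_simps)
      hence "(2 * \<beta> - \<gamma>) * (cmod l)\<^sup>2 \<le> - \<delta> * (cmod l)\<^sup>2" by (intro mult_right_mono) auto
      thus ?thesis by (intro mult_left_mono iffD2[OF exp_le_cancel_iff]) auto
    qed
    finally show ?thesis using W_x[OF l] norm_triangle_ineq2[of "W l" "W (x l)"] by (simp add: ring_distribs)
  qed
  have W_zero: "W u = 0" for u
  proof -
    \<comment> \<open>Half the critical rate exceeds \<open>\<pi>/2\<close>, so it can be used as growth rate of \<open>F'\<close> and \<open>H'\<close>.\<close>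
    define q where "q = pi / (2 * lattice_area \<omega>\<^sub>1 \<omega>\<^sub>2)"
    define a where "a = q / 2"
    have "pi < q" using crit by (simp only: q_def)
    hence a: "pi / 2 < a" "a + pi / 2 < q" by (auto simp: a_def)
    have a0: "0 \<le> a + pi / 2" using less_trans[OF pi_half_gt_zero a(1)] pi_half_gt_zero by linarith
    have "gaussian_growth a F'" "gaussian_growth a H'"
      unfolding F'_def H'_def using F H a pos by (auto intro!: gaussian_growth_deriv)
    hence "gaussian_growth (a + pi / 2) W"
      unfolding W_def using F H by (intro gaussian_growth_diff gaussian_growth_mult)
    thus ?thesis
      by (rule lattice_Liouville_decay[OF per _ _ _ \<delta> W_lat]) (use a a0 in \<open>simp_all only: q_def\<close>)
  qed
  have vanish: "f u = 0" if g: "gaussian_growth (pi / 2) f" and zero: "\<And>l. l \<in> ?\<Lambda> \<Longrightarrow> f (x l) = 0"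
     and "\<And>u. (f has_field_derivative f' u) (at u)" "\<And>u l. cmod (u - l) \<le> 1 \<Longrightarrow> cmod (f' u) \<le> E l" for f f' u
  proof (rule lattice_Liouville_decay[OF per g, of "\<gamma> - \<beta>" C])
    show "cmod (f l) \<le> C * exp (- (\<gamma> - \<beta>) * (cmod l)\<^sup>2)" if l: "l \<in> ?\<Lambda>" for l
    proof -
      have "cmod (f l - f (x l)) \<le> E l * cmod (l - x l)"
      proof (rule field_differentiable_bound)
        show "convex (cball l 1)" by simp
        show "(f has_field_derivative f' u) (at u within cball l 1)" for u
          by (rule has_field_derivative_at_within) fact
        show "cmod (f' u) \<le> E l" if "u \<in> cball l 1" for u
          using that \<open>\<And>u l. cmod (u - l) \<le> 1 \<Longrightarrow> cmod (f' u) \<le> E l\<close> by (simp add: dist_norm norm_minus_commute)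
      qed (use near[OF l] in \<open>auto simp: dist_norm norm_minus_commute\<close>)
      also have "\<dots> \<le> E l * exp (- \<gamma> * (cmod l)\<^sup>2)"
        using close(1)[OF l] E0 by (intro mult_left_mono) (auto simp: norm_minus_commute)
      also have "\<dots> = C * exp (- (\<gamma> - \<beta>) * (cmod l)\<^sup>2)"
        unfolding E_def mult.assoc exp_add[symmetric] by (simp add: algebra_simps)
      finally show ?thesis using zero[OF l] by simp
    qed
    show "\<gamma> - \<beta> > 0" using \<beta> \<eta> pos by linarith
    show "pi / 2 < pi / (2 * lattice_area \<omega>\<^sub>1 \<omega>\<^sub>2)" using crit pi_gt_zero by linarith
  qed (use pos in auto)
  have "deriv F u * H u = deriv H u * F u" for u
    using W_zero[of u] by (simp add: W_def F'_def H'_def)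
  from zero_wronskian_imp_proportional[OF F_hol H_hol this] show ?thesis
  proof
    assume H0: "\<forall>u. H u = 0"
    have "F u = 0" for u
      by (rule vanish[OF F _ D(1) bounds(3)]) (use eq(1) H0 in auto)
    thus ?thesis using H0 by (intro exI[of _ 1]) auto
  next
    assume "\<exists>\<tau>. \<forall>u. F u = \<tau> * H u"
    then obtain \<tau> where \<tau>: "\<And>u. F u = \<tau> * H u" by blast
    show ?thesis
    proof (cases "cmod \<tau> = 1")
      case False
      have "H (x l) = 0" if "l \<in> ?\<Lambda>" for l
        using eq(1)[OF that] False by (simp add: \<tau> norm_mult)
      hence "H u = 0" for u by (rule vanish[OF H _ D(2) bounds(4)])
      thus ?thesis using \<tau> by (intro exI[of _ 1]) auto
    qed (use \<tau> in blast)
  qed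
qed

section \<open>The Gabor transform as an entire function\<close>

lemma has_integral_gaussian:
  "has_bochner_integral lborel (\<lambda>t::real. exp (- (2 * pi) * (t - x)\<^sup>2)) (1 / sqrt 2)"
proof -
  define \<sigma> where "\<sigma> = 1 / (2 * sqrt pi)"
  have \<sigma>: "\<sigma> > 0" "2 * \<sigma>\<^sup>2 = 1 / (2 * pi)" "2 * pi * \<sigma>\<^sup>2 = 1 / 2"
    by (auto simp: \<sigma>_def power_mult_distrib power_divide)
  have eq: "exp (- (2 * pi) * (t - x)\<^sup>2) = (1 / sqrt 2) * normal_density x \<sigma> t" for t
    unfolding normal_density_def \<sigma>(2,3) by (simp add: real_sqrt_divide)
  have "has_bochner_integral lborel (normal_density x \<sigma>) 1"
    using \<sigma> integral_normal_density[of \<sigma> x] by (simp add: has_bochner_integral_iff)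
  from has_bochner_integral_mult_right[OF this, of "1 / sqrt 2"] show ?thesis
    unfolding eq by simp
qed

lemma gaussian_integrable: "integrable lebesgue (\<lambda>t::real. exp (- (2 * pi) * (t - x)\<^sup>2))"
  and gaussian_integral: "(LINT t|lebesgue. exp (- (2 * pi) * (t - x)\<^sup>2)) = 1 / sqrt 2"
  using has_integral_gaussian[of x] by (simp_all add: integrable_completion integral_completion has_bochner_integral_iff)

lemma L2_measurable: "g \<in> L2 \<Longrightarrow> g \<in> borel_measurable lebesgue"
  and L2_integrable: "g \<in> L2 \<Longrightarrow> integrable lebesgue (\<lambda>t. (cmod (g t))\<^sup>2)"
  by (auto simp: L2_def)

lemma borel_measurable_lebesgueI: "f \<in> borel_measurable borel \<Longrightarrow> f \<in> borel_measurable lebesgue"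
  by (rule measurable_completion) simp

lemma cnj_measurable_lebesgue:
  assumes "g \<in> borel_measurable lebesgue" 
  shows "(\<lambda>t. cnj (g t)) \<in> borel_measurable lebesgue"
  using measurable_compose[OF assms borel_measurable_continuous_onI[OF continuous_on_cnj[OF continuous_on_id]]] by simp

text \<open>
  The arithmetic-geometric mean inequality replaces Cauchy--Schwarz: the product is dominated by
  \<open>\<bar>g\<bar>\<^sup>2\<close> plus multiples of two shifted Gaussians.
\<close>

lemma L2_weight_integrable:
  assumes g: "g \<in> L2"
  shows "integrable lebesgue (\<lambda>t. cmod (g t) * exp (- pi * t\<^sup>2 + 2 * pi * r * \<bar>t\<bar>))"
proof -
  define k where "k = (\<lambda>t. exp (- pi * t\<^sup>2 + 2 * pi * r * \<bar>t\<bar>))"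
  have k_meas: "k \<in> borel_measurable lebesgue"
    unfolding k_def by (rule borel_measurable_lebesgueI) measurable
  let ?G = "\<lambda>s t. exp (- (2 * pi) * (t - s)\<^sup>2)"
  have int: "integrable lebesgue (\<lambda>t. (cmod (g t))\<^sup>2 + exp (2 * pi * r\<^sup>2) * (?G r t + ?G (- r) t))"
    by (intro Bochner_Integration.integrable_add integrable_mult_right L2_integrable g gaussian_integrable)
  have k2: "(k t)\<^sup>2 \<le> exp (2 * pi * r\<^sup>2) * (?G r t + ?G (- r) t)" for t
  proof -
    have "(k t)\<^sup>2 = exp (2 * pi * r\<^sup>2) * ?G (if t \<ge> 0 then r else - r) t"
      unfolding k_def exp_double[symmetric] exp_add[symmetric]
      by (rule arg_cong[where f = exp]) (auto simp: power2_eq_square algebra_simps)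
    also have "\<dots> \<le> exp (2 * pi * r\<^sup>2) * (?G r t + ?G (- r) t)"
      by (intro mult_left_mono) (auto simp: add_increasing add_increasing2)
    finally show ?thesis .
  qed
  have "integrable lebesgue (\<lambda>t. cmod (g t) * k t)"
  proof (rule Bochner_Integration.integrable_bound[OF int])
    show "(\<lambda>t. cmod (g t) * k t) \<in> borel_measurable lebesgue"
      using k_meas L2_measurable[OF g] by measurable
    have "cmod (g t) * k t \<le> (cmod (g t))\<^sup>2 + exp (2 * pi * r\<^sup>2) * (?G r t + ?G (- r) t)" for t
    proof -
      have "2 * (cmod (g t) * k t) \<le> (cmod (g t))\<^sup>2 + (k t)\<^sup>2"
        using sum_squares_bound[of "cmod (g t)" "k t"] by simp
      moreover have "0 \<le> cmod (g t) * k t" by (simp add: k_def)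
      ultimately show ?thesis using k2[of t] by linarith
    qed
    thus "AE t in lebesgue. norm (cmod (g t) * k t) \<le> norm ((cmod (g t))\<^sup>2 + exp (2 * pi * r\<^sup>2) * (?G r t + ?G (- r) t))"
      by (intro AE_I2) (simp add: k_def add_nonneg_nonneg)
  qed
  thus ?thesis by (simp add: k_def)
qed

text \<open>
  The conjugate on \<open>g\<close> makes the integral holomorphic in the time-frequency point \<open>z\<close> itself;
  without it the Gabor transform would correspond to a function of \<open>cnj z\<close>.
\<close>

definition bargmann :: "(real \<Rightarrow> complex) \<Rightarrow> complex \<Rightarrow> complex" where
  "bargmann g z = (LINT t|lebesgue. cnj (g t) * exp (of_real (- pi * t\<^sup>2) + of_real (2 * pi * t) * z))"

text \<open>
  The factor makes the growth rotation invariant: \<open>exp (\<pi> (Re z)\<^sup>2)\<close> turns into \<open>exp (\<pi>/2 \<bar>z\<bar>\<^sup>2)\<close>.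
\<close>

definition fock_transform :: "(real \<Rightarrow> complex) \<Rightarrow> complex \<Rightarrow> complex" where
  "fock_transform g z = bargmann g z * exp (- of_real (pi / 2) * z\<^sup>2)"

lemma bargmann_kernel_le:
  "cmod (exp (of_real (- pi * t\<^sup>2) + of_real (2 * pi * t) * z)) \<le> exp (- pi * t\<^sup>2 + 2 * pi * cmod z * \<bar>t\<bar>)"
proof -
  have "t * Re z \<le> \<bar>t\<bar> * \<bar>Re z\<bar>" using abs_ge_self[of "t * Re z"] by (simp only: abs_mult)
  also have "\<dots> \<le> \<bar>t\<bar> * cmod z" by (intro mult_left_mono abs_Re_le_cmod) auto
  finally have "t * Re z \<le> \<bar>t\<bar> * cmod z" .
  hence "2 * pi * (t * Re z) \<le> 2 * pi * (\<bar>t\<bar> * cmod z)" by (intro mult_left_mono) auto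
  thus ?thesis by (simp add: mult_ac)
qed

lemma bargmann_integrable:
  assumes g: "g \<in> L2"
  shows "integrable lebesgue (\<lambda>t. cnj (g t) * exp (of_real (- pi * t\<^sup>2) + of_real (2 * pi * t) * z))"
proof (rule Bochner_Integration.integrable_bound[OF L2_weight_integrable[OF g, of "cmod z"]])
  show "(\<lambda>t. cnj (g t) * exp (of_real (- pi * t\<^sup>2) + of_real (2 * pi * t) * z)) \<in> borel_measurable lebesgue"
    by (intro borel_measurable_times cnj_measurable_lebesgue L2_measurable g borel_measurable_lebesgueI) measurable
  show "AE t in lebesgue. norm (cnj (g t) * exp (of_real (- pi * t\<^sup>2) + of_real (2 * pi * t) * z))
    \<le> norm (cmod (g t) * exp (- pi * t\<^sup>2 + 2 * pi * cmod z * \<bar>t\<bar>))"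
    by (intro AE_I2) (use bargmann_kernel_le[of _ z] in \<open>simp add: norm_mult mult_left_mono\<close>)
qed

lemma gabor_eq_bargmann:
  "cnj (gabor_transform g z) = of_real (exp (- pi * (Re z)\<^sup>2)) * bargmann g z"
proof -
  have "cnj (gabor_transform g z) = (LINT t|lebesgue. cnj (g t * of_real (exp (- pi * (t - Re z)\<^sup>2))
                           * exp (- 2 * of_real pi * \<i> * of_real (Im z) * of_real t)))"
    unfolding gabor_transform_def by (rule Bochner_Integration.integral_cnj[symmetric])
  also have "\<dots> = (LINT t|lebesgue. of_real (exp (- pi * (Re z)\<^sup>2)) * (cnj (g t) * exp (of_real (- pi * t\<^sup>2) + of_real (2 * pi * t) * z)))"
  proof (rule Bochner_Integration.integral_cong[OF refl])
    fix t :: real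
    have "of_real (- pi * (t - Re z)\<^sup>2) + 2 * of_real pi * \<i> * of_real (Im z) * of_real t
      = of_real (- pi * (Re z)\<^sup>2) + (of_real (- pi * t\<^sup>2) + of_real (2 * pi * t) * z)"
      by (simp add: complex_eq_iff power2_eq_square algebra_simps)
    hence "exp (of_real (- pi * (t - Re z)\<^sup>2)) * exp (2 * of_real pi * \<i> * of_real (Im z) * of_real t)
      = exp (of_real (- pi * (Re z)\<^sup>2)) * exp (of_real (- pi * t\<^sup>2) + of_real (2 * pi * t) * z)"
      unfolding exp_add[symmetric] by (rule arg_cong)
    moreover have "cnj (exp (- 2 * of_real pi * \<i> * of_real (Im z) * of_real t)) =
        exp (2 * of_real pi * \<i> * of_real (Im z) * of_real t)"
      by (simp add: exp_cnj)
    moreover have "cnj (g t * of_real (exp (- pi * (t - Re z)\<^sup>2)) * exp (- 2 * of_real pi * \<i> * of_real (Im z) * of_real t)) =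
       cnj (g t) * (exp (of_real (- pi * (t - Re z)\<^sup>2)) * cnj (exp (- 2 * of_real pi * \<i> * of_real (Im z) * of_real t)))"
      by (simp only: complex_cnj_mult complex_cnj_complex_of_real exp_of_real mult.assoc)
    ultimately have "cnj (g t * of_real (exp (- pi * (t - Re z)\<^sup>2)) * exp (- 2 * of_real pi * \<i> * of_real (Im z) * of_real t)) =
       cnj (g t) * (exp (of_real (- pi * (Re z)\<^sup>2)) * exp (of_real (- pi * t\<^sup>2) + of_real (2 * pi * t) * z))"
      by (simp only:)
    thus "cnj (g t * of_real (exp (- pi * (t - Re z)\<^sup>2)) * exp (- 2 * of_real pi * \<i> * of_real (Im z) * of_real t)) =
      of_real (exp (- pi * (Re z)\<^sup>2)) * (cnj (g t) * exp (of_real (- pi * t\<^sup>2) + of_real (2 * pi * t) * z))"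
      by (simp only: exp_of_real mult.left_commute)
  qed
  finally show ?thesis unfolding bargmann_def by simp
qed

lemma cmod_fock_transform:
  "cmod (fock_transform g z) = cmod (bargmann g z) * exp (- (pi / 2) * ((Re z)\<^sup>2 - (Im z)\<^sup>2))"
proof -
  have "Re (- of_real (pi / 2) * z\<^sup>2) = - (pi / 2) * ((Re z)\<^sup>2 - (Im z)\<^sup>2)"
    by (simp add: power2_eq_square)
  thus ?thesis unfolding fock_transform_def norm_mult norm_exp_eq_Re by (simp only:)
qed

lemma cmod_gabor_eq_fock:
  "cmod (gabor_transform g z) = exp (- (pi / 2) * (cmod z)\<^sup>2) * cmod (fock_transform g z)"
proof -
  have "cmod (gabor_transform g z) = exp (- pi * (Re z)\<^sup>2) * cmod (bargmann g z)"
    using arg_cong[OF gabor_eq_bargmann[of g z], of cmod] by (simp add: norm_mult)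
  also have "- pi * (Re z)\<^sup>2 = - (pi / 2) * (cmod z)\<^sup>2 + - (pi / 2) * ((Re z)\<^sup>2 - (Im z)\<^sup>2)"
    unfolding cmod_power2 by (simp add: field_simps)
  finally show ?thesis unfolding exp_add cmod_fock_transform by (simp only: mult_ac)
qed

text \<open>
  The kernel is expanded into its exponential series in \<open>z\<close>. The partial sums of the absolute values are dominated by one integrable
  function, so integration can be interchanged with summation and yields an everywhere convergent power series.
\<close>

lemma bargmann_holomorphic:
  assumes g: "g \<in> L2"
  shows "bargmann g holomorphic_on UNIV"
proof -
  define w where "w = (\<lambda>t. cnj (g t) * exp (of_real (- pi * t\<^sup>2)))"
  have w_norm: "cmod (w t) = cmod (g t) * exp (- pi * t\<^sup>2)" for t by (simp add: w_def norm_mult)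
  define a where "a = (\<lambda>n. LINT t|lebesgue. w t * (of_real (2 * pi * t) ^ n /\<^sub>R fact n))"
  have sums: "(\<lambda>n. a n * z ^ n) sums bargmann g z" for z
  proof -
    define f where "f = (\<lambda>n t. w t * ((of_real (2 * pi * t) * z) ^ n /\<^sub>R fact n))"
    have w_meas: "w \<in> borel_measurable lebesgue"
      unfolding w_def by (intro borel_measurable_times cnj_measurable_lebesgue L2_measurable g borel_measurable_lebesgueI) measurable
    have f_meas: "f n \<in> borel_measurable lebesgue" for n
      unfolding f_def by (intro borel_measurable_times w_meas borel_measurable_lebesgueI) measurable
    let ?d = "\<lambda>t. cmod (g t) * exp (- pi * t\<^sup>2 + 2 * pi * cmod z * \<bar>t\<bar>)"
    have partial: "(\<Sum>n<N. cmod (f n t)) \<le> ?d t" for N t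
    proof -
      let ?x = "2 * pi * cmod z * \<bar>t\<bar>"
      have "(\<Sum>n<N. cmod (f n t)) = cmod (w t) * (\<Sum>n<N. ?x ^ n /\<^sub>R fact n)"
        unfolding sum_distrib_left f_def
        by (intro sum.cong refl) (simp add: norm_mult norm_power mult_ac abs_mult)
      also have "\<dots> \<le> cmod (w t) * exp ?x"
        using exp_converges[of ?x] 
        by (intro mult_left_mono) (auto simp: sums_iff intro!: sum_le_suminf[THEN order_trans])
      also have "\<dots> = ?d t" by (simp add: w_norm exp_add[symmetric])
      finally show ?thesis .
    qed
    have single: "cmod (f n t) \<le> ?d t" for n t
    proof -
      have "cmod (f n t) \<le> (\<Sum>k<Suc n. cmod (f k t))" by (rule member_le_sum) auto
      thus ?thesis using partial order_trans by blast
    qed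
    have int_f: "integrable lebesgue (f n)" for n
      by (rule Bochner_Integration.integrable_bound[OF L2_weight_integrable[OF g, of "cmod z"]])
         (use single f_meas in auto)
    have lim: "(\<lambda>n. f n t) sums (cnj (g t) * exp (of_real (- pi * t\<^sup>2) + of_real (2 * pi * t) * z))" for t
      unfolding f_def exp_add mult.assoc[symmetric] w_def[symmetric] 
      using sums_mult[OF exp_converges[of "of_real (2 * pi * t) * z"], of "w t"] by (simp add: w_def)
    have "(\<lambda>n. integral\<^sup>L lebesgue (f n)) sums (LINT t|lebesgue. (\<Sum>n. f n t))"
    proof (rule sums_integral[OF int_f])
      show "AE t in lebesgue. summable (\<lambda>n. norm (f n t))"
        by (intro AE_I2 summableI_nonneg_bounded[OF _ partial]) auto
      show "summable (\<lambda>n. LINT t|lebesgue. norm (f n t))"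
      proof (rule summableI_nonneg_bounded)
        show "(\<Sum>n<N. LINT t|lebesgue. norm (f n t)) \<le> integral\<^sup>L lebesgue ?d" for N
          unfolding Bochner_Integration.integral_sum[OF integrable_norm[OF int_f], symmetric]
          by (intro integral_mono Bochner_Integration.integrable_sum integrable_norm int_f 
              L2_weight_integrable g partial)
      qed auto
    qed
    moreover have "(LINT t|lebesgue. (\<Sum>n. f n t)) = bargmann g z"
      unfolding bargmann_def by (intro Bochner_Integration.integral_cong refl sums_unique[symmetric] lim)
    moreover have "integral\<^sup>L lebesgue (f n) = a n * z ^ n" for n
    proof -
      have "f n = (\<lambda>t. (w t * (of_real (2 * pi * t) ^ n /\<^sub>R fact n)) * z ^ n)"
        by (simp add: f_def power_mult_distrib fun_eq_iff)
      thus ?thesis unfolding a_def by simp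
    qed
    ultimately show ?thesis by simp
  qed
  have "bargmann g holomorphic_on ball 0 r" for r
    by (rule power_series_holomorphic[where a = a]) (use sums in simp)
  hence "bargmann g field_differentiable at z" for z
    using holomorphic_on_imp_differentiable_at[of "bargmann g" "ball 0 (cmod z + 1)" z] by auto
  thus ?thesis by (simp add: holomorphic_on_def field_differentiable_at_within)
qed

lemma bargmann_bound:
  assumes g: "g \<in> L2"
  obtains C where "\<And>z. cmod (bargmann g z) \<le> C * exp (pi * (Re z)\<^sup>2)"
proof
  fix z
  define x where "x = Re z"
  let ?k = "\<lambda>t. exp (- pi * (t - x)\<^sup>2)"
  have "cmod (bargmann g z) \<le> (LINT t|lebesgue. exp (pi * x\<^sup>2) * ((cmod (g t))\<^sup>2 + exp (- (2 * pi) * (t - x)\<^sup>2)))"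
    unfolding bargmann_def
  proof (rule Bochner_Integration.integral_norm_bound_integral)
    show "integrable lebesgue (\<lambda>t. cnj (g t) * exp (of_real (- pi * t\<^sup>2) + of_real (2 * pi * t) * z))"
      by (rule bargmann_integrable[OF g])
    show "integrable lebesgue (\<lambda>t. exp (pi * x\<^sup>2) * ((cmod (g t))\<^sup>2 + exp (- (2 * pi) * (t - x)\<^sup>2)))"
      by (intro Bochner_Integration.integrable_add integrable_mult_right L2_integrable g gaussian_integrable)
    fix t :: real
    have "cmod (exp (of_real (- pi * t\<^sup>2) + of_real (2 * pi * t) * z)) = exp (pi * x\<^sup>2) * ?k t"
      by (simp add: x_def exp_add[symmetric] power2_eq_square algebra_simps)
    hence "norm (cnj (g t) * exp (of_real (- pi * t\<^sup>2) + of_real (2 * pi * t) * z)) = exp (pi * x\<^sup>2) * (cmod (g t) * ?k t)"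
      by (simp add: norm_mult)
    also have "\<dots> \<le> exp (pi * x\<^sup>2) * ((cmod (g t))\<^sup>2 + (?k t)\<^sup>2)"
    proof (intro mult_left_mono)
      have "2 * (cmod (g t) * ?k t) \<le> (cmod (g t))\<^sup>2 + (?k t)\<^sup>2"
        using sum_squares_bound[of "cmod (g t)" "?k t"] by simp
      moreover have "0 \<le> cmod (g t) * ?k t" by simp
      ultimately show "cmod (g t) * ?k t \<le> (cmod (g t))\<^sup>2 + (?k t)\<^sup>2" by linarith
    qed auto
    also have "(?k t)\<^sup>2 = exp (- (2 * pi) * (t - x)\<^sup>2)" by (simp add: exp_double[symmetric])
    finally show "norm (cnj (g t) * exp (of_real (- pi * t\<^sup>2) + of_real (2 * pi * t) * z))
      \<le> exp (pi * x\<^sup>2) * ((cmod (g t))\<^sup>2 + exp (- (2 * pi) * (t - x)\<^sup>2))" .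
  qed
  also have "\<dots> = exp (pi * x\<^sup>2) * ((LINT t|lebesgue. (cmod (g t))\<^sup>2) + 1 / sqrt 2)"
    by (simp only: integral_mult_right_zero gaussian_integral
        Bochner_Integration.integral_add[OF L2_integrable[OF g] gaussian_integrable])
  finally show "cmod (bargmann g z) \<le> ((LINT t|lebesgue. (cmod (g t))\<^sup>2) + 1 / sqrt 2) * exp (pi * (Re z)\<^sup>2)"
    by (simp add: x_def mult.commute)
qed

lemma fock_transform_growth:
  assumes g: "g \<in> L2"
  shows "gaussian_growth (pi / 2) (fock_transform g)"
proof -
  obtain C where C: "\<And>z. cmod (bargmann g z) \<le> C * exp (pi * (Re z)\<^sup>2)"
    using bargmann_bound[OF g] by blast
  have "cmod (fock_transform g z) \<le> C * exp (pi / 2 * (cmod z)\<^sup>2)" for z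
  proof -
    have "cmod (fock_transform g z) \<le> (C * exp (pi * (Re z)\<^sup>2)) * exp (- (pi / 2) * ((Re z)\<^sup>2 - (Im z)\<^sup>2))"
      unfolding cmod_fock_transform by (intro mult_right_mono C) auto
    also have "\<dots> = C * exp (pi * (Re z)\<^sup>2 + - (pi / 2) * ((Re z)\<^sup>2 - (Im z)\<^sup>2))"
      by (simp only: mult.assoc exp_add)
    also have "pi * (Re z)\<^sup>2 + - (pi / 2) * ((Re z)\<^sup>2 - (Im z)\<^sup>2) = pi / 2 * (cmod z)\<^sup>2"
      unfolding cmod_power2 by (simp add: field_simps)
    finally show ?thesis .
  qed
  moreover have "fock_transform g holomorphic_on UNIV"
    unfolding fock_transform_def by (intro holomorphic_intros bargmann_holomorphic g)
  ultimately show ?thesis unfolding gaussian_growth_def by blast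
qed

section \<open>Injectivity of the Fourier transform\<close>

text \<open>
  The positive and negative parts of \<open>k\<close> have the same Fourier transform, and in particular the same mass. After
  normalisation they are densities of two probability measures with the same characteristic function, which coincide by
  Levy's uniqueness theorem.
\<close>

lemma real_fourier_injective:
  fixes k :: "real \<Rightarrow> real"
  assumes k [measurable]: "integrable lborel k"
    and zero: "\<And>s. (CLINT t|lborel. of_real (k t) * iexp (s * t)) = 0"
  shows "AE t in lborel. k t = 0"
proof -
  note [measurable] = borel_measurable_integrable[OF k]
  define kp where "kp = (\<lambda>t. max 0 (k t))"
  define kn where "kn = (\<lambda>t. max 0 (- k t))"
  have k_eq: "k t = kp t - kn t" for t by (simp add: kp_def kn_def)
  have nonneg: "0 \<le> kp t" "0 \<le> kn t" for t by (auto simp: kp_def kn_def)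
  have int: "integrable lborel kp" "integrable lborel kn"
    unfolding kp_def kn_def using k by (auto intro!: integrable_max)
  note [measurable] = int[THEN borel_measurable_integrable]
  have int_c: "integrable lborel (\<lambda>t. of_real (f t) * iexp (s * t))" if "integrable lborel f" for f :: "real \<Rightarrow> real" and s
  proof (rule Bochner_Integration.integrable_bound[OF that])
    note [measurable] = borel_measurable_integrable[OF that]
    show "(\<lambda>t. of_real (f t) * iexp (s * t)) \<in> borel_measurable lborel" by measurable
  qed (auto simp: norm_mult)
  have eq: "(CLINT t|lborel. of_real (kp t) * iexp (s * t)) = (CLINT t|lborel. of_real (kn t) * iexp (s * t))" for s
  proof -
    have "(CLINT t|lborel. of_real (k t) * iexp (s * t)) 
       = (CLINT t|lborel. of_real (kp t) * iexp (s * t)) - (CLINT t|lborel. of_real (kn t) * iexp (s * t))"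
      unfolding Bochner_Integration.integral_diff[OF int_c[OF int(1)] int_c[OF int(2)], symmetric]
      by (simp add: k_eq left_diff_distrib)
    thus ?thesis using zero[of s] by simp
  qed
  define m where "m = integral\<^sup>L lborel kp"
  have m: "integral\<^sup>L lborel kp = m" "integral\<^sup>L lborel kn = m"
  proof -
    have "complex_of_real (integral\<^sup>L lborel kp) = of_real (integral\<^sup>L lborel kn)"
      using eq[of 0] by simp
    thus "integral\<^sup>L lborel kp = m" "integral\<^sup>L lborel kn = m" by (simp_all add: m_def)
  qed
  show ?thesis
  proof (cases "m = 0")
    case True
    have "AE t in lborel. kp t = 0" "AE t in lborel. kn t = 0"
      using m True integral_nonneg_eq_0_iff_AE[OF int(1)] integral_nonneg_eq_0_iff_AE[OF int(2)] nonneg by auto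
    thus ?thesis by eventually_elim (simp add: k_eq)
  next
    case False
    have "m \<ge> 0" unfolding m_def by (rule Bochner_Integration.integral_nonneg) (rule nonneg)
    hence m0: "m > 0" using False by simp
    define P where "P = (\<lambda>f::real\<Rightarrow>real. density lborel (\<lambda>t. ennreal (f t / m)))"
    have dist: "real_distribution (P f)" if f: "integrable lborel f" "\<And>t. 0 \<le> f t" "integral\<^sup>L lborel f = m" for f
    proof -
      note [measurable] = borel_measurable_integrable[OF f(1)]
      have "(\<integral>\<^sup>+ t. ennreal (f t / m) \<partial>lborel) = ennreal (integral\<^sup>L lborel (\<lambda>t. f t / m))"
        by (rule nn_integral_eq_integral) (use f m0 in auto)
      also have "\<dots> = 1" using f m0 by simp
      finally have "prob_space (P f)"
        by (intro prob_spaceI) (simp add: P_def emeasure_density)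
      thus ?thesis by (simp add: real_distribution_def real_distribution_axioms_def P_def)
    qed
    have char: "char (P f) s = (CLINT t|lborel. of_real (f t) * iexp (s * t)) / m" 
      if f: "integrable lborel f" "\<And>t. 0 \<le> f t" for f s
    proof -
      note [measurable] = borel_measurable_integrable[OF f(1)]
      have "char (P f) s = (CLINT t|lborel. (f t / m) *\<^sub>R iexp (s * t))"
        unfolding char_def P_def by (rule integral_density) (use f m0 in auto)
      also have "\<dots> = (CLINT t|lborel. of_real (f t) * iexp (s * t) / m)"
        by (simp add: scaleR_conv_of_real)
      finally show ?thesis by simp
    qed
    have "P kp = P kn"
      by (rule Levy_uniqueness[OF dist[OF int(1) nonneg(1) m(1)] dist[OF int(2) nonneg(2) m(2)]])
         (rule ext, simp only: char[OF int(1) nonneg(1)] char[OF int(2) nonneg(2)] eq)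
    hence "AE t in lborel. ennreal (kp t / m) = ennreal (kn t / m)"
      unfolding P_def by (intro sigma_finite_measure.density_unique[OF sigma_finite_lborel]) auto
    thus ?thesis 
      by eventually_elim (use m0 nonneg in \<open>simp add: k_eq ennreal_inj divide_nonneg_pos\<close>)
  qed
qed

text \<open>
  The conjugate of \<open>k\<close> also has vanishing Fourier transform, hence so do the real and imaginary parts.
\<close>

lemma fourier_injective:
  fixes k :: "real \<Rightarrow> complex"
  assumes k: "integrable lebesgue k"
    and zero: "\<And>s. (CLINT t|lebesgue. k t * iexp (s * t)) = 0"
  shows "AE t in lebesgue. k t = 0"
proof -
  have real: "AE t in lebesgue. f t = 0" if f: "integrable lebesgue f" 
      and f0: "\<And>s. (CLINT t|lebesgue. of_real (f t) * iexp (s * t)) = 0" for f :: "real \<Rightarrow> real"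
  proof -
    obtain f' where f': "f' \<in> borel_measurable lborel" "AE t in lborel. f t = f' t"
      using completion_ex_borel_measurable_real[OF borel_measurable_integrable[OF f]] by blast
    note [measurable] = f'(1)
    have ae: "AE t in lebesgue. f t = f' t" using f'(2) by (rule AE_completion)
    have f'_leb: "f' \<in> borel_measurable lebesgue" using f'(1) by (rule measurable_completion)
    have "integrable lebesgue f'"
      using integrable_cong_AE[OF borel_measurable_integrable[OF f] f'_leb ae] f by simp
    hence int: "integrable lborel f'" using f'(1) by (simp add: integrable_completion)
    have "(CLINT t|lborel. of_real (f' t) * iexp (s * t)) = 0" for s
    proof -
      have meas0: "(\<lambda>t. complex_of_real (f' t) * iexp (s * t)) \<in> borel_measurable lborel" by measurable
      hence meas: "(\<lambda>t. complex_of_real (f' t) * iexp (s * t)) \<in> borel_measurable lebesgue"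
        by (rule measurable_completion)
      have "(CLINT t|lborel. of_real (f' t) * iexp (s * t)) = (CLINT t|lebesgue. of_real (f' t) * iexp (s * t))"
        by (rule integral_completion[OF meas0, symmetric])
      also have "\<dots> = (CLINT t|lebesgue. of_real (f t) * iexp (s * t))"
      proof (rule integral_cong_AE[OF meas])
        have "(\<lambda>t. iexp (s * t)) \<in> borel_measurable lebesgue" by (rule measurable_completion) measurable
        thus "(\<lambda>t. of_real (f t) * iexp (s * t)) \<in> borel_measurable lebesgue"
          using borel_measurable_integrable[OF f] by (intro borel_measurable_times borel_measurable_of_real) auto
        show "AE t in lebesgue. complex_of_real (f' t) * iexp (s * t) = of_real (f t) * iexp (s * t)"
          using ae by eventually_elim simp
      qed
      also note f0
      finally show ?thesis .
    qed
    from AE_completion[OF real_fourier_injective[OF int this]] ae show ?thesis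
      by eventually_elim simp
  qed
  have im_eq: "complex_of_real (Im w) = (w - cnj w) / (2 * \<i>)" for w
    by (simp add: complex_eq_iff)
  have iexp_leb: "(\<lambda>t. iexp (s * t)) \<in> borel_measurable lebesgue" for s
    by (rule measurable_completion) measurable
  have int: "integrable lebesgue (\<lambda>t. k t * iexp (s * t))" for s
    by (rule Bochner_Integration.integrable_bound[OF k])
       (use borel_measurable_integrable[OF k] iexp_leb in \<open>auto simp: norm_mult intro: borel_measurable_times\<close>)
  have int': "integrable lebesgue (\<lambda>t. cnj (k t) * iexp (s * t))" for s
    using integrable_cnj[OF int[of "- s"]] by (simp add: exp_cnj)
  have zero': "(CLINT t|lebesgue. cnj (k t) * iexp (s * t)) = 0" for s
  proof -
    have "(CLINT t|lebesgue. cnj (k t) * iexp (s * t)) = (CLINT t|lebesgue. cnj (k t * iexp (- s * t)))"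
      by (simp add: exp_cnj)
    also have "\<dots> = cnj (CLINT t|lebesgue. k t * iexp (- s * t))" by (rule Bochner_Integration.integral_cnj)
    finally show ?thesis using zero[of "- s"] by simp
  qed
  have "AE t in lebesgue. Re (k t) = 0"
  proof (rule real)
    show "integrable lebesgue (\<lambda>t. Re (k t))" using k by (rule integrable_Re)
    show "(CLINT t|lebesgue. of_real (Re (k t)) * iexp (s * t)) = 0" for s
    proof -
      have "(CLINT t|lebesgue. of_real (Re (k t)) * iexp (s * t)) 
          = (CLINT t|lebesgue. (k t * iexp (s * t) + cnj (k t) * iexp (s * t)) / 2)"
        by (intro Bochner_Integration.integral_cong refl) (simp add: ring_distribs[symmetric] complex_add_cnj)
      also have "\<dots> = 0"
        unfolding integral_divide_zero Bochner_Integration.integral_add[OF int int'] zero zero' by simp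
      finally show ?thesis .
    qed
  qed
  moreover have "AE t in lebesgue. Im (k t) = 0"
  proof (rule real)
    show "integrable lebesgue (\<lambda>t. Im (k t))" using k by (rule integrable_Im)
    show "(CLINT t|lebesgue. of_real (Im (k t)) * iexp (s * t)) = 0" for s
    proof -
      have "(CLINT t|lebesgue. of_real (Im (k t)) * iexp (s * t)) 
          = (CLINT t|lebesgue. (k t * iexp (s * t) - cnj (k t) * iexp (s * t)) / (2 * \<i>))"
        by (intro Bochner_Integration.integral_cong refl) (simp only: im_eq times_divide_eq_left left_diff_distrib)
      also have "\<dots> = 0"
        unfolding integral_divide_zero Bochner_Integration.integral_diff[OF int int'] zero zero' by simp
      finally show ?thesis .
    qed
  qed
  ultimately show ?thesis by eventually_elim (simp add: complex_eq_iff)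
qed

text \<open>
  On the imaginary axis the Bargmann transform is the Fourier transform of \<open>t \<mapsto> cnj (g t) exp (- \<pi> t\<^sup>2)\<close>.
\<close>

lemma fock_transform_injective:
  assumes g: "g \<in> L2" and h: "h \<in> L2" and eq: "\<And>z. fock_transform g z = \<tau> * fock_transform h z"
  shows "AE t in lebesgue. g t = cnj \<tau> * h t"
proof -
  let ?K = "\<lambda>z t. exp (of_real (- pi * t\<^sup>2) + of_real (2 * pi * t) * z)"
  have eq_b: "bargmann g z = \<tau> * bargmann h z" for z
    using eq[of z] by (simp add: fock_transform_def)
  define k where "k = (\<lambda>t. cnj (g t) * ?K 0 t - \<tau> * (cnj (h t) * ?K 0 t))"
  have K: "?K 0 t * iexp (s * t) = ?K (\<i> * of_real (s / (2 * pi))) t" for s t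
    unfolding exp_add[symmetric] by (rule arg_cong[where f = exp]) (simp add: field_simps)
  have "AE t in lebesgue. k t = 0"
  proof (rule fourier_injective)
    show "integrable lebesgue k"
      unfolding k_def by (intro Bochner_Integration.integrable_diff integrable_mult_right bargmann_integrable g h)
    show "(CLINT t|lebesgue. k t * iexp (s * t)) = 0" for s
    proof -
      let ?z = "\<i> * of_real (s / (2 * pi))"
      have "k t * iexp (s * t) = cnj (g t) * ?K ?z t - \<tau> * (cnj (h t) * ?K ?z t)" for t
        unfolding k_def K[symmetric] by (simp only: left_diff_distrib mult.assoc)
      hence "(CLINT t|lebesgue. k t * iexp (s * t)) = (CLINT t|lebesgue. cnj (g t) * ?K ?z t - \<tau> * (cnj (h t) * ?K ?z t))"
        by (simp only:)
      also have "\<dots> = bargmann g ?z - \<tau> * bargmann h ?z"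
        unfolding bargmann_def
        by (simp only: integral_mult_right_zero Bochner_Integration.integral_diff[OF
              bargmann_integrable[OF g] integrable_mult_right[OF bargmann_integrable[OF h]]])
      finally show ?thesis using eq_b[of ?z] by simp
    qed
  qed
  thus ?thesis
  proof eventually_elim
    case (elim t)
    have "k t = (cnj (g t) - \<tau> * cnj (h t)) * ?K 0 t" by (simp add: k_def algebra_simps)
    hence "cnj (g t) = \<tau> * cnj (h t)" using elim by simp
    hence "cnj (cnj (g t)) = cnj (\<tau> * cnj (h t))" by (rule arg_cong)
    thus ?case by simp
  qed
qed

lemma gabor_uniqueness_from_triples:
  fixes x y z :: "complex \<Rightarrow> complex"
  assumes per: "lattice_periods \<omega>\<^sub>1 \<omega>\<^sub>2" and dens: "lattice_area \<omega>\<^sub>1 \<omega>\<^sub>2 < 1/2"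
    and \<eta>: "\<eta> > 0" "2 * pi + \<eta> < \<gamma>" and c: "c > 0"
    and close: "\<And>l. l \<in> lattice \<omega>\<^sub>1 \<omega>\<^sub>2 \<Longrightarrow> cmod (x l - l) \<le> exp (- \<gamma> * (cmod l)\<^sup>2)"
       "\<And>l. l \<in> lattice \<omega>\<^sub>1 \<omega>\<^sub>2 \<Longrightarrow> cmod (y l - l) \<le> exp (- \<gamma> * (cmod l)\<^sup>2)"
       "\<And>l. l \<in> lattice \<omega>\<^sub>1 \<omega>\<^sub>2 \<Longrightarrow> cmod (z l - l) \<le> exp (- \<gamma> * (cmod l)\<^sup>2)"
    and noncollinear: "\<And>l. l \<in> lattice \<omega>\<^sub>1 \<omega>\<^sub>2 \<Longrightarrow>
       c * exp (- \<eta> * (cmod l)\<^sup>2) * exp (- \<gamma> * (cmod l)\<^sup>2) * cmod (y l - x l) < \<bar>Im (cnj (y l - x l) * (z l - x l))\<bar>"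
    and U: "\<And>l. l \<in> lattice \<omega>\<^sub>1 \<omega>\<^sub>2 \<Longrightarrow> {x l, y l, z l} \<subseteq> U"
  shows "gabor_uniqueness_set U L2"
  unfolding gabor_uniqueness_set_def
proof (intro ballI impI)
  fix g h assume g: "g \<in> L2" and h: "h \<in> L2" 
    and eq: "\<forall>u\<in>U. cmod (gabor_transform g u) = cmod (gabor_transform h u)"
  have eqF: "cmod (fock_transform g u) = cmod (fock_transform h u)" if "u \<in> U" for u
    using eq that by (simp add: cmod_gabor_eq_fock)
  have "\<exists>\<tau>. cmod \<tau> = 1 \<and> (\<forall>u. fock_transform g u = \<tau> * fock_transform h u)"
    by (rule phase_retrieval_from_triples[OF fock_transform_growth[OF g] fock_transform_growth[OF h] 
         per dens \<eta> c close noncollinear])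
       (use U eqF in auto)
  then obtain \<tau> where \<tau>: "cmod \<tau> = 1" "\<And>u. fock_transform g u = \<tau> * fock_transform h u" by blast
  have "AE t in lebesgue. g t = cnj \<tau> * h t" by (rule fock_transform_injective[OF g h \<tau>(2)])
  thus "\<exists>\<tau>. cmod \<tau> = 1 \<and> (AE t in lebesgue. g t = \<tau> * h t)"
    using \<tau>(1) by (intro exI[of _ "cnj \<tau>"]) simp
qed

section \<open>Random triples in discs\<close>

text \<open>
  Both orders of the coordinates are needed below: a strip is sliced along the coordinate axis that is the more transversal to it.
\<close>

lemma lborel_complex_eq_distr:
  "distr (lborel \<Otimes>\<^sub>M lborel) borel (\<lambda>(x, y). Complex x y) = lborel" (is "?A")
  "distr (lborel \<Otimes>\<^sub>M lborel) borel (\<lambda>(x, y). Complex y x) = lborel" (is "?B")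
proof -
  have meas: "(\<lambda>(x, y). Complex x y) \<in> borel_measurable (lborel \<Otimes>\<^sub>M lborel)"
    "(\<lambda>(x, y). Complex y x) \<in> borel_measurable (lborel \<Otimes>\<^sub>M lborel)"
    unfolding Complex_eq by measurable
  have area: "(\<Prod>b\<in>Basis. (u - l) \<bullet> b) = (Re u - Re l) * (Im u - Im l)" for u l :: complex
    by (simp add: Basis_complex_def)
  have box: "(\<lambda>(x, y). Complex x y) -` box l u = {Re l<..<Re u} \<times> {Im l<..<Im u}"
    "(\<lambda>(x, y). Complex y x) -` box l u = {Im l<..<Im u} \<times> {Re l<..<Re u}" for l u
    by (auto simp: box_def Basis_complex_def)
  show ?A
  proof (rule lborel_eqI[symmetric])
    fix l u :: complex assume le: "\<And>b. b \<in> Basis \<Longrightarrow> l \<bullet> b \<le> u \<bullet> b"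
    have "Re l \<le> Re u" "Im l \<le> Im u" using le[of 1] le[of \<i>] by (auto simp: Basis_complex_def)
    thus "emeasure (distr (lborel \<Otimes>\<^sub>M lborel) borel (\<lambda>(x, y). Complex x y)) (box l u) = (\<Prod>b\<in>Basis. (u - l) \<bullet> b)"
      by (simp add: emeasure_distr meas box space_pair_measure lborel.emeasure_pair_measure_Times area ennreal_mult)
  qed simp
  show ?B
  proof (rule lborel_eqI[symmetric])
    fix l u :: complex assume le: "\<And>b. b \<in> Basis \<Longrightarrow> l \<bullet> b \<le> u \<bullet> b"
    have "Re l \<le> Re u" "Im l \<le> Im u" using le[of 1] le[of \<i>] by (auto simp: Basis_complex_def)
    thus "emeasure (distr (lborel \<Otimes>\<^sub>M lborel) borel (\<lambda>(x, y). Complex y x)) (box l u) = (\<Prod>b\<in>Basis. (u - l) \<bullet> b)"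
      by (simp add: emeasure_distr meas box space_pair_measure lborel.emeasure_pair_measure_Times area ennreal_mult mult.commute)
  qed simp
qed

lemma emeasure_lborel_le_slices:
  fixes h :: "real \<times> real \<Rightarrow> complex"
  assumes h: "h \<in> borel_measurable (lborel \<Otimes>\<^sub>M lborel)" "distr (lborel \<Otimes>\<^sub>M lborel) borel h = lborel"
    and A: "A \<in> sets borel" and "r \<ge> 0" "w \<ge> 0"
    and slices: "\<And>x y. h (x, y) \<in> A \<Longrightarrow> \<bar>x - p\<bar> \<le> r \<and> \<bar>y - k x\<bar> \<le> w"
  shows "emeasure lborel A \<le> ennreal (4 * r * w)"
proof -
  have "emeasure lborel A = emeasure (lborel \<Otimes>\<^sub>M lborel) (h -` A)"
    using emeasure_distr[OF h(1), of A] A h(2) by (simp add: space_pair_measure)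
  also have "\<dots> = (\<integral>\<^sup>+ x. emeasure lborel (Pair x -` (h -` A)) \<partial>lborel)"
    using measurable_sets[OF h(1), of A] A
    by (intro lborel.emeasure_pair_measure_alt) (simp add: space_pair_measure)
  also have "\<dots> \<le> (\<integral>\<^sup>+ x. ennreal (2 * w) * indicator {p - r..p + r} x \<partial>lborel)"
  proof (rule nn_integral_mono)
    fix x
    show "emeasure lborel (Pair x -` (h -` A)) \<le> ennreal (2 * w) * indicator {p - r..p + r} x"
    proof (cases "\<bar>x - p\<bar> \<le> r")
      case True
      have "emeasure lborel (Pair x -` (h -` A)) \<le> emeasure lborel {k x - w..k x + w}"
        using slices[of x] by (intro emeasure_mono) (force simp: abs_le_iff)+
      also have "\<dots> = ennreal (2 * w)" using \<open>w \<ge> 0\<close> by simp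
      finally show ?thesis using True by (simp add: abs_le_iff)
    next
      case False
      hence "Pair x -` (h -` A) = {}" using slices[of x] by auto
      thus ?thesis by simp
    qed
  qed
  also have "\<dots> = ennreal (2 * w) * ennreal (2 * r)"
    using \<open>r \<ge> 0\<close> by (simp add: nn_integral_cmult_indicator)
  also have "\<dots> = ennreal (4 * r * w)" using \<open>r \<ge> 0\<close> \<open>w \<ge> 0\<close> by (simp add: ennreal_mult[symmetric] mult_ac)
  finally show ?thesis .
qed

text \<open>
  One of \<open>\<bar>Re e\<bar>\<close>, \<open>\<bar>Im e\<bar>\<close> is at least \<open>\<bar>e\<bar> / 2\<close>. In the corresponding coordinate direction
  the slices of the strip have length at most \<open>4 w\<close>, and the disc meets slices over an interval of length \<open>2 r\<close> only.
\<close>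

lemma strip_disc_area:
  fixes e a z :: complex
  assumes e: "e \<noteq> 0" and r: "r \<ge> 0" and w: "w \<ge> 0"
  shows "emeasure lborel (cball z r \<inter> {c. \<bar>Im (cnj e * (c - a))\<bar> \<le> w * cmod e}) \<le> ennreal (8 * r * w)"
proof -
  let ?A = "cball z r \<inter> {c. \<bar>Im (cnj e * (c - a))\<bar> \<le> w * cmod e}"
  have "closed {c. \<bar>Im (cnj e * (c - a))\<bar> \<le> w * cmod e}"
    by (intro closed_Collect_le continuous_intros)
  hence A: "?A \<in> sets borel" by (intro borel_closed closed_Int) auto
  have Im_eq: "Im (cnj e * (c - a)) = Re e * (Im c - Im a) - Im e * (Re c - Re a)" for c by simp
  have ball: "\<bar>Re c - Re z\<bar> \<le> r \<and> \<bar>Im c - Im z\<bar> \<le> r" if "c \<in> ?A" for c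
    using that abs_Re_le_cmod[of "c - z"] abs_Im_le_cmod[of "c - z"] by (auto simp: dist_norm norm_minus_commute)
  have near: "\<bar>y - v\<bar> \<le> 2 * w" if "\<bar>s * (y - v)\<bar> \<le> w * cmod e" "cmod e \<le> 2 * \<bar>s\<bar>" for y v s :: real
  proof -
    have "s \<noteq> 0" using that(2) e by auto
    have "\<bar>s\<bar> * \<bar>y - v\<bar> \<le> w * cmod e" using that(1) by (simp add: abs_mult)
    also have "\<dots> \<le> w * (2 * \<bar>s\<bar>)" using that(2) w by (intro mult_left_mono)
    finally have "\<bar>s\<bar> * \<bar>y - v\<bar> \<le> \<bar>s\<bar> * (2 * w)" by (simp add: mult_ac)
    thus ?thesis using \<open>s \<noteq> 0\<close> by simp
  qed
  have "cmod e \<le> \<bar>Re e\<bar> + \<bar>Im e\<bar>" by (rule cmod_le)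
  hence "cmod e \<le> 2 * \<bar>Re e\<bar> \<or> cmod e \<le> 2 * \<bar>Im e\<bar>" by linarith
  thus ?thesis
  proof
    assume s: "cmod e \<le> 2 * \<bar>Re e\<bar>"
    hence nz: "Re e \<noteq> 0" using e by auto
    have "emeasure lborel ?A \<le> ennreal (4 * r * (2 * w))"
    proof (rule emeasure_lborel_le_slices[OF _ lborel_complex_eq_distr(1) A r])
      show "(\<lambda>(x, y). Complex x y) \<in> borel_measurable (lborel \<Otimes>\<^sub>M lborel)" unfolding Complex_eq by measurable
      fix x y assume c: "(case (x, y) of (x, y) \<Rightarrow> Complex x y) \<in> ?A"
      have "Re e * (y - (Im a + Im e * (x - Re a) / Re e)) = Im (cnj e * (Complex x y - a))"
        unfolding Im_eq using nz by (simp add: field_simps)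
      hence "\<bar>y - (Im a + Im e * (x - Re a) / Re e)\<bar> \<le> 2 * w" using c s by (intro near[of "Re e"]) auto
      thus "\<bar>x - Re z\<bar> \<le> r \<and> \<bar>y - (Im a + Im e * (x - Re a) / Re e)\<bar> \<le> 2 * w"
        using ball[of "Complex x y"] c by simp
    qed (use w in simp)
    thus ?thesis by (simp add: mult_ac)
  next
    assume s: "cmod e \<le> 2 * \<bar>Im e\<bar>"
    hence nz: "Im e \<noteq> 0" using e by auto
    have "emeasure lborel ?A \<le> ennreal (4 * r * (2 * w))"
    proof (rule emeasure_lborel_le_slices[OF _ lborel_complex_eq_distr(2) A r])
      show "(\<lambda>(x, y). Complex y x) \<in> borel_measurable (lborel \<Otimes>\<^sub>M lborel)" unfolding Complex_eq by measurable
      fix x y assume c: "(case (x, y) of (x, y) \<Rightarrow> Complex y x) \<in> ?A"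
      have "Im e * (y - (Re a + Re e * (x - Im a) / Im e)) = - Im (cnj e * (Complex y x - a))"
        unfolding Im_eq using nz by (simp add: field_simps)
      hence "\<bar>y - (Re a + Re e * (x - Im a) / Im e)\<bar> \<le> 2 * w" using c s by (intro near[of "Im e"]) auto
      thus "\<bar>x - Im z\<bar> \<le> r \<and> \<bar>y - (Re a + Re e * (x - Im a) / Im e)\<bar> \<le> 2 * w"
        using ball[of "Complex y x"] c by simp
    qed (use w in simp)
    thus ?thesis by (simp add: mult_ac)
  qed
qed

lemma uniform_disc_strip:
  fixes e a z :: complex
  assumes e: "e \<noteq> 0" and r: "r > 0" and \<epsilon>: "\<epsilon> \<ge> 0"
  shows "emeasure (uniform_measure lborel (cball z r)) {c. \<bar>Im (cnj e * (c - a))\<bar> \<le> \<epsilon> * r * cmod e} \<le> ennreal (8 * \<epsilon>)"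
proof -
  let ?S = "{c. \<bar>Im (cnj e * (c - a))\<bar> \<le> \<epsilon> * r * cmod e}"
  have "closed ?S" by (intro closed_Collect_le continuous_intros)
  hence "emeasure (uniform_measure lborel (cball z r)) ?S = emeasure lborel (cball z r \<inter> ?S) / emeasure lborel (cball z r)"
    by (intro emeasure_uniform_measure) auto
  also have "\<dots> \<le> ennreal (8 * r * (\<epsilon> * r)) / ennreal (pi * r\<^sup>2)"
  proof -
    have "emeasure lborel (cball z r) = ennreal (pi * r\<^sup>2)"
      using r by (simp add: emeasure_cball eval_unit_ball_vol)
    moreover have "emeasure lborel (cball z r \<inter> ?S) \<le> ennreal (8 * r * (\<epsilon> * r))"
      by (rule strip_disc_area) (use e r \<epsilon> in auto)
    ultimately show ?thesis by (simp add: divide_right_mono_ennreal)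
  qed
  also have "\<dots> = ennreal (8 * r * (\<epsilon> * r) / (pi * r\<^sup>2))" using r \<epsilon> by (simp add: divide_ennreal)
  also have "8 * r * (\<epsilon> * r) / (pi * r\<^sup>2) = 8 * \<epsilon> / pi" using r by (simp add: power2_eq_square field_simps)
  also have "ennreal (8 * \<epsilon> / pi) \<le> ennreal (8 * \<epsilon>)"
    using \<epsilon> pi_ge_two by (intro ennreal_leI) (simp add: divide_le_eq mult_le_cancel_left1)
  finally show ?thesis .
qed

lemma uniform_disc_singleton:
  fixes z a :: complex
  shows "emeasure (uniform_measure lborel (cball z r)) {a} = 0"
  by (subst emeasure_uniform_measure) (auto simp: Int_insert_right)

lemma (in prob_space) indep_var_slices:
  assumes ind: "indep_var S X T Y" and E: "E \<in> sets (S \<Otimes>\<^sub>M T)"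
    and slices: "\<And>x. x \<in> space S \<Longrightarrow> emeasure M {w \<in> space M. (x, Y w) \<in> E} \<le> k"
  shows "emeasure M {w \<in> space M. (X w, Y w) \<in> E} \<le> k"
proof -
  have rv [measurable]: "random_variable S X" "random_variable T Y"
    and eq: "distr M S X \<Otimes>\<^sub>M distr M T Y = distr M (S \<Otimes>\<^sub>M T) (\<lambda>w. (X w, Y w))"
    using ind by (simp_all add: indep_var_distribution_eq)
  interpret X: prob_space "distr M S X" by (rule prob_space_distr) measurable
  interpret Y: prob_space "distr M T Y" by (rule prob_space_distr) measurable
  have "emeasure M {w \<in> space M. (X w, Y w) \<in> E} = emeasure (distr M (S \<Otimes>\<^sub>M T) (\<lambda>w. (X w, Y w))) E"
    using E by (subst emeasure_distr) (auto intro!: arg_cong[where f = "emeasure M"])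
  also have "\<dots> = (\<integral>\<^sup>+ x. emeasure (distr M T Y) (Pair x -` E) \<partial>distr M S X)"
    unfolding eq[symmetric] using E by (intro Y.emeasure_pair_measure_alt) simp
  also have "\<dots> \<le> (\<integral>\<^sup>+ x. k \<partial>distr M S X)"
  proof (rule nn_integral_mono)
    fix x assume "x \<in> space (distr M S X)"
    hence x: "x \<in> space S" by simp
    have "emeasure (distr M T Y) (Pair x -` E) = emeasure M {w \<in> space M. (x, Y w) \<in> E}"
      using E by (subst emeasure_distr) (auto intro!: arg_cong[where f = "emeasure M"] sets_Pair1)
    thus "emeasure (distr M T Y) (Pair x -` E) \<le> k" using slices[OF x] by simp
  qed
  also have "\<dots> = k" using X.emeasure_space_1 by simp
  finally show ?thesis .
qed

text \<open>
  The value of \<open>X k\<close> is duplicated so that both variables take values in the same type, as independence of a pair requires.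
\<close>

lemma (in prob_space) indep_vars_triple:
  assumes ind: "indep_vars (\<lambda>_. N) X I" and ijk: "i \<in> I" "j \<in> I" "k \<in> I" "i \<noteq> k" "j \<noteq> k"
  shows "indep_var (N \<Otimes>\<^sub>M N) (\<lambda>w. (X i w, X j w)) (N \<Otimes>\<^sub>M N) (\<lambda>w. (X k w, X k w))"
proof -
  have "indep_var (PiM {i, j} (\<lambda>_. N)) (\<lambda>w. restrict (\<lambda>i. X i w) {i, j}) (PiM {k} (\<lambda>_. N)) (\<lambda>w. restrict (\<lambda>i. X i w) {k})"
    by (rule indep_var_restrict[OF ind]) (use ijk in auto)
  hence "indep_var (N \<Otimes>\<^sub>M N) ((\<lambda>f. (f i, f j)) \<circ> (\<lambda>w. restrict (\<lambda>i. X i w) {i, j}))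
      (N \<Otimes>\<^sub>M N) ((\<lambda>f. (f k, f k)) \<circ> (\<lambda>w. restrict (\<lambda>i. X i w) {k}))"
    by (rule indep_var_compose) measurable
  thus ?thesis by (simp add: o_def)
qed

text \<open>
  A quantitative form of the Borel--Cantelli argument: for each \<open>n\<close> the union of the events has probability at most a constant divided
  by \<open>n + 1\<close>, so the intersection over \<open>n\<close> of these unions is a null set.
\<close>

lemma (in prob_space) AE_uniform_avoidance:
  assumes \<Lambda>: "countable \<Lambda>" "infinite \<Lambda>" and g: "g summable_on \<Lambda>" "\<And>l. l \<in> \<Lambda> \<Longrightarrow> g l \<ge> (0::real)"
    and B: "\<And>n l. l \<in> \<Lambda> \<Longrightarrow> B n l \<in> events" 
    and bound: "\<And>n l. l \<in> \<Lambda> \<Longrightarrow> prob (B n l) \<le> g l / real (Suc n)"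
  shows "AE w in M. \<exists>n. \<forall>l\<in>\<Lambda>. w \<notin> B n l"
proof -
  define e where "e = from_nat_into \<Lambda>"
  have e: "bij_betw e UNIV \<Lambda>" unfolding e_def by (rule bij_betw_from_nat_into[OF \<Lambda>])
  have e_in: "e i \<in> \<Lambda>" for i using e by (auto simp: bij_betw_def)
  have "(\<lambda>i. g (e i)) summable_on UNIV" using g(1) summable_on_reindex_bij_betw[OF e, of g] by simp
  hence sum_g: "summable (\<lambda>i. g (e i))" using g(2) e_in by (subst (asm) summable_on_UNIV_nonneg_real_iff) auto
  define S where "S = (\<Sum>i. g (e i))"
  define N where "N = (\<Inter>n. \<Union>i. B n (e i))"
  have N: "N \<in> events" unfolding N_def using B e_in by (intro sets.countable_INT' sets.countable_UN) auto
  have prob_le: "prob N \<le> S / real (Suc n)" for n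
  proof -
    have sum': "summable (\<lambda>i. g (e i) / real (Suc n))" by (rule summable_divide[OF sum_g])
    have sum_prob: "summable (\<lambda>i. prob (B n (e i)))"
      by (rule summable_comparison_test'[OF sum']) (use bound e_in in auto)
    have "prob N \<le> prob (\<Union>i. B n (e i))"
      using B e_in by (intro finite_measure_mono) (auto simp: N_def)
    also have "\<dots> \<le> (\<Sum>i. prob (B n (e i)))"
      using B e_in by (intro finite_measure_subadditive_countably sum_prob) auto
    also have "\<dots> \<le> (\<Sum>i. g (e i) / real (Suc n))"
      by (rule suminf_le[OF _ sum_prob sum']) (use bound e_in in auto)
    also have "\<dots> = S / real (Suc n)" unfolding S_def by (rule suminf_divide[OF sum_g])
    finally show ?thesis .
  qed
  have "(\<lambda>n. S / real (Suc n)) \<longlonglongrightarrow> 0" 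
    using tendsto_mult_right_zero[OF LIMSEQ_inverse_real_of_nat, of S] by (simp add: divide_inverse)
  hence "prob N \<le> 0" by (rule LIMSEQ_le_const) (use prob_le in auto)
  hence "prob N = 0" using measure_nonneg[of M N] by linarith
  hence "AE w in M. w \<notin> N" using N by (simp add: AE_iff_measurable[OF N] emeasure_eq_measure prob_eq_0)
  thus ?thesis
  proof eventually_elim
    case (elim w)
    then obtain n where "\<And>i. w \<notin> B n (e i)" by (auto simp: N_def)
    moreover have "\<Lambda> = range e" using e by (auto simp: bij_betw_def)
    ultimately show ?case by blast
  qed
qed

lemma (in prob_space) AE_uniform_disc_mem:
  fixes X :: "'a \<Rightarrow> complex"
  assumes X: "random_variable borel X" and unif: "distr M borel X = uniform_measure lborel (cball z r)"
  shows "AE w in M. X w \<in> cball z r"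
proof -
  have "AE v in distr M borel X. v \<in> cball z r"
    unfolding unif by (rule AE_uniform_measureI) auto
  thus ?thesis by (rule AE_distrD[OF X])
qed

lemma (in prob_space) AE_uniform_disc_neq:
  fixes X Y :: "'a \<Rightarrow> complex"
  assumes ind: "indep_var (borel \<Otimes>\<^sub>M borel) (\<lambda>w. (X w, X w)) (borel \<Otimes>\<^sub>M borel) (\<lambda>w. (Y w, Y w))"
    and Y: "random_variable borel Y"
    and unif: "distr M borel Y = uniform_measure lborel (cball z r)"
  shows "AE w in M. X w \<noteq> Y w"
proof -
  define E :: "((complex \<times> complex) \<times> (complex \<times> complex)) set" where "E = {u. fst (fst u) = fst (snd u)}"
  have E: "E \<in> sets ((borel \<Otimes>\<^sub>M borel) \<Otimes>\<^sub>M (borel \<Otimes>\<^sub>M borel))"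
  proof -
    have "closed E" unfolding E_def by (intro closed_Collect_eq continuous_intros)
    thus ?thesis unfolding borel_prod by simp
  qed
  have "emeasure M {w \<in> space M. ((X w, X w), (Y w, Y w)) \<in> E} \<le> 0"
  proof (rule indep_var_slices[OF ind E])
    fix p :: "complex \<times> complex"
    have "emeasure M {w \<in> space M. (p, (Y w, Y w)) \<in> E} = emeasure (distr M borel Y) {fst p}"
      using Y by (subst emeasure_distr) (auto simp: E_def intro!: arg_cong[where f = "emeasure M"])
    also have "\<dots> = 0" unfolding unif by (rule uniform_disc_singleton)
    finally show "emeasure M {w \<in> space M. (p, (Y w, Y w)) \<in> E} \<le> 0" by simp
  qed
  hence *: "emeasure M {w \<in> space M. X w = Y w} = 0" by (simp add: E_def)
  have rv: "random_variable (borel \<Otimes>\<^sub>M borel) (\<lambda>w. (X w, X w))" using ind by (rule indep_var_rv1)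
  have X: "random_variable borel X"
    using measurable_compose[OF rv measurable_fst] by simp
  have "{w \<in> space M. X w = Y w} \<in> events" using X Y by measurable
  thus ?thesis using * by (subst AE_iff_measurable[OF _ refl]) auto
qed

text \<open>
  Given two distinct points \<open>X\<close> and \<open>Y\<close>, the third point must avoid a strip around the line through them. The width of the strip does
  not depend on the distance of \<open>X\<close> and \<open>Y\<close>, hence neither does the bound.
\<close>

lemma (in prob_space) prob_near_collinear:
  fixes X Y W :: "'a \<Rightarrow> complex"
  assumes ind: "indep_var (borel \<Otimes>\<^sub>M borel) (\<lambda>w. (X w, Y w)) (borel \<Otimes>\<^sub>M borel) (\<lambda>w. (W w, W w))"
    and W: "random_variable borel W"
    and unif: "distr M borel W = uniform_measure lborel (cball z r)" and r: "r > 0" and \<epsilon>: "\<epsilon> \<ge> 0"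
  defines "B \<equiv> {w \<in> space M. X w \<noteq> Y w \<and> \<bar>Im (cnj (Y w - X w) * (W w - X w))\<bar> \<le> \<epsilon> * r * cmod (Y w - X w)}"
  shows "B \<in> events" "prob B \<le> 8 * \<epsilon>"
proof -
  define E :: "((complex \<times> complex) \<times> (complex \<times> complex)) set" where
    "E = {u. fst (fst u) \<noteq> snd (fst u)} \<inter>
         {u. \<bar>Im (cnj (snd (fst u) - fst (fst u)) * (fst (snd u) - fst (fst u)))\<bar> \<le> \<epsilon> * r * cmod (snd (fst u) - fst (fst u))}"
  have E: "E \<in> sets ((borel \<Otimes>\<^sub>M borel) \<Otimes>\<^sub>M (borel \<Otimes>\<^sub>M borel))"
  proof -
    have "open {u :: (complex \<times> complex) \<times> (complex \<times> complex). fst (fst u) \<noteq> snd (fst u)}"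
      by (intro open_Collect_neq continuous_intros)
    moreover have "closed {u :: (complex \<times> complex) \<times> (complex \<times> complex).
       \<bar>Im (cnj (snd (fst u) - fst (fst u)) * (fst (snd u) - fst (fst u)))\<bar> \<le> \<epsilon> * r * cmod (snd (fst u) - fst (fst u))}"
      by (intro closed_Collect_le continuous_intros)
    ultimately show ?thesis unfolding borel_prod E_def by (intro sets.Int borel_open borel_closed)
  qed
  have rv: "random_variable (borel \<Otimes>\<^sub>M borel) (\<lambda>w. (X w, Y w))" "random_variable (borel \<Otimes>\<^sub>M borel) (\<lambda>w. (W w, W w))"
    by (rule indep_var_rv1[OF ind], rule indep_var_rv2[OF ind])
  have B_eq: "B = {w \<in> space M. ((X w, Y w), (W w, W w)) \<in> E}" by (auto simp: B_def E_def)
  have "random_variable ((borel \<Otimes>\<^sub>M borel) \<Otimes>\<^sub>M (borel \<Otimes>\<^sub>M borel)) (\<lambda>w. ((X w, Y w), (W w, W w)))"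
    using rv by (rule measurable_Pair)
  from measurable_sets[OF this E] show B: "B \<in> events"
    unfolding B_eq by (simp add: vimage_def Int_def conj_commute)
  have "emeasure M B \<le> ennreal (8 * \<epsilon>)"
    unfolding B_eq
  proof (rule indep_var_slices[OF ind E])
    fix p :: "complex \<times> complex"
    show "emeasure M {w \<in> space M. (p, (W w, W w)) \<in> E} \<le> ennreal (8 * \<epsilon>)"
    proof (cases "fst p = snd p")
      case True
      hence "{w \<in> space M. (p, (W w, W w)) \<in> E} = {}" by (auto simp: E_def)
      thus ?thesis by (simp only: emeasure_empty zero_le)
    next
      case False
      let ?S = "{c. \<bar>Im (cnj (snd p - fst p) * (c - fst p))\<bar> \<le> \<epsilon> * r * cmod (snd p - fst p)}"
      have "closed ?S" by (intro closed_Collect_le continuous_intros)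
      hence "emeasure (distr M borel W) ?S = emeasure M {w \<in> space M. (p, (W w, W w)) \<in> E}"
        using W False by (subst emeasure_distr) (auto simp: E_def intro!: arg_cong[where f = "emeasure M"])
      moreover have "emeasure (distr M borel W) ?S \<le> ennreal (8 * \<epsilon>)"
        unfolding unif by (rule uniform_disc_strip) (use False r \<epsilon> in auto)
      ultimately show ?thesis by simp
    qed
  qed
  thus "prob B \<le> 8 * \<epsilon>" using \<epsilon> by (simp add: emeasure_eq_measure)
qed

theorem theorem2p9:
  fixes \<gamma> :: real and f :: "complex \<Rightarrow> real"
    and \<omega>\<^sub>1 \<omega>\<^sub>2 :: complex and \<Lambda> :: "complex set"
    and M :: "'a measure" and Z :: "complex \<Rightarrow> nat \<Rightarrow> 'a \<Rightarrow> complex"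
  assumes gamma: "\<gamma> > 2 * pi"
    and f: "\<And>z. f z = exp (- \<gamma> * (cmod z)\<^sup>2)"
    and periods: "lattice_periods \<omega>\<^sub>1 \<omega>\<^sub>2"
    and Lambda: "\<Lambda> = lattice \<omega>\<^sub>1 \<omega>\<^sub>2"
    and density: "lattice_density \<omega>\<^sub>1 \<omega>\<^sub>2 > 4"
    and prob: "prob_space M"
    and indep: "prob_space.indep_vars M (\<lambda>_. borel) (\<lambda>(z, l). Z z l) (\<Lambda> \<times> {1, 2, 3})"
    and uniform: "\<And>z l. z \<in> \<Lambda> \<Longrightarrow> l \<in> {1, 2, 3} \<Longrightarrow>
                    distr M borel (Z z l) = uniform_measure lborel (cball z (f z))"
  shows "AE w in M. gabor_uniqueness_set {Z z l w | z l. z \<in> \<Lambda> \<and> l \<in> {1, 2, 3}} L2"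
proof -
  interpret prob_space M by (rule prob)
  have area: "0 < lattice_area \<omega>\<^sub>1 \<omega>\<^sub>2" using periods by (rule lattice_periods_area_pos)
  have dens: "lattice_area \<omega>\<^sub>1 \<omega>\<^sub>2 < 1/2" 
    using density area by (simp add: lattice_density_def field_simps)
  define \<eta> where "\<eta> = (\<gamma> - 2 * pi) / 2"
  have \<eta>: "\<eta> > 0" "2 * pi + \<eta> < \<gamma>" using gamma by (auto simp: \<eta>_def field_simps)
  have rv: "random_variable borel (Z z l)" if "z \<in> \<Lambda>" "l \<in> {1, 2, 3}" for z l
    using indep that unfolding indep_vars_def by fastforce
  have ind3: "indep_var (borel \<Otimes>\<^sub>M borel) (\<lambda>w. (Z z i w, Z z j w)) (borel \<Otimes>\<^sub>M borel) (\<lambda>w. (Z z k w, Z z k w))" 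
    if "z \<in> \<Lambda>" "i \<in> {1, 2, 3}" "j \<in> {1, 2, 3}" "k \<in> {1, 2, 3}" "i \<noteq> k" "j \<noteq> k" for z i j k
    using indep_vars_triple[OF indep, of "(z, i)" "(z, j)" "(z, k)"] that by simp
  have f0: "f z > 0" for z by (simp add: f)
  have count: "countable \<Lambda>" unfolding Lambda by (rule countable_lattice)
  have inf: "infinite \<Lambda>"
  proof -
    have "\<omega>\<^sub>1 \<noteq> 0" using periods by (simp add: lattice_periods_def)
    hence "inj (\<lambda>n::nat. of_int (int n) * \<omega>\<^sub>1 + of_int 0 * \<omega>\<^sub>2)" by (auto simp: inj_def)
    hence "infinite (range (\<lambda>n::nat. of_int (int n) * \<omega>\<^sub>1 + of_int 0 * \<omega>\<^sub>2))" by (rule range_inj_infinite)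
    moreover have "range (\<lambda>n::nat. of_int (int n) * \<omega>\<^sub>1 + of_int 0 * \<omega>\<^sub>2) \<subseteq> \<Lambda>"
      unfolding Lambda lattice_def by blast
    ultimately show ?thesis using finite_subset by blast
  qed
  define e where "e = (\<lambda>z. exp (- \<eta> * (cmod z)\<^sup>2))"
  define B where "B = (\<lambda>n z. {w \<in> space M. Z z 1 w \<noteq> Z z 2 w \<and> 
     \<bar>Im (cnj (Z z 2 w - Z z 1 w) * (Z z 3 w - Z z 1 w))\<bar> \<le> (e z / real (Suc n)) * f z * cmod (Z z 2 w - Z z 1 w)})"
  have avoid: "AE w in M. \<exists>n. \<forall>z\<in>\<Lambda>. w \<notin> B n z"
  proof (rule AE_uniform_avoidance[OF count inf])
    show "(\<lambda>z. 8 * e z) summable_on \<Lambda>"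
      unfolding e_def Lambda by (intro summable_on_cmult_right summable_gaussian_lattice area \<eta>)
    fix z n assume z: "z \<in> \<Lambda>"
    show "0 \<le> 8 * e z" by (simp add: e_def)
    have \<epsilon>: "e z / real (Suc n) \<ge> 0" by (simp add: e_def)
    have "B n z \<in> events" "prob (B n z) \<le> 8 * (e z / real (Suc n))"
      unfolding B_def by (rule prob_near_collinear[OF ind3[OF z] rv[OF z] uniform[OF z] f0 \<epsilon>]; simp)+
    thus "B n z \<in> events" "prob (B n z) \<le> 8 * e z / real (Suc n)" by simp_all
  qed
  have disc: "AE w in M. \<forall>z\<in>\<Lambda>. \<forall>l\<in>{1, 2, 3}. Z z l w \<in> cball z (f z)"
    by (intro AE_ball_countable' AE_uniform_disc_mem rv uniform count) auto
  have neq: "AE w in M. \<forall>z\<in>\<Lambda>. Z z 1 w \<noteq> Z z 2 w"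
    by (intro AE_ball_countable' AE_uniform_disc_neq[OF ind3 rv uniform] count) auto
  show ?thesis
    using avoid disc neq AE_space
  proof eventually_elim
    case (elim w)
    then obtain n where n: "\<And>z. z \<in> \<Lambda> \<Longrightarrow> w \<notin> B n z" by blast
    have close: "cmod (Z z l w - z) \<le> exp (- \<gamma> * (cmod z)\<^sup>2)" if "z \<in> lattice \<omega>\<^sub>1 \<omega>\<^sub>2" "l \<in> {1, 2, 3}" for z l
    proof -
      have "Z z l w \<in> cball z (f z)" using elim(2) that unfolding Lambda by blast
      thus ?thesis by (simp add: dist_norm norm_minus_commute f)
    qed
    show ?case
    proof (rule gabor_uniqueness_from_triples[OF periods dens \<eta>, of "1 / real (Suc n)" "\<lambda>z. Z z 1 w" "\<lambda>z. Z z 2 w" "\<lambda>z. Z z 3 w"])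
      fix z assume z: "z \<in> lattice \<omega>\<^sub>1 \<omega>\<^sub>2"
      show "cmod (Z z 1 w - z) \<le> exp (- \<gamma> * (cmod z)\<^sup>2)" "cmod (Z z 2 w - z) \<le> exp (- \<gamma> * (cmod z)\<^sup>2)"
         "cmod (Z z 3 w - z) \<le> exp (- \<gamma> * (cmod z)\<^sup>2)"
        using close[OF z] by auto
      show "1 / real (Suc n) * exp (- \<eta> * (cmod z)\<^sup>2) * exp (- \<gamma> * (cmod z)\<^sup>2) * cmod (Z z 2 w - Z z 1 w)
        < \<bar>Im (cnj (Z z 2 w - Z z 1 w) * (Z z 3 w - Z z 1 w))\<bar>"
        using n[of z] z elim(3,4) by (simp add: B_def e_def f Lambda not_le del: of_nat_Suc)
      show "{Z z 1 w, Z z 2 w, Z z 3 w} \<subseteq> {Z z l w |z l. z \<in> \<Lambda> \<and> l \<in> {1, 2, 3}}"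
        using z unfolding Lambda by blast
    qed simp
  qed
qed

end
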